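(* Let $\Lambda$ be the $\mathfrak o_F$-lattice sequence in $V$ with $\Lambda(4i)=\varpi^iN_0$, $\Lambda(4i+1)=\varpi^iN_1$, $\Lambda(4i+2)=\varpi^iN_2$, $\Lambda(4i+3)=\varpi^{i+1}N_1^\#$ ($i\in\mathbf Z$), and let $n$ be a positive integer coprime to $4$. Let $[\Lambda,n,[n/2],\beta]$ and $[\Lambda,n,[n/2],\gamma]$ be fundamental skew strata. Suppose that there is an irreducible smooth representation of $G$ containing both $[\Lambda,n,[n/2],\beta]$ and $[\Lambda,n,[n/2],\gamma]$. Then $(P_{\Lambda,[n/2]+1},\psi_\gamma)$ is a $P_{\Lambda,0}$-conjugate of $(P_{\Lambda,[n/2]+1},\psi_\beta)$, i.e. there is $g\in P_{\Lambda,0}$ with $\psi_\gamma(x)=\psi_\beta(gxg^{-1})$ for all $x\in P_{\Lambda,[n/2]+1}$.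
   Context: Let $F_0$ be a non-archimedean local field of odd residual characteristic, with ring of integers $\mathfrak o_0$, maximal ideal $\mathfrak p_0$ and residue field $k_0$ of cardinality $q$. Let $\varepsilon\in\mathfrak o_0^\times$ be a nonsquare and $F=F_0[\sqrt\varepsilon]$ the unramified quadratic extension, with corresponding objects $\mathfrak o_F,\mathfrak p_F,k_F$; $x\mapsto\overline x$ is Galois conjugation, and $\varpi$ is a common uniformizer of $F_0$ and $F$. Let $V=F^4$ (column vectors) with standard basis $e_1,\dots,e_4$, $A=M_4(F)=\mathrm{End}_F(V)$ with matrix units $E_{ij}$, $H=E_{14}+E_{23}+E_{32}+E_{41}$, $f(x,y)={}^t\overline xHy$ on $V$, $\sigma(X)=H^{-1}\,{}^t\overline X H$ on $A$, $G=U(2,2)=\{g\in GL_4(F): g\sigma(g)=1\}$ and $\mathfrak g=\{X\in A: X+\sigma(X)=0\}$. An $\mathfrak o_F$-lattice sequence in $V$ is a function $\Lambda$ from $\mathbf Z$ to the set of $\mathfrak o_F$-lattices in $V$ with $\Lambda(i)\supseteq\Lambda(i+1)$ for all $i$ and for which there is a positive integer $e(\Lambda)$ (the period) with $\varpi\Lambda(i)=\Lambda(i+e(\Lambda))$ for all $i$. For a lattice $L$, $L^\#=\{v\in V: f(v,L)\subset\mathfrak o_F\}$. $\Lambda$ is self-dual if there is an integer $d(\Lambda)$ with $\Lambda(i)^\#=\Lambda(d(\Lambda)-i)$ for all $i$. Put $N_0=\mathfrak o_Fe_1\oplus\mathfrak o_Fe_2\oplus\mathfrak o_Fe_3\oplus\mathfrak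 o_Fe_4$, $N_1=\mathfrak o_Fe_1\oplus\mathfrak o_Fe_2\oplus\mathfrak o_Fe_3\oplus\mathfrak p_Fe_4$, $N_2=\mathfrak o_Fe_1\oplus\mathfrak o_Fe_2\oplus\mathfrak p_Fe_3\oplus\mathfrak p_Fe_4$. For a lattice sequence $\Lambda$ put $\mathfrak a_n(\Lambda)=\{X\in A: X\Lambda(i)\subset\Lambda(i+n)\ \forall i\}$. For $\Lambda$ self-dual put $\mathfrak g_{\Lambda,n}=\mathfrak g\cap\mathfrak a_n(\Lambda)$, $P_{\Lambda,0}=G\cap\mathfrak a_0(\Lambda)$ and $P_{\Lambda,n}=G\cap(1+\mathfrak a_n(\Lambda))$ for $n\ge1$ (an open normal subgroup of $P_{\Lambda,0}$). A stratum is a 4-tuple $[\Lambda,n,r,\beta]$ with $\Lambda$ an $\mathfrak o_F$-lattice sequence in $V$, integers $n>r\ge0$ and $\beta\in\mathfrak a_{-n}(\Lambda)$; it is skew if $\Lambda$ is self-dual and $\beta\in\mathfrak g_{\Lambda,-n}$. With $k=\gcd(e(\Lambda),n)$ put $y_\beta=\varpi^{n/k}\beta^{e(\Lambda)/k}\in\mathfrak a_0(\Lambda)$; its characteristic polynomial $\Phi_\beta(X)$ lies in $\mathfrak o_F[X]$ and $\phi_\beta(X)\in k_F[X]$ denotes its reduction modulo $\mathfrak p_F$. The stratum is fundamental if $\phi_\beta(X)\ne X^4$. Fix an additive character $\Omega$ of $F_0$ with conductor $\mathfrak p_0$ (trivial on $\mathfrak p_0$, not on $\mathfrak o_0$), and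 let $\mathrm{tr}_{A/F_0}=\mathrm{tr}_{F/F_0}\circ\mathrm{tr}_{A/F}$. For a skew stratum with $n>r\ge[n/2]$, $\psi_\beta(p)=\Omega(\mathrm{tr}_{A/F_0}(\beta(p-1)))$ is a character of $P_{\Lambda,r+1}$ trivial on $P_{\Lambda,n+1}$. A smooth complex representation $\pi$ of $G$ contains $[\Lambda,n,r,\beta]$ (with $n>r\ge[n/2]$) if the restriction of $\pi$ to $P_{\Lambda,r+1}$ contains $\psi_\beta$. *)

theory Defs
  imports
    "HOL-Analysis.Determinants"
    "HOL-Library.Numeral_Type"
    "HOL-Computational_Algebra.Polynomial"
    "HOL-Algebra.QuotRing"
    "HOL-Algebra.UnivPoly"
begin

section \<open>Local fields\<close>

text \<open>
  A valuation is a function \<open>v\<close> into the integers whose value at \<open>0\<close> is irrelevant.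
  Fields are subfields \<open>K\<close> of an ambient field type, so that an extension and its base
  field live in the same type and share the valuation.
\<close>

definition val_ideal :: "('f::field \<Rightarrow> int) \<Rightarrow> int \<Rightarrow> 'f set" where
  "val_ideal v m = {x. x = 0 \<or> m \<le> v x}"

definition val_ring :: "'f::field set \<Rightarrow> ('f \<Rightarrow> int) \<Rightarrow> 'f ring" where
  "val_ring K v =
     \<lparr>carrier = K \<inter> val_ideal v 0, mult = (*), one = 1, zero = 0, add = (+)\<rparr>"

definition residue_field :: "'f::field set \<Rightarrow> ('f \<Rightarrow> int) \<Rightarrow> 'f set ring" where
  "residue_field K v = val_ring K v Quot (K \<inter> val_ideal v 1)"

definition residue_char :: "'f::field set \<Rightarrow> ('f \<Rightarrow> int) \<Rightarrow> nat" where
  "residue_char K v = (LEAST p. 0 < p \<and>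
     [p] \<cdot>\<^bsub>residue_field K v\<^esub> \<one>\<^bsub>residue_field K v\<^esub> = \<zero>\<^bsub>residue_field K v\<^esub>)"

locale discretely_valued_field =
  fixes K :: "'f::field set" and v :: "'f \<Rightarrow> int"
  assumes one_mem: "1 \<in> K"
    and diff_mem: "\<lbrakk>x \<in> K; y \<in> K\<rbrakk> \<Longrightarrow> x - y \<in> K"
    and mult_mem: "\<lbrakk>x \<in> K; y \<in> K\<rbrakk> \<Longrightarrow> x * y \<in> K"
    and inverse_mem: "x \<in> K \<Longrightarrow> inverse x \<in> K"
    and v_mult: "\<lbrakk>x \<in> K; y \<in> K; x \<noteq> 0; y \<noteq> 0\<rbrakk> \<Longrightarrow> v (x * y) = v x + v y"
    and v_add: "\<lbrakk>x \<in> K; y \<in> K; x \<noteq> 0; y \<noteq> 0; x + y \<noteq> 0\<rbrakk> \<Longrightarrow> min (v x) (v y) \<le> v (x + y)"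
    and v_normalized: "\<exists>x\<in>K. x \<noteq> 0 \<and> v x = 1"

locale nonarch_local_field = discretely_valued_field K v
  for K :: "'f::field set" and v :: "'f \<Rightarrow> int" +
  assumes complete:
      "\<And>X :: nat \<Rightarrow> 'f. \<lbrakk>range X \<subseteq> K; \<And>N. \<exists>M. \<forall>m\<ge>M. \<forall>n\<ge>M. X m - X n \<in> val_ideal v N\<rbrakk>
         \<Longrightarrow> \<exists>L\<in>K. \<forall>N. \<exists>M. \<forall>n\<ge>M. X n - L \<in> val_ideal v N"
    and finite_residue_field: "finite (carrier (residue_field K v))"

text \<open>
  The field \<open>F\<close> is the whole type, \<open>s\<close> is the chosen square root of \<open>\<epsilon>\<close>, and \<open>cj\<close> is Galois
  conjugation. As \<open>F\<close> is unramified over \<open>F0\<close>, the normalized valuation of \<open>F\<close> restricts to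
  that of \<open>F0\<close>.
\<close>

locale unramified_quadratic_extension =
  base: nonarch_local_field F0 v + ext: discretely_valued_field UNIV v
  for F0 :: "'f::field set" and v :: "'f \<Rightarrow> int" +
  fixes \<epsilon> s \<pi> :: 'f and cj :: "'f \<Rightarrow> 'f"
  assumes odd_residue_char: "odd (residue_char F0 v)"
    and unit: "\<epsilon> \<in> F0" "\<epsilon> \<noteq> 0" "v \<epsilon> = 0"
    and nonsquare: "\<not> (\<exists>y\<in>F0. y\<^sup>2 = \<epsilon>)"
    and sqrt: "s\<^sup>2 = \<epsilon>"
    and generates: "\<And>x. \<exists>a\<in>F0. \<exists>b\<in>F0. x = a + b * s"
    and conjugation: "\<And>a b. \<lbrakk>a \<in> F0; b \<in> F0\<rbrakk> \<Longrightarrow> cj (a + b * s) = a - b * s"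
    and uniformizer: "\<pi> \<in> F0" "\<pi> \<noteq> 0" "v \<pi> = 1"

text \<open>A character of a local field that is trivial on the maximal ideal is automatically continuous.\<close>

definition char_of_conductor_p ::
    "'f::field set \<Rightarrow> ('f \<Rightarrow> int) \<Rightarrow> ('f \<Rightarrow> complex) \<Rightarrow> bool" where
  "char_of_conductor_p K v \<Omega> \<longleftrightarrow>
     (\<forall>x\<in>K. \<forall>y\<in>K. \<Omega> (x + y) = \<Omega> x * \<Omega> y) \<and>
     (\<forall>x\<in>K \<inter> val_ideal v 1. \<Omega> x = 1) \<and>
     (\<exists>x\<in>K \<inter> val_ideal v 0. \<Omega> x \<noteq> 1)"


section \<open>The unitary group\<close>

text \<open>
  Multiplication and powers from the type classes are componentwise on \<open>'f^4^4\<close>; the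
  algebra \<open>A\<close> uses \<open>(**)\<close> and \<open>mat 1\<close>.
\<close>

definition herm_matrix :: "'f::field^4^4" where
  "herm_matrix = (\<chi> i j. if (i, j) \<in> {(1,4), (2,3), (3,2), (4,1)} then 1 else 0)"

definition herm :: "('f::field \<Rightarrow> 'f) \<Rightarrow> 'f^4 \<Rightarrow> 'f^4 \<Rightarrow> 'f" where
  "herm cj x y = (\<Sum>i\<in>UNIV. cj (x $ i) * (herm_matrix *v y) $ i)"

definition sigma_inv :: "('f::field \<Rightarrow> 'f) \<Rightarrow> 'f^4^4 \<Rightarrow> 'f^4^4" where
  "sigma_inv cj X = matrix_inv herm_matrix ** transpose (\<chi> i j. cj (X $ i $ j)) ** herm_matrix"

definition U22 :: "('f::field \<Rightarrow> 'f) \<Rightarrow> ('f^4^4) set" where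
  "U22 cj = {g. invertible g \<and> g ** sigma_inv cj g = mat 1}"

definition u22_lie :: "('f::field \<Rightarrow> 'f) \<Rightarrow> ('f^4^4) set" where
  "u22_lie cj = {X. X + sigma_inv cj X = 0}"


section \<open>Lattice sequences\<close>

definition is_lattice :: "('f::field \<Rightarrow> int) \<Rightarrow> ('f^4) set \<Rightarrow> bool" where
  "is_lattice v L \<longleftrightarrow> (\<exists>B. finite B \<and> vec.span B = UNIV \<and>
     L = {\<Sum>b\<in>B. c b *s b |c. \<forall>b\<in>B. c b \<in> val_ideal v 0})"

definition lattice_scale :: "'f::field \<Rightarrow> ('f^4) set \<Rightarrow> ('f^4) set" where
  "lattice_scale c L = (\<lambda>x. c *s x) ` L"

definition dual_lattice ::
    "('f::field \<Rightarrow> int) \<Rightarrow> ('f \<Rightarrow> 'f) \<Rightarrow> ('f^4) set \<Rightarrow> ('f^4) set" where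
  "dual_lattice v cj L = {x. \<forall>y\<in>L. herm cj x y \<in> val_ideal v 0}"

definition is_period :: "'f::field \<Rightarrow> (int \<Rightarrow> ('f^4) set) \<Rightarrow> nat \<Rightarrow> bool" where
  "is_period \<pi> \<Lambda> e \<longleftrightarrow> 0 < e \<and> (\<forall>i. lattice_scale \<pi> (\<Lambda> i) = \<Lambda> (i + int e))"

definition lattice_sequence ::
    "('f::field \<Rightarrow> int) \<Rightarrow> 'f \<Rightarrow> (int \<Rightarrow> ('f^4) set) \<Rightarrow> bool" where
  "lattice_sequence v \<pi> \<Lambda> \<longleftrightarrow>
     (\<forall>i. is_lattice v (\<Lambda> i)) \<and> (\<forall>i. \<Lambda> (i + 1) \<subseteq> \<Lambda> i) \<and> (\<exists>e. is_period \<pi> \<Lambda> e)"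

text \<open>The period of a lattice sequence is unique, since \<open>\<pi>L\<close> is strictly smaller than \<open>L\<close>.\<close>

definition period :: "'f::field \<Rightarrow> (int \<Rightarrow> ('f^4) set) \<Rightarrow> nat" where
  "period \<pi> \<Lambda> = (THE e. is_period \<pi> \<Lambda> e)"

definition self_dual ::
    "('f::field \<Rightarrow> int) \<Rightarrow> ('f \<Rightarrow> 'f) \<Rightarrow> (int \<Rightarrow> ('f^4) set) \<Rightarrow> bool" where
  "self_dual v cj \<Lambda> \<longleftrightarrow> (\<exists>d. \<forall>i. dual_lattice v cj (\<Lambda> i) = \<Lambda> (d - i))"

definition N0 :: "('f::field \<Rightarrow> int) \<Rightarrow> ('f^4) set" where
  "N0 v = {x. x $ 1 \<in> val_ideal v 0 \<and> x $ 2 \<in> val_ideal v 0 \<and>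
              x $ 3 \<in> val_ideal v 0 \<and> x $ 4 \<in> val_ideal v 0}"

definition N1 :: "('f::field \<Rightarrow> int) \<Rightarrow> ('f^4) set" where
  "N1 v = {x. x $ 1 \<in> val_ideal v 0 \<and> x $ 2 \<in> val_ideal v 0 \<and>
              x $ 3 \<in> val_ideal v 0 \<and> x $ 4 \<in> val_ideal v 1}"

definition N2 :: "('f::field \<Rightarrow> int) \<Rightarrow> ('f^4) set" where
  "N2 v = {x. x $ 1 \<in> val_ideal v 0 \<and> x $ 2 \<in> val_ideal v 0 \<and>
              x $ 3 \<in> val_ideal v 1 \<and> x $ 4 \<in> val_ideal v 1}"


section \<open>Filtrations and strata\<close>

definition a_filt :: "(int \<Rightarrow> ('f::field^4) set) \<Rightarrow> int \<Rightarrow> ('f^4^4) set" where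
  "a_filt \<Lambda> m = {X. \<forall>i. (\<lambda>x. X *v x) ` \<Lambda> i \<subseteq> \<Lambda> (i + m)}"

definition g_filt ::
    "('f::field \<Rightarrow> 'f) \<Rightarrow> (int \<Rightarrow> ('f^4) set) \<Rightarrow> int \<Rightarrow> ('f^4^4) set" where
  "g_filt cj \<Lambda> m = u22_lie cj \<inter> a_filt \<Lambda> m"

definition P_filt ::
    "('f::field \<Rightarrow> 'f) \<Rightarrow> (int \<Rightarrow> ('f^4) set) \<Rightarrow> nat \<Rightarrow> ('f^4^4) set" where
  "P_filt cj \<Lambda> m = (if m = 0 then U22 cj \<inter> a_filt \<Lambda> 0
     else U22 cj \<inter> (\<lambda>X. mat 1 + X) ` a_filt \<Lambda> (int m))"

definition stratum ::
    "('f::field \<Rightarrow> int) \<Rightarrow> 'f \<Rightarrow> (int \<Rightarrow> ('f^4) set) \<Rightarrow> nat \<Rightarrow> nat \<Rightarrow> 'f^4^4 \<Rightarrow> bool" where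
  "stratum v \<pi> \<Lambda> n r \<beta> \<longleftrightarrow>
     lattice_sequence v \<pi> \<Lambda> \<and> r < n \<and> \<beta> \<in> a_filt \<Lambda> (- int n)"

definition skew_stratum ::
    "('f::field \<Rightarrow> int) \<Rightarrow> ('f \<Rightarrow> 'f) \<Rightarrow> 'f \<Rightarrow> (int \<Rightarrow> ('f^4) set) \<Rightarrow> nat \<Rightarrow> nat \<Rightarrow> 'f^4^4 \<Rightarrow> bool" where
  "skew_stratum v cj \<pi> \<Lambda> n r \<beta> \<longleftrightarrow>
     stratum v \<pi> \<Lambda> n r \<beta> \<and> self_dual v cj \<Lambda> \<and> \<beta> \<in> g_filt cj \<Lambda> (- int n)"

definition matrix_power :: "'f::field^4^4 \<Rightarrow> nat \<Rightarrow> 'f^4^4" where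
  "matrix_power X m = (((**) X) ^^ m) (mat 1)"

definition charpoly :: "'f::field^4^4 \<Rightarrow> 'f poly" where
  "charpoly X = det (\<chi> i j. (if i = j then [:0, 1:] else 0) - [:X $ i $ j:])"

definition y_elt :: "'f::field \<Rightarrow> (int \<Rightarrow> ('f^4) set) \<Rightarrow> nat \<Rightarrow> 'f^4^4 \<Rightarrow> 'f^4^4" where
  "y_elt \<pi> \<Lambda> n \<beta> = (let k = gcd (period \<pi> \<Lambda>) n in
     mat (\<pi> ^ (n div k)) ** matrix_power \<beta> (period \<pi> \<Lambda> div k))"

text \<open>
  Coefficientwise reduction, landing in \<open>UP (residue_field UNIV v)\<close>, whose elements are the
  coefficient sequences. It is meaningful for polynomials with integral coefficients.
\<close>

definition reduce_poly :: "('f::field \<Rightarrow> int) \<Rightarrow> 'f poly \<Rightarrow> nat \<Rightarrow> 'f set" where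
  "reduce_poly v p = (\<lambda>i. val_ideal v 1 +>\<^bsub>val_ring UNIV v\<^esub> Polynomial.coeff p i)"

definition fundamental ::
    "('f::field \<Rightarrow> int) \<Rightarrow> 'f \<Rightarrow> (int \<Rightarrow> ('f^4) set) \<Rightarrow> nat \<Rightarrow> 'f^4^4 \<Rightarrow> bool" where
  "fundamental v \<pi> \<Lambda> n \<beta> \<longleftrightarrow>
     reduce_poly v (charpoly (y_elt \<pi> \<Lambda> n \<beta>)) \<noteq>
       up_ring.monom (UP (residue_field UNIV v)) \<one>\<^bsub>residue_field UNIV v\<^esub> 4"

text \<open>For \<open>z\<close> in \<open>F\<close>, the trace to \<open>F0\<close> is \<open>z + cj z\<close>.\<close>

definition psi :: "('f::field \<Rightarrow> complex) \<Rightarrow> ('f \<Rightarrow> 'f) \<Rightarrow> 'f^4^4 \<Rightarrow> 'f^4^4 \<Rightarrow> complex" where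
  "psi \<Omega> cj \<beta> p = (let z = trace (\<beta> ** (p - mat 1)) in \<Omega> (z + cj z))"


section \<open>Representations\<close>

definition open_in_group ::
    "('f::field \<Rightarrow> int) \<Rightarrow> ('f^4^4) set \<Rightarrow> ('f^4^4) set \<Rightarrow> bool" where
  "open_in_group v G U \<longleftrightarrow> U \<subseteq> G \<and>
     (\<forall>g\<in>U. \<exists>N. \<forall>h\<in>G. (\<forall>i j. h $ i $ j - g $ i $ j \<in> val_ideal v N) \<longrightarrow> h \<in> U)"

text \<open>Representations of \<open>G\<close> on a complex vector space given by a type and its scalar action.\<close>

locale group_rep = vector_space smul
  for smul :: "complex \<Rightarrow> 'w::ab_group_add \<Rightarrow> 'w" +
  fixes G :: "('f::field^4^4) set" and \<rho> :: "'f^4^4 \<Rightarrow> 'w \<Rightarrow> 'w"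
  assumes rep_linear: "g \<in> G \<Longrightarrow> Vector_Spaces.linear smul smul (\<rho> g)"
    and rep_one: "\<rho> (mat 1) = id"
    and rep_mult: "\<lbrakk>g \<in> G; h \<in> G\<rbrakk> \<Longrightarrow> \<rho> (g ** h) = \<rho> g \<circ> \<rho> h"

locale irreducible_smooth_rep = group_rep smul G \<rho>
  for smul :: "complex \<Rightarrow> 'w::ab_group_add \<Rightarrow> 'w"
    and G :: "('f::field^4^4) set" and \<rho> :: "'f^4^4 \<Rightarrow> 'w \<Rightarrow> 'w" +
  fixes v :: "'f \<Rightarrow> int"
  assumes smooth: "\<And>w. open_in_group v G {g \<in> G. \<rho> g w = w}"
    and nonzero: "\<exists>w::'w. w \<noteq> 0"
    and irreducible: "\<And>W. \<lbrakk>subspace W; \<And>g. g \<in> G \<Longrightarrow> \<rho> g ` W \<subseteq> W\<rbrakk> \<Longrightarrow> W = {0} \<or> W = UNIV"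

definition rep_contains ::
    "(complex \<Rightarrow> 'w::ab_group_add \<Rightarrow> 'w) \<Rightarrow> ('f::field^4^4 \<Rightarrow> 'w \<Rightarrow> 'w) \<Rightarrow>
     ('f \<Rightarrow> complex) \<Rightarrow> ('f \<Rightarrow> 'f) \<Rightarrow> (int \<Rightarrow> ('f^4) set) \<Rightarrow> nat \<Rightarrow> 'f^4^4 \<Rightarrow> bool" where
  "rep_contains smul \<rho> \<Omega> cj \<Lambda> r \<beta> \<longleftrightarrow>
     (\<exists>w. w \<noteq> 0 \<and> (\<forall>p\<in>P_filt cj \<Lambda> (r + 1). \<rho> p w = smul (psi \<Omega> cj \<beta> p) w))"

end

theory Submission
  imports Defs
begin

text \<open>
  The chain \<open>\<Lambda>\<close> is a full chain of period \<open>4\<close>: its graded pieces \<open>\<Lambda> i / \<Lambda> (i + 1)\<close> are lines over the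
  residue field. A fundamental \<open>\<beta>\<close> of level \<open>n\<close> coprime to \<open>4\<close> therefore acts on them by nonzero
  maps (lemma \<open>fundamental_shifts\<close>), that is, it translates levels by exactly \<open>- n\<close>, and
  so does every element of \<open>\<beta> + a_filt \<Lambda> (1 - n)\<close>. Such an element generates a totally ramified extension
  of degree \<open>4\<close>, whose lattices in \<open>V\<close> form a single chain; so it can translate the levels of two
  chains only if they are the same chain up to numbering.

  Write \<open>r = n div 2\<close>. If an irreducible representation contains both strata, averaging over the compact group
  \<open>P_filt cj \<Lambda> (r + 1)\<close> yields a \<open>g\<close> in the unitary group for which \<open>\<psi>\<^sub>\<gamma>\<close> and the
  \<open>g\<close>-conjugate of \<open>\<psi>\<^sub>\<beta>\<close> agree where both are defined (\<open>intertwining_element_exists\<close>). The Cayley transform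
  turns this into a statement about the trace pairing on a lattice of the Lie algebra, and duality of
  lattices gives a common element of \<open>\<gamma> + a_filt \<Lambda> (- r)\<close> and \<open>g (\<beta> + a_filt \<Lambda> (- r)) g\<inverse>\<close>
  (\<open>intertwining_decomposition\<close>).

  This common element translates the levels of \<open>\<Lambda>\<close> and of \<open>g\<Lambda>\<close> by \<open>- n\<close>. Hence \<open>g\<Lambda>\<close> is \<open>\<Lambda>\<close>
  renumbered (\<open>conjugate_shifts_normalizes\<close>), and since a unitary \<open>g\<close> respects duality, which
  reverses the numbering, \<open>g\<close> fixes each \<open>\<Lambda> i\<close> (\<open>unitary_shift_zero\<close>). Then \<open>g\<close> normalizes
  \<open>P_filt cj \<Lambda> (r + 1)\<close>, so the two characters agree on the whole group.
\<close>


section \<open>Arithmetic of a discrete valuation\<close>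

locale discrete_valuation = discretely_valued_field UNIV v for v :: "'f::field \<Rightarrow> int"
begin

lemma val_mult: "x \<noteq> 0 \<Longrightarrow> y \<noteq> 0 \<Longrightarrow> v (x * y) = v x + v y"
  using v_mult by simp

lemma val_one: "v 1 = 0"
  using val_mult[of 1 1] by simp

lemma val_minus: "v (- x) = v x"
proof (cases "x = 0")
  case False
  have "v (- 1) + v (- 1) = v ((- 1) * (- 1))"
    by (subst val_mult) simp_all
  then have "v (- 1) = 0"
    by (simp add: val_one)
  then show ?thesis
    using val_mult[of "- 1" x] False by simp
qed simp

lemma val_inverse: "x \<noteq> 0 \<Longrightarrow> v (inverse x) = - v x"
  using val_mult[of x "inverse x"] by (simp add: val_one)

lemma val_divide: "x \<noteq> 0 \<Longrightarrow> y \<noteq> 0 \<Longrightarrow> v (x / y) = v x - v y"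
  by (simp add: divide_inverse val_mult val_inverse)

lemma val_power: "x \<noteq> 0 \<Longrightarrow> v (x ^ n) = int n * v x"
  by (induction n) (simp_all add: val_one val_mult algebra_simps)

lemma val_powi: "x \<noteq> 0 \<Longrightarrow> v (x powi k) = k * v x"
  by (simp add: power_int_def val_power val_inverse flip: power_inverse)

lemma val_ideal_zero [simp]: "0 \<in> val_ideal v m"
  by (simp add: val_ideal_def)

lemma one_in_val_ideal [simp]: "1 \<in> val_ideal v 0"
  by (simp add: val_ideal_def val_one)

lemma val_ideal_add:
  assumes "x \<in> val_ideal v m" "y \<in> val_ideal v m"
  shows "x + y \<in> val_ideal v m"
  using assms v_add[of x y] by (fastforce simp: val_ideal_def)

lemma val_ideal_minus_iff [simp]: "- x \<in> val_ideal v m \<longleftrightarrow> x \<in> val_ideal v m"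
  by (simp add: val_ideal_def val_minus)

lemma val_ideal_diff:
  assumes "x \<in> val_ideal v m" "y \<in> val_ideal v m"
  shows "x - y \<in> val_ideal v m"
  using val_ideal_add[OF assms(1), of "- y"] assms(2) by simp

lemma val_ideal_sum: "(\<And>i. i \<in> I \<Longrightarrow> f i \<in> val_ideal v m) \<Longrightarrow> sum f I \<in> val_ideal v m"
  by (induction I rule: infinite_finite_induct) (auto intro: val_ideal_add)

lemma val_ideal_mult:
  assumes "x \<in> val_ideal v m" "y \<in> val_ideal v k"
  shows "x * y \<in> val_ideal v (m + k)"
  using assms by (cases "x = 0 \<or> y = 0") (auto simp: val_ideal_def val_mult)

lemma val_ideal_mono: "x \<in> val_ideal v m \<Longrightarrow> k \<le> m \<Longrightarrow> x \<in> val_ideal v k"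
  by (auto simp: val_ideal_def)

lemma val_ideal_mult_left_iff:
  "c \<noteq> 0 \<Longrightarrow> c * x \<in> val_ideal v m \<longleftrightarrow> x \<in> val_ideal v (m - v c)"
  by (cases "x = 0") (auto simp: val_ideal_def val_mult)

lemma val_ideal_integral_mult:
  "x \<in> val_ideal v 0 \<Longrightarrow> y \<in> val_ideal v m \<Longrightarrow> x * y \<in> val_ideal v m"
  using val_ideal_mult[of x 0 y m] by simp

lemma val_ideal_Inter_zero: "(\<And>N. x \<in> val_ideal v N) \<Longrightarrow> x = 0"
  unfolding val_ideal_def by (metis (mono_tags, lifting) less_irrefl mem_Collect_eq zless_add1_eq add1_zle_eq)

end

sublocale unramified_quadratic_extension \<subseteq> discrete_valuation v
  by (rule discrete_valuation.intro) (rule ext.discretely_valued_field_axioms)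


section \<open>Conjugation preserves the valuation\<close>

context unramified_quadratic_extension
begin

lemma base_zero: "0 \<in> F0"
  using base.diff_mem[OF base.one_mem base.one_mem] by simp

lemma base_minus: "x \<in> F0 \<Longrightarrow> - x \<in> F0"
  using base.diff_mem[OF base_zero] by simp

lemma base_add: "x \<in> F0 \<Longrightarrow> y \<in> F0 \<Longrightarrow> x + y \<in> F0"
  using base.diff_mem[of x "- y"] base_minus by simp

lemma base_divide: "x \<in> F0 \<Longrightarrow> y \<in> F0 \<Longrightarrow> x / y \<in> F0"
  by (simp add: divide_inverse base.mult_mem base.inverse_mem)

lemma base_two: "2 \<in> F0"
  using base_add[OF base.one_mem base.one_mem] by simp

text \<open>
  If \<open>2\<close> were in the maximal ideal, then \<open>1 + 1 = 0\<close> in the residue field, whose characteristic would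
  be at most \<open>2\<close>, hence \<open>1\<close> as it is odd.
\<close>

lemma two_notin_max: "2 \<notin> val_ideal v 1"
proof
  assume two: "2 \<in> val_ideal v 1"
  let ?I = "F0 \<inter> val_ideal v 1" and ?R = "residue_field F0 v"
  have zero: "\<zero>\<^bsub>?R\<^esub> = ?I"
    by (simp add: residue_field_def FactRing_def val_ring_def)
  have one: "\<one>\<^bsub>?R\<^esub> = {i + 1 | i. i \<in> ?I}"
    by (auto simp: residue_field_def FactRing_def val_ring_def a_r_coset_defs)
  have add: "A \<oplus>\<^bsub>?R\<^esub> B = {a + b | a b. a \<in> A \<and> b \<in> B}" for A B
    by (auto simp: residue_field_def FactRing_def val_ring_def set_add_def set_mult_def)
  have Iadd: "x \<in> ?I \<Longrightarrow> y \<in> ?I \<Longrightarrow> x + y \<in> ?I" for x y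
    using base_add val_ideal_add by blast
  have n1: "add_pow ?R (1::nat) \<one>\<^bsub>?R\<^esub> = \<zero>\<^bsub>?R\<^esub> \<oplus>\<^bsub>?R\<^esub> \<one>\<^bsub>?R\<^esub>"
    by (simp add: add_pow_def nat_pow_def)
  have n2: "add_pow ?R (2::nat) \<one>\<^bsub>?R\<^esub> = (\<zero>\<^bsub>?R\<^esub> \<oplus>\<^bsub>?R\<^esub> \<one>\<^bsub>?R\<^esub>) \<oplus>\<^bsub>?R\<^esub> \<one>\<^bsub>?R\<^esub>"
    by (simp add: add_pow_def nat_pow_def numeral_2_eq_2)
  have I2: "2 \<in> ?I"
    using two base_two by simp
  have "add_pow ?R (2::nat) \<one>\<^bsub>?R\<^esub> = ?I"
  proof (rule Set.set_eqI, rule iffI)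
    fix x assume "x \<in> add_pow ?R (2::nat) \<one>\<^bsub>?R\<^esub>"
    then have "x \<in> (\<zero>\<^bsub>?R\<^esub> \<oplus>\<^bsub>?R\<^esub> \<one>\<^bsub>?R\<^esub>) \<oplus>\<^bsub>?R\<^esub> \<one>\<^bsub>?R\<^esub>"
      by (simp only: n2)
    then obtain a b c where "a \<in> ?I" "b \<in> ?I" "c \<in> ?I" "x = a + (b + 1) + (c + 1)"
      unfolding add zero one by blast
    then have "x = a + b + c + 2" "a + b + c + 2 \<in> ?I"
      using Iadd I2 by auto
    then show "x \<in> ?I" by simp
  next
    fix x assume "x \<in> ?I"
    then have "x - 2 \<in> ?I"
      using I2 base.diff_mem val_ideal_diff by blast
    moreover have "0 \<in> ?I"
      using base_zero by simp
    moreover have "x = (x - 2) + (0 + 1) + (0 + 1)"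
      by simp
    ultimately show "x \<in> add_pow ?R (2::nat) \<one>\<^bsub>?R\<^esub>"
      unfolding n2 unfolding add zero one by blast
  qed
  then have two_zero: "0 < (2::nat) \<and> add_pow ?R (2::nat) \<one>\<^bsub>?R\<^esub> = \<zero>\<^bsub>?R\<^esub>"
    using zero by simp
  then have "residue_char F0 v \<le> 2"
    unfolding residue_char_def by (rule Least_le)
  moreover have least: "0 < residue_char F0 v \<and> add_pow ?R (residue_char F0 v) \<one>\<^bsub>?R\<^esub> = \<zero>\<^bsub>?R\<^esub>"
    unfolding residue_char_def using two_zero by (rule LeastI)
  ultimately have "residue_char F0 v = 1"
    using odd_residue_char by (metis One_nat_def even_numeral le_SucE le_zero_eq less_irrefl numeral_2_eq_2)
  then have "\<zero>\<^bsub>?R\<^esub> \<oplus>\<^bsub>?R\<^esub> \<one>\<^bsub>?R\<^esub> = \<zero>\<^bsub>?R\<^esub>"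
    using least n1 by simp
  moreover have "0 + (0 + 1) \<in> \<zero>\<^bsub>?R\<^esub> \<oplus>\<^bsub>?R\<^esub> \<one>\<^bsub>?R\<^esub>"
    unfolding add zero one using base_zero by (blast intro: val_ideal_zero)
  ultimately have "1 \<in> val_ideal v 1"
    unfolding zero by simp
  then show False
    by (simp add: val_ideal_def val_one)
qed

lemma two_nonzero: "(2::'f) \<noteq> 0"
  using two_notin_max by (metis val_ideal_zero)

lemma val_two: "v 2 = 0"
proof -
  have "2 \<in> val_ideal v 0"
    using val_ideal_add[of 1 0 1] by simp
  then show ?thesis
    using two_notin_max two_nonzero by (auto simp: val_ideal_def)
qed

lemma two_mult_in_val_ideal_iff:
  "2 * x \<in> val_ideal v m \<longleftrightarrow> x \<in> val_ideal v m"
  using two_nonzero by (simp add: val_ideal_mult_left_iff val_two)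

lemma sqrt_nonzero: "s \<noteq> 0"
  using sqrt unit by auto

lemma val_sqrt: "v s = 0"
proof -
  have "v (s * s) = 0"
    using sqrt unit by (simp add: power2_eq_square)
  then show ?thesis
    using sqrt_nonzero by (simp add: val_mult)
qed

lemma sqrt_approx_nonzero:
  assumes "t\<^sup>2 - \<epsilon> \<in> val_ideal v 1"
  shows "t \<noteq> 0" "v t = 0"
proof -
  show t0: "t \<noteq> 0"
    using assms unit by (auto simp: val_ideal_def val_minus)
  have "\<epsilon> \<notin> val_ideal v 1" "\<epsilon> \<in> val_ideal v 0"
    using unit by (auto simp: val_ideal_def)
  then have "t\<^sup>2 \<in> val_ideal v 0" "t\<^sup>2 \<notin> val_ideal v 1"
    using assms val_ideal_add[of "t\<^sup>2 - \<epsilon>" 0 \<epsilon>] val_ideal_mono[OF assms, of 0]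
      val_ideal_diff[of "t\<^sup>2" 1 "t\<^sup>2 - \<epsilon>"] by auto
  then show "v t = 0"
    using t0 by (auto simp: val_ideal_def val_power)
qed

text \<open>
  Newton's iteration \<open>t \<mapsto> (t + \<epsilon>/t)/2\<close>: the new error \<open>t'\<^sup>2 - \<epsilon>\<close> is \<open>(t\<^sup>2 - \<epsilon>)\<^sup>2/(4t\<^sup>2)\<close>, so its
  valuation doubles, and completeness provides a root in \<open>F0\<close>. This is Hensel's lemma for
  \<open>T\<^sup>2 - \<epsilon>\<close>.
\<close>

lemma no_sqrt_mod_max:
  assumes t: "t \<in> F0" and tmax: "t\<^sup>2 - \<epsilon> \<in> val_ideal v 1"
  shows False
proof -
  define X where "X = rec_nat t (\<lambda>_ x. (x + \<epsilon> / x) / 2)"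
  have X0: "X 0 = t" and XS: "X (Suc k) = (X k + \<epsilon> / X k) / 2" for k
    by (simp_all add: X_def)
  have XF: "X k \<in> F0" for k
    by (induction k) (auto simp: X0 XS t unit intro!: base_divide base_add base_two)
  have four: "(4::'f) \<noteq> 0"
    using two_nonzero mult_eq_0_iff[of "2::'f" 2] by simp
  have err: "(X k)\<^sup>2 - \<epsilon> \<in> val_ideal v (1 + int k)" for k
  proof (induction k)
    case 0
    then show ?case using tmax by (simp add: X0)
  next
    case (Suc k)
    let ?d = "(X k)\<^sup>2 - \<epsilon>"
    have "?d \<in> val_ideal v 1"
      using Suc by (rule val_ideal_mono) simp
    note nz = sqrt_approx_nonzero[OF this]
    have "?d * ?d \<in> val_ideal v ((1 + int k) + (1 + int k))"
      using Suc by (intro val_ideal_mult)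
    moreover have "(X (Suc k))\<^sup>2 - \<epsilon> = (?d * ?d) * inverse ((2 * X k) * (2 * X k))"
      using nz two_nonzero four by (simp add: XS field_simps power2_eq_square)
    moreover have "inverse ((2 * X k) * (2 * X k)) \<in> val_ideal v 0"
    proof -
      have "inverse (y * y) \<in> val_ideal v 0" if "y \<noteq> 0" "v y = 0" for y
        using that by (simp add: val_ideal_def val_inverse val_mult del: inverse_mult_distrib)
      from this[of "2 * X k"] show ?thesis
        using nz two_nonzero by (simp add: val_mult val_two)
    qed
    ultimately have "(X (Suc k))\<^sup>2 - \<epsilon> \<in> val_ideal v ((1 + int k) + (1 + int k) + 0)"
      by (metis val_ideal_mult)
    then show ?case by (rule val_ideal_mono) simp
  qed
  have nz: "X k \<noteq> 0" "v (X k) = 0" for k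
    using sqrt_approx_nonzero[OF val_ideal_mono[OF err]] by simp_all
  have step: "X (Suc k) - X k \<in> val_ideal v (int k)" for k
  proof -
    have "X (Suc k) - X k = - (((X k)\<^sup>2 - \<epsilon>) / (2 * X k))"
      using nz two_nonzero by (simp add: XS field_simps power2_eq_square)
    moreover have "((X k)\<^sup>2 - \<epsilon>) / (2 * X k) \<in> val_ideal v (1 + int k)"
      using err[of k] nz two_nonzero
      by (cases "(X k)\<^sup>2 - \<epsilon> = 0") (auto simp: val_ideal_def val_mult val_two val_divide)
    ultimately have "X (Suc k) - X k \<in> val_ideal v (1 + int k)"
      by simp
    then show ?thesis by (rule val_ideal_mono) simp
  qed
  have steps: "X (M + d) - X M \<in> val_ideal v (int M)" for M d
  proof (induction d)
    case (Suc d)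
    have "X (Suc (M + d)) - X (M + d) \<in> val_ideal v (int M)"
      using step by (rule val_ideal_mono) simp
    from val_ideal_add[OF this Suc] show ?case by simp
  qed simp
  have "\<exists>L\<in>F0. \<forall>N. \<exists>M. \<forall>n\<ge>M. X n - L \<in> val_ideal v N"
  proof (rule base.complete)
    show "range X \<subseteq> F0" using XF by auto
    fix N
    have "X m - X n \<in> val_ideal v N" if "m \<ge> nat N" "n \<ge> nat N" for m n
    proof -
      have "X m - X (nat N) \<in> val_ideal v (int (nat N))" "X n - X (nat N) \<in> val_ideal v (int (nat N))"
        using steps[of "nat N" "m - nat N"] steps[of "nat N" "n - nat N"] that by simp_all
      then have "X m - X (nat N) - (X n - X (nat N)) \<in> val_ideal v (int (nat N))"
        by (rule val_ideal_diff)
      then show ?thesis by (auto elim: val_ideal_mono)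
    qed
    then show "\<exists>M. \<forall>m\<ge>M. \<forall>n\<ge>M. X m - X n \<in> val_ideal v N" by blast
  qed
  then obtain L where L: "L \<in> F0" "\<And>N. \<exists>M. \<forall>n\<ge>M. X n - L \<in> val_ideal v N"
    by blast
  have "L\<^sup>2 - \<epsilon> \<in> val_ideal v N" for N
  proof -
    obtain M where M: "\<And>n. n \<ge> M \<Longrightarrow> X n - L \<in> val_ideal v (max 0 N)"
      using L(2) by blast
    define k where "k = M + nat N"
    have a: "X k - L \<in> val_ideal v (max 0 N)"
      using M by (simp add: k_def)
    have b: "X k \<in> val_ideal v 0"
      using nz by (simp add: val_ideal_def)
    have "X k - L \<in> val_ideal v 0"
      using a by (rule val_ideal_mono) simp
    then have "2 * X k - (X k - L) \<in> val_ideal v 0"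
      using b val_ideal_add[OF b b] by (metis val_ideal_diff mult_2)
    from val_ideal_integral_mult[OF this a]
    have "(2 * X k - (X k - L)) * (X k - L) \<in> val_ideal v N"
      by (rule val_ideal_mono) simp
    moreover have "(X k)\<^sup>2 - \<epsilon> \<in> val_ideal v N"
      using err by (rule val_ideal_mono) (simp add: k_def)
    ultimately have "((X k)\<^sup>2 - \<epsilon>) - (2 * X k - (X k - L)) * (X k - L) \<in> val_ideal v N"
      by (blast intro: val_ideal_diff)
    then show ?thesis by (simp add: algebra_simps power2_eq_square)
  qed
  then have "L\<^sup>2 = \<epsilon>"
    using val_ideal_Inter_zero by fastforce
  then show False
    using nonsquare L(1) by blast
qed

text \<open>
  If a combination \<open>a + b s\<close> were smaller than \<open>b\<close>, the ratio \<open>- a / b\<close> would be a square root of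
  \<open>\<epsilon>\<close> modulo the maximal ideal.
\<close>

lemma components_in_val_ideal:
  assumes a: "a \<in> F0" and b: "b \<in> F0" and ab: "a + b * s \<in> val_ideal v m"
  shows "a \<in> val_ideal v m" "b \<in> val_ideal v m"
proof -
  have "b \<in> val_ideal v m"
  proof (rule ccontr)
    assume nb: "b \<notin> val_ideal v m"
    then have b0: "b \<noteq> 0" and vb: "v b + 1 \<le> m"
      by (auto simp: val_ideal_def)
    define t where "t = - a / b"
    have t: "t \<in> F0"
      using a b base_divide base_minus by (simp add: t_def)
    have "b * (s - t) = a + b * s"
      using b0 by (simp add: t_def distrib_left)
    then have "b * (s - t) \<in> val_ideal v (v b + 1)"
      using val_ideal_mono[OF ab vb] by simp
    then have st: "s - t \<in> val_ideal v 1"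
      using b0 by (simp add: val_ideal_mult_left_iff)
    have "s \<in> val_ideal v 0"
      by (simp add: val_ideal_def val_sqrt)
    then have "s + s - (s - t) \<in> val_ideal v 0"
      using val_ideal_mono[OF st, of 0] val_ideal_diff[OF val_ideal_add[of s 0 s]] by fastforce
    from val_ideal_integral_mult[OF this st] have "(s + s - (s - t)) * (s - t) \<in> val_ideal v 1" .
    then have "- (t\<^sup>2 - \<epsilon>) \<in> val_ideal v 1"
      by (simp add: algebra_simps power2_eq_square flip: sqrt)
    then show False
      using no_sqrt_mod_max[OF t] val_ideal_minus_iff by blast
  qed
  moreover have "s \<in> val_ideal v 0"
    by (simp add: val_ideal_def val_sqrt)
  ultimately have "s * b \<in> val_ideal v m"
    by (intro val_ideal_integral_mult)
  from val_ideal_diff[OF ab, of "b * s"] this show "a \<in> val_ideal v m"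
    by (simp add: mult.commute)
  show "b \<in> val_ideal v m" by fact
qed

lemma cj_add: "cj (x + y) = cj x + cj y"
proof -
  obtain a b c d where m: "a \<in> F0" "b \<in> F0" "c \<in> F0" "d \<in> F0" and xy: "x = a + b * s" "y = c + d * s"
    using generates by metis
  have "x + y = (a + c) + (b + d) * s"
    unfolding xy by (simp add: algebra_simps)
  then have "cj (x + y) = (a + c) - (b + d) * s"
    using m base_add conjugation by simp
  moreover have "cj x = a - b * s" "cj y = c - d * s"
    using m conjugation by (simp_all add: xy)
  ultimately show ?thesis
    by (simp only:) (simp add: algebra_simps)
qed

lemma cj_mult: "cj (x * y) = cj x * cj y"
proof -
  obtain a b c d where m: "a \<in> F0" "b \<in> F0" "c \<in> F0" "d \<in> F0" and xy: "x = a + b * s" "y = c + d * s"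
    using generates by metis
  have "x * y = (a * c + b * d * \<epsilon>) + (a * d + b * c) * s"
    unfolding xy sqrt[symmetric] by (simp add: algebra_simps power2_eq_square)
  moreover have "a * c + b * d * \<epsilon> \<in> F0" "a * d + b * c \<in> F0"
    using m unit base_add base.mult_mem by simp_all
  ultimately have "cj (x * y) = (a * c + b * d * \<epsilon>) - (a * d + b * c) * s"
    using conjugation by simp
  also have "\<dots> = (a - b * s) * (c - d * s)"
    unfolding sqrt[symmetric] by (simp add: algebra_simps power2_eq_square)
  finally show ?thesis
    using m conjugation xy by simp
qed

lemma cj_base: "x \<in> F0 \<Longrightarrow> cj x = x"
  using conjugation[of x 0] base_zero by simp

lemma cj_cj [simp]: "cj (cj x) = x"
proof -
  obtain a b where "a \<in> F0" "b \<in> F0" "x = a + b * s"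
    using generates by metis
  then show ?thesis
    using conjugation[of a b] conjugation[of a "- b"] base_minus by simp
qed

lemma cj_zero [simp]: "cj 0 = 0" and cj_one [simp]: "cj 1 = 1"
  using cj_base base_zero base.one_mem by auto

lemma cj_minus: "cj (- x) = - cj x"
  using cj_add[of x "- x"] by (simp add: eq_neg_iff_add_eq_0 add.commute)

lemma cj_diff: "cj (x - y) = cj x - cj y"
  using cj_add[of x "- y"] by (simp add: cj_minus)

lemma cj_sum: "cj (sum f I) = (\<Sum>i\<in>I. cj (f i))"
  by (induction I rule: infinite_finite_induct) (simp_all add: cj_add)

lemma cj_in_val_ideal: 
  assumes "x \<in> val_ideal v m"
  shows "cj x \<in> val_ideal v m"
proof -
  obtain a b where ab: "a \<in> F0" "b \<in> F0" "x = a + b * s"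
    using generates by metis
  then have m: "a \<in> val_ideal v m" "b \<in> val_ideal v m"
    using components_in_val_ideal assms by blast+
  have "s * b \<in> val_ideal v m"
    using m by (intro val_ideal_integral_mult) (simp_all add: val_ideal_def val_sqrt)
  then have "a - b * s \<in> val_ideal v m"
    using m by (simp add: val_ideal_diff mult.commute)
  then show ?thesis
    using ab conjugation by simp
qed

lemma cj_in_val_ideal_iff [simp]: "cj x \<in> val_ideal v m \<longleftrightarrow> x \<in> val_ideal v m"
  using cj_in_val_ideal by (metis cj_cj)

lemma trace_in_base: "x + cj x \<in> F0"
proof -
  obtain a b where "a \<in> F0" "b \<in> F0" "x = a + b * s"
    using generates by metis
  then show ?thesis
    using conjugation[of a b] base.mult_mem[OF base_two] by simp
qed

text \<open>
  For \<open>x = a + b s\<close>, the traces of \<open>1 \<cdot> x\<close> and of \<open>s \<cdot> x\<close> are \<open>2 a\<close> and \<open>2 b \<epsilon>\<close>, and \<open>2\<close>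
  and \<open>\<epsilon>\<close> are units.
\<close>

lemma trace_form_perfect:
  assumes "\<And>c. c \<in> val_ideal v 0 \<Longrightarrow> c * x + cj (c * x) \<in> val_ideal v m"
  shows "x \<in> val_ideal v m"
proof -
  obtain a b where ab: "a \<in> F0" "b \<in> F0" "x = a + b * s"
    using generates by metis
  have cjs: "cj s = - s"
    using conjugation[OF base_zero base.one_mem] by simp
  have cjx: "cj x = a - b * s"
    using ab conjugation by simp
  have "2 * a \<in> val_ideal v m"
    using assms[of 1] by (simp add: cjx) (simp add: ab)
  moreover have "2 * s * (b * s) \<in> val_ideal v m"
  proof -
    have "s * x + cj (s * x) = 2 * s * (b * s)"
      unfolding cj_mult cjs cjx by (simp add: ab algebra_simps)
    moreover have "s \<in> val_ideal v 0"
      by (simp add: val_ideal_def val_sqrt)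
    ultimately show ?thesis
      using assms[of s] by simp
  qed
  ultimately have "a \<in> val_ideal v m" "b * s \<in> val_ideal v m"
    using two_nonzero sqrt_nonzero
    by (simp_all add: val_ideal_mult_left_iff val_two val_sqrt val_mult)
  then show ?thesis
    by (simp add: ab val_ideal_add)
qed

end


section \<open>The adjoint involution on matrices\<close>

lemma matrix_add_rdistrib: "(A + B) ** C = A ** C + B ** (C :: 'a::ring_1^'n^'m)"
  by (simp add: vec_eq_iff matrix_matrix_mult_def distrib_right sum.distrib)

lemma matrix_diff_ldistrib: "A ** (B - C) = A ** B - A ** (C :: 'a::ring_1^'n^'m)"
  by (simp add: vec_eq_iff matrix_matrix_mult_def right_diff_distrib sum_subtractf)

lemma matrix_diff_rdistrib: "(A - B) ** C = A ** C - B ** (C :: 'a::ring_1^'n^'m)"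
  by (simp add: vec_eq_iff matrix_matrix_mult_def left_diff_distrib sum_subtractf)

lemma matrix_minus_left: "(- A) ** B = - (A ** (B :: 'a::ring_1^'n^'m))"
  by (simp add: vec_eq_iff matrix_matrix_mult_def sum_negf)

lemma matrix_minus_right: "A ** (- B) = - (A ** (B :: 'a::ring_1^'n^'m))"
  by (simp add: vec_eq_iff matrix_matrix_mult_def sum_negf)

lemmas matrix_ring_simps =
  matrix_add_ldistrib matrix_add_rdistrib matrix_diff_ldistrib matrix_diff_rdistrib
  matrix_minus_left matrix_minus_right matrix_mul_assoc

lemma matrix_inv_eqI:
  fixes A B :: "'a::field^'n^'n"
  assumes "A ** B = mat 1"
  shows "matrix_inv A = B"
proof -
  have BA: "B ** A = mat 1"
    using assms matrix_left_right_inverse by blast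
  have "A ** matrix_inv A = mat 1 \<and> matrix_inv A ** A = mat 1"
    unfolding matrix_inv_def by (rule someI[of _ B]) (use assms BA in blast)
  then show ?thesis
    by (metis BA matrix_mul_assoc matrix_mul_lid matrix_mul_rid)
qed

lemma matrix_inv_mult:
  fixes A :: "'a::field^'n^'n"
  assumes "invertible A"
  shows "A ** matrix_inv A = mat 1" "matrix_inv A ** A = mat 1"
  using assms matrix_inv_eqI unfolding invertible_def by metis+

lemma matrix_mult_inv_cancel:
  fixes A :: "'a::field^'n^'n"
  assumes "invertible A"
  shows "X ** A ** matrix_inv A = X" "X ** matrix_inv A ** A = X"
  using matrix_inv_mult[OF assms] by (metis matrix_mul_assoc matrix_mul_rid)+

lemma matrix_vector_mult_scale: "X *v (c *s u) = c *s (X *v (u :: 'a::comm_ring_1^'n))"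
  by (simp add: vec_eq_iff matrix_vector_mult_def sum_distrib_left algebra_simps)

lemma mat_mult_left: "mat c ** X = (\<chi> i j. c * (X :: 'a::comm_ring_1^'n^'m) $ i $ j)"
  by (simp add: vec_eq_iff matrix_matrix_mult_def mat_def if_distrib[of "\<lambda>x. x * _"] cong: if_cong)

lemma mat_mult_commute: "mat c ** X = X ** mat (c :: 'a::comm_ring_1)"
  by (simp add: vec_eq_iff matrix_matrix_mult_def mat_def if_distrib[of "\<lambda>x. x * _"]
      if_distrib[of "\<lambda>x. _ * x"] mult.commute cong: if_cong)

lemma mat_mult_vector: "mat c *v u = c *s (u :: 'a::comm_ring_1^'n)"
  by (simp add: vec_eq_iff matrix_vector_mult_def mat_def if_distrib[of "\<lambda>x. x * _"] cong: if_cong)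

text \<open>
  The matrix \<open>H\<close> permutes the standard basis by the reversal \<open>k \<mapsto> 5 - k\<close>. It is spelled out because
  in the index type \<open>4\<close> the numeral \<open>5\<close> denotes \<open>1\<close>.
\<close>

definition rv :: "4 \<Rightarrow> 4" where
  "rv k = (if k = 1 then 4 else if k = 2 then 3 else if k = 3 then 2 else 1)"

lemma rv_simps [simp]: "rv 1 = 4" "rv 2 = 3" "rv 3 = 2" "rv 4 = 1"
  by (simp_all add: rv_def)

lemma rv_rv [simp]: "rv (rv k) = k"
  using exhaust_4[of k] by auto

lemma rv_inj [simp]: "rv k = rv l \<longleftrightarrow> k = l"
  by (metis rv_rv)

lemma bij_rv: "bij rv"
  by (rule o_bij[of rv]) (auto simp: fun_eq_iff)

lemma sum_rv: "(\<Sum>k\<in>UNIV. f (rv k)) = (\<Sum>k\<in>UNIV. f k)"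
  using sum.reindex_bij_betw[OF bij_rv] by simp

lemma herm_matrix_entry: "herm_matrix $ i $ j = (if j = rv i then 1 else 0)"
proof -
  have "\<forall>i j. herm_matrix $ i $ j = (if j = rv i then 1 else 0)"
    unfolding forall_4 by (simp add: herm_matrix_def)
  then show ?thesis by blast
qed

lemma rv_eq_iff: "i = rv j \<longleftrightarrow> j = rv i"
  by (metis rv_rv)

lemma herm_matrix_mult_left: "(herm_matrix ** X) $ i $ j = X $ rv i $ j"
  by (simp add: matrix_matrix_mult_def herm_matrix_entry if_distrib[of "\<lambda>x. x * _"] cong: if_cong)

lemma herm_matrix_mult_right: "(X ** herm_matrix) $ i $ j = X $ i $ rv j"
  by (simp add: matrix_matrix_mult_def herm_matrix_entry rv_eq_iff[of j]
      if_distrib[of "\<lambda>x. _ * x"] cong: if_cong)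

lemma herm_matrix_inv: "matrix_inv herm_matrix = (herm_matrix :: 'f::field^4^4)"
  by (rule matrix_inv_eqI)
    (simp add: vec_eq_iff herm_matrix_mult_left herm_matrix_entry mat_def)

lemma sigma_entry: "sigma_inv cj X $ k $ l = cj (X $ rv l $ rv k)"
  by (simp add: sigma_inv_def herm_matrix_inv herm_matrix_mult_right herm_matrix_mult_left
      transpose_def flip: matrix_mul_assoc)

lemma herm_entry: "herm cj x y = (\<Sum>k\<in>UNIV. cj (x $ k) * y $ rv k)"
  by (simp add: herm_def matrix_vector_mult_def herm_matrix_entry
      if_distrib[of "\<lambda>x. x * _"] cong: if_cong)

context unramified_quadratic_extension
begin

abbreviation \<sigma> :: "'f^4^4 \<Rightarrow> 'f^4^4" where "\<sigma> \<equiv> sigma_inv cj"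

lemma sigma_add: "\<sigma> (X + Y) = \<sigma> X + \<sigma> Y"
  by (simp add: vec_eq_iff sigma_entry cj_add)

lemma sigma_diff: "\<sigma> (X - Y) = \<sigma> X - \<sigma> Y"
  by (simp add: vec_eq_iff sigma_entry cj_diff)

lemma sigma_one: "\<sigma> (mat 1) = mat 1"
  by (auto simp: vec_eq_iff sigma_entry mat_def)

lemma sigma_sigma: "\<sigma> (\<sigma> X) = X"
  by (simp add: vec_eq_iff sigma_entry)

lemma sigma_mult: "\<sigma> (X ** Y) = \<sigma> Y ** \<sigma> X"
proof -
  have "\<sigma> (X ** Y) $ k $ l = (\<sigma> Y ** \<sigma> X) $ k $ l" for k l
  proof -
    have "\<sigma> (X ** Y) $ k $ l = (\<Sum>j\<in>UNIV. cj (Y $ j $ rv k) * cj (X $ rv l $ j))"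
      by (simp add: sigma_entry matrix_matrix_mult_def cj_sum cj_mult mult.commute)
    also have "\<dots> = (\<Sum>j\<in>UNIV. cj (Y $ rv j $ rv k) * cj (X $ rv l $ rv j))"
      by (rule sum_rv[symmetric])
    finally show ?thesis
      by (simp add: sigma_entry matrix_matrix_mult_def)
  qed
  then show ?thesis by (simp add: vec_eq_iff)
qed

lemma trace_sigma: "trace (\<sigma> X) = cj (trace X)"
  using sum_rv[of "\<lambda>k. cj (X $ k $ k)"] by (simp add: trace_def sigma_entry cj_sum)

lemma herm_sigma: "herm cj (\<sigma> X *v x) y = herm cj x (X *v y)"
proof -
  have "herm cj (\<sigma> X *v x) y = (\<Sum>k\<in>UNIV. \<Sum>l\<in>UNIV. X $ rv l $ rv k * cj (x $ l) * y $ rv k)"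
    by (simp add: herm_entry matrix_vector_mult_def sigma_entry cj_sum cj_mult sum_distrib_right)
  also have "\<dots> = (\<Sum>k\<in>UNIV. \<Sum>l\<in>UNIV. X $ rv l $ k * cj (x $ l) * y $ k)"
    by (rule sum_rv)
  also have "\<dots> = (\<Sum>l\<in>UNIV. \<Sum>k\<in>UNIV. X $ rv l $ k * cj (x $ l) * y $ k)"
    by (rule sum.swap)
  also have "\<dots> = herm cj x (X *v y)"
    by (simp add: herm_entry matrix_vector_mult_def sum_distrib_left ac_simps)
  finally show ?thesis .
qed

lemma U22_iff: "g \<in> U22 cj \<longleftrightarrow> g ** \<sigma> g = mat 1"
  unfolding U22_def using invertible_right_inverse by auto

lemma U22_invertible: "g \<in> U22 cj \<Longrightarrow> invertible g"
  by (simp add: U22_def)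

lemma U22_inv: "g \<in> U22 cj \<Longrightarrow> matrix_inv g = \<sigma> g"
  using matrix_inv_eqI U22_iff by blast

lemma U22_inv_mem: "g \<in> U22 cj \<Longrightarrow> matrix_inv g \<in> U22 cj"
  by (metis U22_inv U22_iff matrix_left_right_inverse sigma_sigma)

lemma U22_one: "mat 1 \<in> U22 cj"
  by (simp add: U22_iff sigma_one)

lemma U22_mult:
  assumes "g \<in> U22 cj" "h \<in> U22 cj"
  shows "g ** h \<in> U22 cj"
proof -
  have "g ** h ** (\<sigma> h ** \<sigma> g) = g ** (h ** \<sigma> h) ** \<sigma> g"
    by (simp add: matrix_mul_assoc)
  then show ?thesis
    using assms by (simp add: U22_iff sigma_mult)
qed

lemma herm_U22: "g \<in> U22 cj \<Longrightarrow> herm cj (g *v x) (g *v y) = herm cj x y"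
  using herm_sigma[of "\<sigma> g" x "g *v y"]
  by (simp add: sigma_sigma matrix_vector_mul_assoc) (metis U22_iff matrix_left_right_inverse matrix_vector_mul_lid)

end


section \<open>The Iwahori lattice chain in coordinates\<close>

text \<open>
  The basis vector \<open>e\<^sub>k\<close> is replaced by \<open>\<pi> e\<^sub>k\<close> in the chain at the levels \<open>i \<equiv> - pos k\<close> modulo \<open>4\<close>.
\<close>

definition pos :: "4 \<Rightarrow> int" where
  "pos k = (if k = 1 then 0 else if k = 2 then 1 else if k = 3 then 2 else 3)"

lemma pos_simps [simp]: "pos 1 = 0" "pos 2 = 1" "pos 3 = 2" "pos 4 = 3"
  by (simp_all add: pos_def)

lemma pos_range: "0 \<le> pos k" "pos k \<le> 3"
  by (simp_all add: pos_def)

lemma pos_rv: "pos (rv k) = 3 - pos k"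
  using exhaust_4[of k] by auto

lemma pos_inj: "pos k = pos l \<longleftrightarrow> k = l"
  using exhaust_4[of k] exhaust_4[of l] by auto

lemma div_4_le_iff: "x div 4 \<le> q \<longleftrightarrow> x \<le> 4 * q + 3" for x q :: int
  by presburger

lemma div_4_subadditive: "(x + y) div 4 \<le> (x + 3) div 4 + y div 4" for x y :: int
  by presburger

lemma div_4_jump_unique:
  fixes n d :: int
  assumes "n div 4 < (n + 1) div 4" "d \<noteq> 0" "- 3 \<le> d" "d \<le> 3"
  shows "(n + d + 1) div 4 = (n + d) div 4"
proof -
  have "d = - 3 \<or> d = - 2 \<or> d = - 1 \<or> d = 1 \<or> d = 2 \<or> d = 3"
    using assms by auto
  then show ?thesis
    using assms(1) by (elim disjE; hypsubst; presburger)
qed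

locale iwahori_chain = unramified_quadratic_extension F0 v \<epsilon> s \<pi> cj
  for F0 :: "'f::field set" and v :: "'f \<Rightarrow> int" and \<epsilon> s \<pi> :: 'f and cj :: "'f \<Rightarrow> 'f" +
  fixes \<Lambda> :: "int \<Rightarrow> ('f^4) set"
  assumes chain_0: "\<And>i. \<Lambda> (4 * i) = lattice_scale (\<pi> powi i) (N0 v)"
    and chain_1: "\<And>i. \<Lambda> (4 * i + 1) = lattice_scale (\<pi> powi i) (N1 v)"
    and chain_2: "\<And>i. \<Lambda> (4 * i + 2) = lattice_scale (\<pi> powi i) (N2 v)"
    and chain_3: "\<And>i. \<Lambda> (4 * i + 3) = lattice_scale (\<pi> powi (i + 1)) (dual_lattice v cj (N1 v))"
begin

lemma lattice_scale_iff:
  "c \<noteq> 0 \<Longrightarrow> x \<in> lattice_scale c L \<longleftrightarrow> inverse c *s x \<in> (L :: ('f^4) set)"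
  unfolding lattice_scale_def by (auto simp: image_iff intro!: bexI[of _ "inverse c *s x"])

lemma inverse_powi_mem:
  "inverse (\<pi> powi i) * a \<in> val_ideal v m \<longleftrightarrow> a \<in> val_ideal v (m + i)"
  using uniformizer by (simp add: val_ideal_mult_left_iff val_inverse val_powi)

lemma dual_N1_iff:
  "x \<in> dual_lattice v cj (N1 v) \<longleftrightarrow>
     x $ 1 \<in> val_ideal v (- 1) \<and> x $ 2 \<in> val_ideal v 0 \<and> x $ 3 \<in> val_ideal v 0 \<and> x $ 4 \<in> val_ideal v 0"
proof
  assume x: "x \<in> dual_lattice v cj (N1 v)"
  have ax: "herm cj x (axis (rv k) a) = cj (x $ k) * a" for k a
    by (simp add: herm_entry axis_def if_distrib[of "\<lambda>x. _ * x"] cong: if_cong)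
  have one: "1 \<in> val_ideal v 0" and pi: "\<pi> \<in> val_ideal v 1" "\<pi> \<in> val_ideal v 0"
    using uniformizer by (simp_all add: val_ideal_def val_one)
  have "axis (rv 1) \<pi> \<in> N1 v" "axis (rv 2) 1 \<in> N1 v" "axis (rv 3) 1 \<in> N1 v" "axis (rv 4) 1 \<in> N1 v"
    using one pi by (simp_all add: N1_def axis_def)
  then have "cj (x $ 1) * \<pi> \<in> val_ideal v 0" "cj (x $ 2) * 1 \<in> val_ideal v 0"
    "cj (x $ 3) * 1 \<in> val_ideal v 0" "cj (x $ 4) * 1 \<in> val_ideal v 0"
    using x unfolding dual_lattice_def ax[symmetric] by blast+
  moreover have "\<pi> * cj (x $ 1) \<in> val_ideal v 0 \<longleftrightarrow> x $ 1 \<in> val_ideal v (- 1)"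
    using uniformizer by (simp add: val_ideal_mult_left_iff)
  ultimately show "x $ 1 \<in> val_ideal v (- 1) \<and> x $ 2 \<in> val_ideal v 0 \<and> x $ 3 \<in> val_ideal v 0 \<and> x $ 4 \<in> val_ideal v 0"
    by (simp add: mult.commute)
next
  assume x: "x $ 1 \<in> val_ideal v (- 1) \<and> x $ 2 \<in> val_ideal v 0 \<and> x $ 3 \<in> val_ideal v 0 \<and> x $ 4 \<in> val_ideal v 0"
  have "herm cj x y \<in> val_ideal v 0" if "y \<in> N1 v" for y
  proof -
    have "cj (x $ 1) * y $ 4 \<in> val_ideal v (- 1 + 1)"
      using x that by (intro val_ideal_mult) (simp_all add: N1_def)
    moreover have "cj (x $ 2) * y $ 3 \<in> val_ideal v (0 + 0)" "cj (x $ 3) * y $ 2 \<in> val_ideal v (0 + 0)"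
      "cj (x $ 4) * y $ 1 \<in> val_ideal v (0 + 0)"
      using x that by (intro val_ideal_mult; simp add: N1_def)+
    ultimately show ?thesis
      by (simp add: herm_entry sum_4 val_ideal_add)
  qed
  then show "x \<in> dual_lattice v cj (N1 v)"
    by (simp add: dual_lattice_def)
qed

lemma chain_iff: "x \<in> \<Lambda> i \<longleftrightarrow> (\<forall>k. x $ k \<in> val_ideal v ((i + pos k) div 4))"
proof -
  define j r where "j = i div 4" and "r = i mod 4"
  have i: "i = 4 * j + r" and r: "r = 0 \<or> r = 1 \<or> r = 2 \<or> r = 3"
    by (auto simp: j_def r_def)
  have nz: "\<pi> powi j \<noteq> 0" "\<pi> powi (j + 1) \<noteq> 0" 
    using uniformizer by simp_all
  from r show ?thesis
  proof (elim disjE)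
    assume "r = 0"
    then have i: "i = 4 * j" using i by simp
    show ?thesis
      unfolding i chain_0 using nz
      by (simp add: lattice_scale_iff N0_def forall_4 inverse_powi_mem)
  next
    assume "r = 1"
    then have i: "i = 4 * j + 1" using i by simp
    show ?thesis
      unfolding i chain_1 using nz
      by (simp add: lattice_scale_iff N1_def forall_4 inverse_powi_mem add.commute)
  next
    assume "r = 2"
    then have i: "i = 4 * j + 2" using i by simp
    show ?thesis
      unfolding i chain_2 using nz
      by (simp add: lattice_scale_iff N2_def forall_4 inverse_powi_mem add.commute)
  next
    assume "r = 3"
    then have i: "i = 4 * j + 3" using i by simp
    show ?thesis
      unfolding i chain_3 using nz
      by (simp add: lattice_scale_iff dual_N1_iff forall_4 inverse_powi_mem add.commute)
  qed
qed

lemma chain_zero [simp]: "0 \<in> \<Lambda> i"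
  by (simp add: chain_iff)

lemma chain_add: "x \<in> \<Lambda> i \<Longrightarrow> y \<in> \<Lambda> i \<Longrightarrow> x + y \<in> \<Lambda> i"
  by (simp add: chain_iff val_ideal_add)

lemma chain_diff: "x \<in> \<Lambda> i \<Longrightarrow> y \<in> \<Lambda> i \<Longrightarrow> x - y \<in> \<Lambda> i"
  by (simp add: chain_iff val_ideal_diff)

lemma chain_scale: "c \<noteq> 0 \<Longrightarrow> c *s x \<in> \<Lambda> (i + 4 * v c) \<longleftrightarrow> x \<in> \<Lambda> i"
proof -
  have "(i + 4 * v c + pos k) div 4 = (i + pos k) div 4 + v c" for k
    using div_mult_self2[of 4 "i + pos k" "v c"] by (simp add: algebra_simps)
  then show "c \<noteq> 0 \<Longrightarrow> ?thesis"
    by (simp add: chain_iff val_ideal_mult_left_iff)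
qed

lemma chain_integral_scale: "c \<in> val_ideal v 0 \<Longrightarrow> x \<in> \<Lambda> i \<Longrightarrow> c *s x \<in> \<Lambda> i"
  by (simp add: chain_iff val_ideal_integral_mult)

lemma chain_anti: "i \<le> j \<Longrightarrow> x \<in> \<Lambda> j \<Longrightarrow> x \<in> \<Lambda> i"
  unfolding chain_iff by (meson add_right_mono val_ideal_mono zdiv_mono1 zero_less_numeral)

text \<open>
  Exactly one coordinate \<open>k\<close> changes its exponent between \<open>\<Lambda> i\<close> and \<open>\<Lambda> (i + 1)\<close>, so the quotient
  is a line over the residue field and a vector outside \<open>\<Lambda> (i + 1)\<close> spans it.
\<close>

lemma chain_graded_line:
  assumes u: "u \<in> \<Lambda> i" "u \<notin> \<Lambda> (i + 1)" and w: "w \<in> \<Lambda> i"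
  obtains a where "a \<in> val_ideal v 0" "w - a *s u \<in> \<Lambda> (i + 1)"
proof -
  obtain k where k: "u $ k \<notin> val_ideal v ((i + 1 + pos k) div 4)"
    using u chain_iff by blast
  have uk: "u $ k \<in> val_ideal v ((i + pos k) div 4)" and wk: "w $ k \<in> val_ideal v ((i + pos k) div 4)"
    using u w chain_iff by blast+
  have uk0: "u $ k \<noteq> 0"
    using k by auto
  have less: "(i + pos k) div 4 < (i + 1 + pos k) div 4"
    using k uk val_ideal_mono by (meson not_le)
  have vuk: "v (u $ k) = (i + pos k) div 4"
    using k uk uk0 less by (auto simp: val_ideal_def)
  define a where "a = w $ k / u $ k"
  have a: "a \<in> val_ideal v 0"
    using wk uk0 vuk by (cases "w $ k = 0") (auto simp: a_def val_ideal_def val_divide)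
  have "(w - a *s u) $ j \<in> val_ideal v ((i + 1 + pos j) div 4)" for j
  proof (cases "j = k")
    case True
    then show ?thesis using uk0 by (simp add: a_def)
  next
    case False
    then have "pos j \<noteq> pos k"
      by (simp add: pos_inj)
    then have "(i + 1 + pos j) div 4 = (i + pos j) div 4"
      using div_4_jump_unique[of "i + pos k" "pos j - pos k"] less pos_range[of j] pos_range[of k]
      by (simp add: algebra_simps)
    moreover have "w - a *s u \<in> \<Lambda> i"
      using chain_diff[OF w chain_integral_scale[OF a u(1)]] .
    ultimately show ?thesis
      by (simp add: chain_iff)
  qed
  then show thesis
    using that a chain_iff by blast
qed

lemma chain_level:
  assumes "u \<noteq> 0"
  obtains i where "u \<in> \<Lambda> i" "u \<notin> \<Lambda> (i + 1)"
proof -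
  note witness = that
  define M where "M = Min (range (\<lambda>k. v (u $ k)))"
  have M: "M \<le> v (u $ k)" for k
    unfolding M_def by (intro Min_le) auto
  have lo: "u \<in> \<Lambda> (4 * M - 3)"
    unfolding chain_iff
  proof
    fix k
    have "(4 * M - 3 + pos k) div 4 \<le> M"
      using pos_range[of k] by (simp add: div_4_le_iff)
    then show "u $ k \<in> val_ideal v ((4 * M - 3 + pos k) div 4)"
      using M[of k] by (simp add: val_ideal_def)
  qed
  obtain k where k: "u $ k \<noteq> 0"
    using assms by (metis vec_eq_iff zero_index)
  have hi: "u \<notin> \<Lambda> (4 * (v (u $ k) + 1))"
  proof
    assume "u \<in> \<Lambda> (4 * (v (u $ k) + 1))"
    then have "u $ k \<in> val_ideal v ((4 * (v (u $ k) + 1) + pos k) div 4)"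
      using chain_iff by blast
    then have "(4 * (v (u $ k) + 1) + pos k) div 4 \<le> v (u $ k)"
      using k by (simp add: val_ideal_def)
    then show False
      using pos_range[of k] by (simp add: div_4_le_iff)
  qed
  show thesis
  proof (rule ccontr)
    assume no: "\<not> thesis"
    have "u \<in> \<Lambda> j" if ge: "4 * M - 3 \<le> j" for j
      using ge
    proof (induction j rule: int_ge_induct)
      case base
      show ?case by (rule lo)
    next
      case (step j)
      then show ?case
        using witness[of j] no by blast
    qed
    moreover have "4 * M - 3 \<le> 4 * (v (u $ k) + 1)"
      using M[of k] by simp
    ultimately show False
      using hi by blast
  qed
qed

lemma chain_Inter_zero:
  assumes "\<And>i. u \<in> \<Lambda> i"
  shows "u = 0"
  using assms chain_level by blast

text \<open>
  The bound is the ceiling of \<open>(m + pos k - pos l) / 4\<close>. The strongest condition on the entry \<open>(k, l)\<close> comes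
  from the last level, \<open>3 - pos l\<close>, at which the lattice still contains \<open>e\<^sub>l\<close>.
\<close>

lemma a_filt_iff:
  "X \<in> a_filt \<Lambda> m \<longleftrightarrow> (\<forall>k l. X $ k $ l \<in> val_ideal v ((m + pos k - pos l + 3) div 4))"
proof
  assume X: "X \<in> a_filt \<Lambda> m"
  show "\<forall>k l. X $ k $ l \<in> val_ideal v ((m + pos k - pos l + 3) div 4)"
  proof (intro allI)
    fix k l
    have "axis l 1 \<in> \<Lambda> (3 - pos l)"
      by (simp add: chain_iff axis_def)
    then have "X *v axis l 1 \<in> \<Lambda> (3 - pos l + m)"
      using X unfolding a_filt_def by blast
    moreover have "(X *v axis l 1) $ k = X $ k $ l"
      by (simp add: matrix_vector_mult_def axis_def if_distrib[of "\<lambda>x. _ * x"] cong: if_cong)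
    ultimately have "X $ k $ l \<in> val_ideal v ((3 - pos l + m + pos k) div 4)"
      using chain_iff by metis
    then show "X $ k $ l \<in> val_ideal v ((m + pos k - pos l + 3) div 4)"
      by (simp add: algebra_simps)
  qed
next
  assume X: "\<forall>k l. X $ k $ l \<in> val_ideal v ((m + pos k - pos l + 3) div 4)"
  have "X *v x \<in> \<Lambda> (i + m)" if "x \<in> \<Lambda> i" for x i
    unfolding chain_iff
  proof
    fix k
    have "X $ k $ l * x $ l \<in> val_ideal v ((i + m + pos k) div 4)" for l
    proof -
      have "X $ k $ l * x $ l \<in> val_ideal v ((m + pos k - pos l + 3) div 4 + (i + pos l) div 4)"
        using X that chain_iff by (blast intro: val_ideal_mult)
      then show ?thesis
        by (rule val_ideal_mono)
          (use div_4_subadditive[of "m + pos k - pos l" "i + pos l"] in \<open>simp add: algebra_simps\<close>)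
    qed
    then show "(X *v x) $ k \<in> val_ideal v ((i + m + pos k) div 4)"
      by (simp add: matrix_vector_mult_def val_ideal_sum)
  qed
  then show "X \<in> a_filt \<Lambda> m"
    by (auto simp: a_filt_def)
qed

lemma a_filtD: "X \<in> a_filt \<Lambda> m \<Longrightarrow> x \<in> \<Lambda> i \<Longrightarrow> X *v x \<in> \<Lambda> (i + m)"
  by (auto simp: a_filt_def)

lemma a_filtI: "(\<And>i x. x \<in> \<Lambda> i \<Longrightarrow> X *v x \<in> \<Lambda> (i + m)) \<Longrightarrow> X \<in> a_filt \<Lambda> m"
  by (auto simp: a_filt_def)

lemma a_filt_add: "X \<in> a_filt \<Lambda> m \<Longrightarrow> Y \<in> a_filt \<Lambda> m \<Longrightarrow> X + Y \<in> a_filt \<Lambda> m"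
  by (simp add: a_filt_iff val_ideal_add)

lemma a_filt_diff: "X \<in> a_filt \<Lambda> m \<Longrightarrow> Y \<in> a_filt \<Lambda> m \<Longrightarrow> X - Y \<in> a_filt \<Lambda> m"
  by (simp add: a_filt_iff val_ideal_diff)

lemma a_filt_minus: "X \<in> a_filt \<Lambda> m \<Longrightarrow> - X \<in> a_filt \<Lambda> m"
  by (simp add: a_filt_iff)

lemma a_filt_zero: "0 \<in> a_filt \<Lambda> m"
  by (simp add: a_filt_iff)

lemma a_filt_one: "mat 1 \<in> a_filt \<Lambda> 0"
  by (rule a_filtI) simp

lemma a_filt_mult: "X \<in> a_filt \<Lambda> m \<Longrightarrow> Y \<in> a_filt \<Lambda> k \<Longrightarrow> X ** Y \<in> a_filt \<Lambda> (m + k)"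
  using a_filtD[of X m _ "_ + k"] a_filtD[of Y k]
  by (intro a_filtI) (simp add: algebra_simps flip: matrix_vector_mul_assoc)

lemma a_filt_anti: "k \<le> m \<Longrightarrow> X \<in> a_filt \<Lambda> m \<Longrightarrow> X \<in> a_filt \<Lambda> k"
  by (rule a_filtI) (rule chain_anti[OF _ a_filtD], simp_all)

lemma a_filt_integral_scale:
  "c \<in> val_ideal v 0 \<Longrightarrow> X \<in> a_filt \<Lambda> m \<Longrightarrow> mat c ** X \<in> a_filt \<Lambda> m"
  by (simp add: a_filt_iff mat_mult_left val_ideal_integral_mult)

lemma a_filt_sigma: "X \<in> a_filt \<Lambda> m \<Longrightarrow> \<sigma> X \<in> a_filt \<Lambda> m"
  unfolding a_filt_iff
proof (intro allI)
  fix k l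
  assume "\<forall>k l. X $ k $ l \<in> val_ideal v ((m + pos k - pos l + 3) div 4)"
  then have "X $ rv l $ rv k \<in> val_ideal v ((m + pos (rv l) - pos (rv k) + 3) div 4)"
    by blast
  then show "\<sigma> X $ k $ l \<in> val_ideal v ((m + pos k - pos l + 3) div 4)"
    by (simp add: sigma_entry pos_rv algebra_simps)
qed

lemma a_filt_bounded:
  obtains m where "X \<in> a_filt \<Lambda> m"
proof -
  define M where "M = Min (range (\<lambda>(k, l). v (X $ k $ l)))"
  have M: "M \<le> v (X $ k $ l)" for k l
    unfolding M_def by (intro Min_le) (auto intro: range_eqI[of _ _ "(k, l)"])
  have "X \<in> a_filt \<Lambda> (4 * M - 6)"
    unfolding a_filt_iff
  proof (intro allI)
    fix k l
    have "(4 * M - 6 + pos k - pos l + 3) div 4 \<le> M"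
      using pos_range[of k] pos_range[of l] by (simp add: div_4_le_iff)
    then show "X $ k $ l \<in> val_ideal v ((4 * M - 6 + pos k - pos l + 3) div 4)"
      using M[of k l] by (simp add: val_ideal_def)
  qed
  then show thesis by (rule that)
qed

lemma trace_a_filt: "X \<in> a_filt \<Lambda> 1 \<Longrightarrow> trace X \<in> val_ideal v 1"
proof -
  assume X: "X \<in> a_filt \<Lambda> 1"
  have "X $ k $ k \<in> val_ideal v 1" for k
    using X[unfolded a_filt_iff, rule_format, of k k] by simp
  then show ?thesis
    by (simp add: trace_def val_ideal_sum)
qed

end


section \<open>Elements that shift the chain\<close>

context iwahori_chain
begin

lemma chain_strict: "\<exists>u. u \<in> \<Lambda> i \<and> u \<notin> \<Lambda> (i + 1)"
proof -
  have "\<exists>k. (i + 1 + pos k) mod 4 = 0"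
  proof -
    have "(i + 1 + pos 1) mod 4 = 0 \<or> (i + 1 + pos 2) mod 4 = 0 \<or> (i + 1 + pos 3) mod 4 = 0 \<or> (i + 1 + pos 4) mod 4 = 0"
      unfolding pos_simps by presburger
    then show ?thesis by (elim disjE) (rule exI, assumption)+
  qed
  then obtain k where k: "(i + 1 + pos k) mod 4 = 0"
    by (elim exE)
  define q where "q = (i + pos k) div 4"
  have q: "(i + 1 + pos k) div 4 = q + 1"
    unfolding q_def using k by presburger
  let ?u = "axis k (\<pi> powi q)"
  have v: "v (\<pi> powi q) = q" and nz: "\<pi> powi q \<noteq> 0"
    using uniformizer by (simp_all add: val_powi)
  have "?u \<in> \<Lambda> i"
    using v unfolding chain_iff by (auto simp: axis_def val_ideal_def q_def)
  moreover have "?u $ k \<notin> val_ideal v ((i + 1 + pos k) div 4)"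
    using v nz by (simp add: q val_ideal_def)
  then have "?u \<notin> \<Lambda> (i + 1)"
    using chain_iff by blast
  ultimately show ?thesis by blast
qed

lemma chain_inj:
  assumes "\<And>u. u \<in> \<Lambda> i \<longleftrightarrow> u \<in> \<Lambda> j"
  shows "i = j"
proof (rule ccontr)
  assume "i \<noteq> j"
  then consider "i + 1 \<le> j" | "j + 1 \<le> i"
    by linarith
  then show False
    by cases (use assms chain_strict chain_anti in blast)+
qed

text \<open>
  Elements that translate the levels of all vectors by the same amount, or equivalently act
  injectively, with degree \<open>d\<close>, on the graded pieces of the chain.
\<close>

definition shifts :: "'f^4^4 \<Rightarrow> int \<Rightarrow> bool" where
  "shifts X d \<longleftrightarrow> (\<forall>i u. X *v u \<in> \<Lambda> (i + d) \<longleftrightarrow> u \<in> \<Lambda> i)"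

lemma shiftsD: "shifts X d \<Longrightarrow> X *v u \<in> \<Lambda> (i + d) \<longleftrightarrow> u \<in> \<Lambda> i"
  by (simp add: shifts_def)

lemma shifts_mult:
  assumes "shifts X d" "shifts Y e"
  shows "shifts (X ** Y) (d + e)"
  unfolding shifts_def
proof (intro allI)
  fix i u
  show "X ** Y *v u \<in> \<Lambda> (i + (d + e)) \<longleftrightarrow> u \<in> \<Lambda> i"
    using shiftsD[OF assms(1), of "Y *v u" "i + e"] shiftsD[OF assms(2), of u i]
    by (simp add: algebra_simps flip: matrix_vector_mul_assoc)
qed

lemma shifts_scalar: "c \<noteq> 0 \<Longrightarrow> shifts (mat c) (4 * v c)"
  by (simp add: shifts_def mat_mult_vector chain_scale)

text \<open>
  Injectivity on graded pieces suffices: a vector has an exact level \<open>j\<close>, so its image has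
  exact level \<open>j + d\<close>.
\<close>

lemma shiftsI:
  assumes X: "X \<in> a_filt \<Lambda> d"
    and exact: "\<And>i u. u \<in> \<Lambda> i \<Longrightarrow> X *v u \<in> \<Lambda> (i + d + 1) \<Longrightarrow> u \<in> \<Lambda> (i + 1)"
  shows "shifts X d"
  unfolding shifts_def
proof (intro allI iffI)
  fix i u
  assume Xu: "X *v u \<in> \<Lambda> (i + d)"
  show "u \<in> \<Lambda> i"
  proof (cases "u = 0")
    case False
    then obtain j where j: "u \<in> \<Lambda> j" "u \<notin> \<Lambda> (j + 1)"
      using chain_level by blast
    have "i \<le> j"
    proof (rule ccontr)
      assume "\<not> i \<le> j"
      then have "X *v u \<in> \<Lambda> (j + d + 1)"
        using Xu chain_anti[of "j + d + 1" "i + d"] by simp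
      then show False
        using exact j by blast
    qed
    then show ?thesis
      using j chain_anti by blast
  qed simp
qed (rule a_filtD[OF X])

lemma shifts_a_filt: "shifts X d \<Longrightarrow> X \<in> a_filt \<Lambda> d"
  by (auto intro: a_filtI simp: shifts_def)

lemma shifts_perturb:
  assumes X: "shifts X d" and Y: "Y \<in> a_filt \<Lambda> (d + 1)"
  shows "shifts (X + Y) d"
proof (rule shiftsI)
  show "X + Y \<in> a_filt \<Lambda> d"
    using shifts_a_filt[OF X] a_filt_anti[OF _ Y] by (simp add: a_filt_add)
  fix i u
  assume u: "u \<in> \<Lambda> i" and XYu: "(X + Y) *v u \<in> \<Lambda> (i + d + 1)"
  have "Y *v u \<in> \<Lambda> (i + d + 1)"
    using a_filtD[OF Y u] by (simp add: add.assoc)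
  from chain_diff[OF XYu this] have "X *v u \<in> \<Lambda> ((i + 1) + d)"
    by (simp add: algebra_simps)
  then show "u \<in> \<Lambda> (i + 1)"
    using shiftsD[OF X] by blast
qed

text \<open>
  Let \<open>T\<close> raise levels by exactly one for the chain \<open>\<Lambda>\<close> and for the chain \<open>g\<Lambda>\<close>. Then any
  lattice \<open>g\<Lambda> i\<close> is a member of \<open>\<Lambda>\<close>: if \<open>\<Lambda> m\<close> is the smallest member containing it, a vector
  of \<open>g\<Lambda> i\<close> of exact level \<open>m\<close> has images under the powers of \<open>T\<close> of every exact level \<open>m + k\<close>, all
  lying in \<open>g\<Lambda> i\<close>, and these exhaust \<open>\<Lambda> m\<close> as the graded pieces are lines.
\<close>

lemma translate_is_member:
  assumes T: "shifts T 1" and T': "shifts T' 1" and conj: "T ** g = g ** T'" and g: "invertible g"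
  shows "\<exists>m. \<forall>u. g *v u \<in> \<Lambda> m \<longleftrightarrow> u \<in> \<Lambda> i"
proof -
  obtain M where M: "g \<in> a_filt \<Lambda> M"
    using a_filt_bounded by blast
  obtain M' where M': "matrix_inv g \<in> a_filt \<Lambda> M'"
    using a_filt_bounded by blast
  have inv: "g *v (matrix_inv g *v w) = w" "matrix_inv g *v (g *v w) = w" for w
    using matrix_inv_mult[OF g] by (simp_all add: matrix_vector_mul_assoc)
  obtain x where x: "x \<in> \<Lambda> i" "x \<notin> \<Lambda> (i + 1)"
    using chain_strict by blast
  have "g *v x \<noteq> 0"
    using x inv(2)[of x] by auto
  then obtain l where l: "g *v x \<in> \<Lambda> l" "g *v x \<notin> \<Lambda> (l + 1)"
    using chain_level by blast
  have "\<exists>m. (\<forall>u\<in>\<Lambda> i. g *v u \<in> \<Lambda> m) \<and> \<not> (\<forall>u\<in>\<Lambda> i. g *v u \<in> \<Lambda> (m + 1))"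
  proof (rule ccontr)
    assume no: "\<not> ?thesis"
    have "\<forall>u\<in>\<Lambda> i. g *v u \<in> \<Lambda> m" if ge: "i + M \<le> m" for m
      using ge
    proof (induction m rule: int_ge_induct)
      case base
      then show ?case using a_filtD[OF M] by blast
    next
      case (step m)
      then show ?case using no by blast
    qed
    from this[of "max (i + M) (l + 1)"] have "g *v x \<in> \<Lambda> (max (i + M) (l + 1))"
      using x by simp
    then show False
      using l chain_anti[of "l + 1" "max (i + M) (l + 1)"] by simp
  qed
  then obtain m u0 where m: "\<And>u. u \<in> \<Lambda> i \<Longrightarrow> g *v u \<in> \<Lambda> m" and u0: "u0 \<in> \<Lambda> i" "g *v u0 \<notin> \<Lambda> (m + 1)"
    by blast
  have orbit: "\<exists>u\<in>\<Lambda> i. g *v u \<in> \<Lambda> (m + int k) \<and> g *v u \<notin> \<Lambda> (m + int k + 1)" for k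
  proof (induction k)
    case 0
    then show ?case using m u0 by auto
  next
    case (Suc k)
    then obtain u where u: "u \<in> \<Lambda> i" "g *v u \<in> \<Lambda> (m + int k)" "g *v u \<notin> \<Lambda> (m + int k + 1)"
      by blast
    have eq: "g *v (T' *v u) = T *v (g *v u)"
      by (simp add: matrix_vector_mul_assoc conj)
    have "T' *v u \<in> \<Lambda> (i + 1)"
      using shiftsD[OF T'] u by blast
    then have "T' *v u \<in> \<Lambda> i"
      using chain_anti[of i "i + 1"] by simp
    moreover have "T *v (g *v u) \<in> \<Lambda> (m + int k + 1)" "T *v (g *v u) \<notin> \<Lambda> (m + int k + 1 + 1)"
      using shiftsD[OF T] u by blast+
    ultimately show ?case
      by (intro bexI[of _ "T' *v u"]) (simp_all add: eq algebra_simps)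
  qed
  have below: "\<forall>w\<in>\<Lambda> (m + int k). matrix_inv g *v w \<in> \<Lambda> i" if k: "k \<le> nat (i - m - M')" for k
    using k
  proof (induction k rule: inc_induct)
    case base
    show ?case
    proof
      fix w
      assume w: "w \<in> \<Lambda> (m + int (nat (i - m - M')))"
      show "matrix_inv g *v w \<in> \<Lambda> i"
        by (rule chain_anti[OF _ a_filtD[OF M' w]]) simp
    qed
  next
    case (step k)
    show ?case
    proof
      fix w
      assume w: "w \<in> \<Lambda> (m + int k)"
      obtain u where u: "u \<in> \<Lambda> i" "g *v u \<in> \<Lambda> (m + int k)" "g *v u \<notin> \<Lambda> (m + int k + 1)"
        using orbit by blast
      obtain a where a: "a \<in> val_ideal v 0" "w - a *s (g *v u) \<in> \<Lambda> (m + int k + 1)"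
        using chain_graded_line[OF u(2,3) w] by blast
      have "matrix_inv g *v (w - a *s (g *v u)) \<in> \<Lambda> i"
      proof -
        have "m + int (Suc k) = m + int k + 1"
          by simp
        with step.IH a(2) show ?thesis
          by (simp only:)
      qed
      then have "matrix_inv g *v w - a *s u \<in> \<Lambda> i"
        by (simp add: matrix_vector_mult_diff_distrib matrix_vector_mult_scale inv)
      from chain_add[OF this chain_integral_scale[OF a(1) u(1)]] show "matrix_inv g *v w \<in> \<Lambda> i"
        by simp
    qed
  qed
  have "g *v u \<in> \<Lambda> m \<longleftrightarrow> u \<in> \<Lambda> i" for u
    using m[of u] below[of 0] inv(2)[of u] by fastforce
  then show ?thesis by blast
qed

text \<open>
  Every \<open>g\<Lambda> i\<close> is some \<open>\<Lambda> (m i)\<close>; as \<open>T\<close> carries \<open>\<Lambda> (m i)\<close> to \<open>\<Lambda> (m i + 1)\<close> and \<open>g\<Lambda> i\<close> to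
  \<open>g\<Lambda> (i + 1)\<close>, the index \<open>m i\<close> grows in steps of one.
\<close>

lemma normalizes_of_common_shift:
  assumes T: "shifts T 1" and T': "shifts T' 1" and conj: "T ** g = g ** T'" and g: "invertible g"
  shows "\<exists>c. shifts g c"
proof -
  have inv: "g *v (matrix_inv g *v w) = w" for w
    using matrix_inv_mult[OF g] by (simp add: matrix_vector_mul_assoc)
  obtain m where m: "\<And>i u. g *v u \<in> \<Lambda> (m i) \<longleftrightarrow> u \<in> \<Lambda> i"
    using translate_is_member[OF assms] by metis
  have step: "m (i + 1) = m i + 1" for i
  proof -
    have "w \<in> \<Lambda> (m (i + 1) - 1) \<longleftrightarrow> w \<in> \<Lambda> (m i)" for w
    proof -
      define u where "u = matrix_inv g *v w"
      have gu: "g *v u = w"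
        by (simp add: u_def inv)
      have "w \<in> \<Lambda> (m (i + 1) - 1) \<longleftrightarrow> T *v w \<in> \<Lambda> (m (i + 1))"
        using shiftsD[OF T, of w "m (i + 1) - 1"] by simp
      also have "T *v w = g *v (T' *v u)"
        by (simp add: gu[symmetric] matrix_vector_mul_assoc conj)
      also have "\<dots> \<in> \<Lambda> (m (i + 1)) \<longleftrightarrow> u \<in> \<Lambda> i"
        using m shiftsD[OF T'] by blast
      also have "\<dots> \<longleftrightarrow> w \<in> \<Lambda> (m i)"
        using m gu by metis
      finally show ?thesis .
    qed
    from chain_inj[OF this] show ?thesis by simp
  qed
  have "m i = i + m 0" for i
  proof (induction i rule: int_induct[where k = 0])
    case (step2 i)
    then show ?case using step[of "i - 1"] by simp
  qed (simp_all add: step)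
  then have "shifts g (m 0)"
    using m unfolding shifts_def by metis
  then show ?thesis by blast
qed

text \<open>
  The image under \<open>g\<close> of the dual of \<open>\<Lambda> 0\<close> is the dual of \<open>\<Lambda> c\<close>. The first has index \<open>d + c\<close>, the
  second \<open>d - c\<close>, because duality reverses the chain.
\<close>

lemma unitary_shift_zero:
  assumes g: "g \<in> U22 cj" and c: "shifts g c" and dual: "self_dual v cj \<Lambda>"
  shows "c = 0"
proof -
  obtain d where d: "\<And>i. dual_lattice v cj (\<Lambda> i) = \<Lambda> (d - i)"
    using dual unfolding self_dual_def by blast
  have inv: "g *v (matrix_inv g *v w) = w" for w
    using matrix_inv_mult[OF U22_invertible[OF g]] by (simp add: matrix_vector_mul_assoc)
  have "w \<in> \<Lambda> d \<longleftrightarrow> w \<in> \<Lambda> (d - c - c)" for w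
  proof -
    have "w \<in> \<Lambda> d \<longleftrightarrow> (\<forall>y\<in>\<Lambda> 0. herm cj (g *v w) (g *v y) \<in> val_ideal v 0)"
      using d[of 0] by (auto simp: dual_lattice_def herm_U22[OF g])
    also have "\<dots> \<longleftrightarrow> (\<forall>z\<in>\<Lambda> c. herm cj (g *v w) z \<in> val_ideal v 0)"
    proof -
      have "z \<in> \<Lambda> c \<longleftrightarrow> matrix_inv g *v z \<in> \<Lambda> 0" for z
        using shiftsD[OF c, of "matrix_inv g *v z" 0] inv by simp
      moreover have "y \<in> \<Lambda> 0 \<longleftrightarrow> g *v y \<in> \<Lambda> c" for y
        using shiftsD[OF c, of y 0] by simp
      ultimately show ?thesis
        by (metis inv)
    qed
    also have "\<dots> \<longleftrightarrow> g *v w \<in> \<Lambda> (d - c)"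
      by (simp add: d[symmetric] dual_lattice_def)
    also have "\<dots> \<longleftrightarrow> w \<in> \<Lambda> (d - c - c)"
      using shiftsD[OF c, of w "d - c - c"] by simp
    finally show ?thesis .
  qed
  from chain_inj[OF this] show ?thesis by simp
qed

end


section \<open>Fundamental strata of level coprime to the period shift the chain\<close>

context discrete_valuation
begin

text \<open>
  For \<open>m = 0\<close> the polynomials with integral coefficients, for \<open>m = 1\<close> those that reduce to zero.
\<close>

definition poly_ideal :: "int \<Rightarrow> 'f poly set" where
  "poly_ideal m = {p. \<forall>i. poly.coeff p i \<in> val_ideal v m}"

lemma poly_ideal_add: "p \<in> poly_ideal m \<Longrightarrow> q \<in> poly_ideal m \<Longrightarrow> p + q \<in> poly_ideal m"
  by (simp add: poly_ideal_def val_ideal_add)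

lemma poly_ideal_zero: "0 \<in> poly_ideal m"
  by (simp add: poly_ideal_def)

lemma poly_ideal_minus: "p \<in> poly_ideal m \<Longrightarrow> - p \<in> poly_ideal m"
  by (simp add: poly_ideal_def)

lemma poly_ideal_mult: "p \<in> poly_ideal m \<Longrightarrow> q \<in> poly_ideal k \<Longrightarrow> p * q \<in> poly_ideal (m + k)"
  by (auto simp: poly_ideal_def coeff_mult intro!: val_ideal_sum val_ideal_mult)

lemma poly_ideal_sum: "(\<And>i. i \<in> I \<Longrightarrow> f i \<in> poly_ideal m) \<Longrightarrow> sum f I \<in> poly_ideal m"
  by (induction I rule: infinite_finite_induct) (auto intro: poly_ideal_add poly_ideal_zero)

lemma poly_ideal_prod:
  assumes "\<And>i. i \<in> I \<Longrightarrow> f i \<in> poly_ideal 0"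
  shows "prod f I \<in> poly_ideal 0"
  using assms
proof (induction I rule: infinite_finite_induct)
  case (insert x F)
  then show ?case using poly_ideal_mult[of "f x" 0 "prod f F" 0] by simp
qed (simp_all add: poly_ideal_def coeff_1)

lemma poly_ideal_prod_max:
  assumes "\<And>i. i \<in> I \<Longrightarrow> f i \<in> poly_ideal 0" "finite I" "j \<in> I" "f j \<in> poly_ideal 1"
  shows "prod f I \<in> poly_ideal 1"
  using poly_ideal_mult[of "f j" 1 "prod f (I - {j})" 0] poly_ideal_prod[of "I - {j}" f] assms
  by (simp add: prod.remove)

lemma poly_ideal_prod_cong:
  assumes "\<And>i. i \<in> I \<Longrightarrow> a i \<in> poly_ideal 0" "\<And>i. i \<in> I \<Longrightarrow> b i \<in> poly_ideal 1"
  shows "(\<Prod>i\<in>I. a i + b i) - prod a I \<in> poly_ideal 1"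
  using assms
proof (induction I rule: infinite_finite_induct)
  case (insert x F)
  have b0: "b i \<in> poly_ideal 0" if "i \<in> insert x F" for i
    using insert.prems(2)[OF that] by (auto simp: poly_ideal_def intro: val_ideal_mono[of _ 1 0])
  have "a x * ((\<Prod>i\<in>F. a i + b i) - prod a F) \<in> poly_ideal (0 + 1)"
    using insert by (intro poly_ideal_mult) auto
  moreover have "b x * (\<Prod>i\<in>F. a i + b i) \<in> poly_ideal (1 + 0)"
    using insert b0 by (intro poly_ideal_mult poly_ideal_prod poly_ideal_add) auto
  ultimately have "a x * ((\<Prod>i\<in>F. a i + b i) - prod a F) + b x * (\<Prod>i\<in>F. a i + b i) \<in> poly_ideal 1"
    by (simp add: poly_ideal_add)
  then show ?case
    using insert by (simp add: algebra_simps)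
qed (simp_all add: poly_ideal_zero)

text \<open>
  Congruence modulo the maximal ideal, in terms of cosets: coefficients with difference in the maximal
  ideal have the same coset, and the coset of \<open>0\<close> is the ideal itself.
\<close>

lemma reduce_poly_eq_monom:
  assumes "p - Polynomial.monom 1 k \<in> poly_ideal 1"
  shows "reduce_poly v p =
    up_ring.monom (UP (residue_field UNIV v)) \<one>\<^bsub>residue_field UNIV v\<^esub> k"
proof -
  let ?R = "residue_field UNIV v" and ?I = "val_ideal v 1"
  have coset: "?I +>\<^bsub>val_ring UNIV v\<^esub> c = {i + c | i. i \<in> ?I}" for c
    by (auto simp: val_ring_def a_r_coset_defs)
  have one: "\<one>\<^bsub>?R\<^esub> = ?I +>\<^bsub>val_ring UNIV v\<^esub> 1" and zero: "\<zero>\<^bsub>?R\<^esub> = ?I"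
    by (simp_all add: residue_field_def FactRing_def val_ring_def)
  have "\<one>\<^bsub>?R\<^esub> \<in> carrier ?R"
    unfolding one by (auto simp: residue_field_def FactRing_def A_RCOSETS_defs RCOSETS_def
        val_ring_def a_r_coset_defs)
  then have monom: "up_ring.monom (UP ?R) \<one>\<^bsub>?R\<^esub> k = (\<lambda>i. if i = k then \<one>\<^bsub>?R\<^esub> else \<zero>\<^bsub>?R\<^esub>)"
    by (simp add: UP_def)
  have shift: "{i + c | i. i \<in> ?I} = {i + d | i. i \<in> ?I}" if cd: "c - d \<in> ?I" for c d
  proof -
    have "i + c = (i + (c - d)) + d" "i + d = (i - (c - d)) + c" for i
      by simp_all
    then show ?thesis
      using val_ideal_add[OF _ cd] val_ideal_diff[OF _ cd] by blast
  qed
  have "?I +>\<^bsub>val_ring UNIV v\<^esub> poly.coeff p i = (if i = k then \<one>\<^bsub>?R\<^esub> else \<zero>\<^bsub>?R\<^esub>)" for i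
  proof -
    have "poly.coeff p i - (if i = k then 1 else 0) \<in> ?I"
      using assms by (auto simp: poly_ideal_def dest: spec[of _ i])
    from shift[OF this] show ?thesis
      unfolding one zero coset by (auto split: if_splits)
  qed
  then show ?thesis
    unfolding monom reduce_poly_def by blast
qed

end

context iwahori_chain
begin

text \<open>
  Modulo the maximal ideal, \<open>X\<close> is strictly upper triangular. In the permutation expansion of the
  determinant, a permutation \<open>p \<noteq> id\<close> has an index with \<open>p i < i\<close>, where the entry vanishes, and
  the identity contributes the fourth power of the variable.
\<close>

lemma charpoly_a_filt_1:
  assumes X: "X \<in> a_filt \<Lambda> 1"
  shows "charpoly X - Polynomial.monom 1 4 \<in> poly_ideal 1"
proof -
  define A :: "'f poly^4^4" where "A = (\<chi> i j. (if i = j then [:0, 1:] else 0) - [:X $ i $ j:])"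
  have entry: "[:c:] \<in> poly_ideal m \<longleftrightarrow> c \<in> val_ideal v m" for c m
    by (auto simp: poly_ideal_def coeff_pCons split: nat.splits)
  have var: "[:0, 1:] \<in> poly_ideal 0"
    by (auto simp: poly_ideal_def coeff_pCons val_ideal_def val_one split: nat.splits)
  have Xin: "X $ i $ j \<in> val_ideal v ((1 + pos i - pos j + 3) div 4)" for i j
    using X a_filt_iff by blast
  have X0: "X $ i $ j \<in> val_ideal v 0" for i j
    by (rule val_ideal_mono[OF Xin]) (use pos_range[of i] pos_range[of j] in simp)
  have X1: "X $ i $ j \<in> val_ideal v 1" if "pos j \<le> pos i" for i j
  proof -
    have "1 \<le> (1 + pos i - pos j + 3) div 4"
      using that by presburger
    then show ?thesis using Xin val_ideal_mono by blast
  qed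
  have A0: "A $ i $ j \<in> poly_ideal 0" for i j
    unfolding A_def using entry X0 var poly_ideal_add[OF _ poly_ideal_minus] poly_ideal_zero
    by (auto simp: diff_conv_add_uminus simp del: add_uminus_conv_diff minus_pCons)
  have off_diag: "of_int (sign p) * (\<Prod>i\<in>UNIV. A $ i $ p i) \<in> poly_ideal 1"
    if p: "p permutes UNIV" "p \<noteq> id" for p
  proof -
    have "\<exists>i. pos (p i) < pos i"
    proof (rule ccontr)
      assume "\<not> ?thesis"
      then have le: "pos i \<le> pos (p i)" for i
        by (meson not_le)
      have "bij p"
        using p permutes_bij by blast
      then have eq: "(\<Sum>i\<in>UNIV. pos (p i)) = (\<Sum>i\<in>UNIV. pos i)"
        by (rule sum.reindex_bij_betw)
      have "pos (p i) = pos i" for i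
      proof (rule ccontr)
        assume "pos (p i) \<noteq> pos i"
        then have "(\<Sum>i\<in>UNIV. pos i) < (\<Sum>i\<in>UNIV. pos (p i))"
          using le by (intro sum_strict_mono_ex1) (auto simp: less_le intro: exI[of _ i])
        then show False using eq by simp
      qed
      then show False
        using p pos_inj by (auto simp: fun_eq_iff)
    qed
    then obtain i where i: "pos (p i) < pos i" by blast
    then have "i \<noteq> p i"
      by auto
    then have "A $ i $ p i \<in> poly_ideal 1"
      using i X1[of "p i" i] poly_ideal_minus[of "[:X $ i $ p i:]" 1] by (simp add: A_def entry)
    then have "(\<Prod>i\<in>UNIV. A $ i $ p i) \<in> poly_ideal 1"
      using A0 by (intro poly_ideal_prod_max[where j = i]) auto
    then show ?thesis
      using poly_ideal_minus by (cases p rule: sign_cases) auto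
  qed
  have diag: "(\<Prod>i\<in>UNIV. A $ i $ i) - Polynomial.monom 1 4 \<in> poly_ideal 1"
  proof -
    have "(\<Prod>i\<in>UNIV. [:0, 1:] + - [:X $ i $ i:]) - (\<Prod>i\<in>(UNIV :: 4 set). [:0, 1:]) \<in> poly_ideal 1"
      using var X1 entry poly_ideal_minus by (intro poly_ideal_prod_cong) blast+
    moreover have "(\<Prod>i\<in>(UNIV :: 4 set). [:0, 1:]) = Polynomial.monom (1::'f) 4"
      by (simp add: monom_altdef)
    moreover have "A $ i $ i = [:0, 1:] + - [:X $ i $ i:]" for i
      by (simp add: A_def)
    ultimately show ?thesis by simp
  qed
  have "charpoly X = (\<Sum>p\<in>{p. p permutes UNIV}. of_int (sign p) * (\<Prod>i\<in>UNIV. A $ i $ p i))"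
    by (simp add: charpoly_def det_def A_def)
  also have "\<dots> = (\<Prod>i\<in>UNIV. A $ i $ i)
      + (\<Sum>p\<in>{p. p permutes UNIV} - {id}. of_int (sign p) * (\<Prod>i\<in>UNIV. A $ i $ p i))"
    by (subst sum.remove[of _ id]) (simp_all add: permutes_id finite_permutations)
  finally have "charpoly X - Polynomial.monom 1 4 = ((\<Prod>i\<in>UNIV. A $ i $ i) - Polynomial.monom 1 4)
      + (\<Sum>p\<in>{p. p permutes UNIV} - {id}. of_int (sign p) * (\<Prod>i\<in>UNIV. A $ i $ p i))"
    by simp
  moreover have "(\<Sum>p\<in>{p. p permutes UNIV} - {id}. of_int (sign p) * (\<Prod>i\<in>UNIV. A $ i $ p i)) \<in> poly_ideal 1"
    using off_diag by (intro poly_ideal_sum) blast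
  ultimately show ?thesis
    by (simp only: poly_ideal_add[OF diag])
qed

lemma period_chain: "period \<pi> \<Lambda> = 4"
proof -
  have scale: "lattice_scale \<pi> (\<Lambda> i) = \<Lambda> (i + 4)" for i
  proof (rule Set.set_eqI)
    fix x
    have "x \<in> lattice_scale \<pi> (\<Lambda> i) \<longleftrightarrow> inverse \<pi> *s x \<in> \<Lambda> i"
      using uniformizer by (simp add: lattice_scale_iff)
    also have "\<dots> \<longleftrightarrow> \<pi> *s (inverse \<pi> *s x) \<in> \<Lambda> (i + 4)"
      using chain_scale[of \<pi> "inverse \<pi> *s x" i] uniformizer by simp
    finally show "x \<in> lattice_scale \<pi> (\<Lambda> i) \<longleftrightarrow> x \<in> \<Lambda> (i + 4)"
      using uniformizer by simp
  qed
  have "e = 4" if e: "is_period \<pi> \<Lambda> e" for e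
  proof -
    have "\<Lambda> (0 + 4) = \<Lambda> (0 + int e)"
      using e scale unfolding is_period_def by metis
    then have "0 + 4 = 0 + int e"
      by (intro chain_inj) simp
    then show ?thesis by simp
  qed
  moreover have "is_period \<pi> \<Lambda> 4"
    using scale by (simp add: is_period_def)
  ultimately show ?thesis
    unfolding period_def by blast
qed

text \<open>
  The multiples \<open>0\<close>, \<open>n\<close>, \<open>2 n\<close>, \<open>3 n\<close> of an odd number represent all classes modulo \<open>4\<close>.
\<close>

lemma odd_step_residues:
  fixes j n i :: int
  assumes "odd n"
  shows "4 dvd j - i \<or> 4 dvd j - n - i \<or> 4 dvd j - n - n - i \<or> 4 dvd j - n - n - n - i"
proof -
  have "4 dvd d \<or> 4 dvd d - n \<or> 4 dvd d - 2 * n \<or> 4 dvd d - 3 * n" for d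
    using assms by presburger
  from this[of "j - i"] show ?thesis
    by (simp add: algebra_simps)
qed

text \<open>
  If \<open>\<beta>\<close> moved some vector of exact level \<open>i\<close> by more than \<open>- n\<close>, it would do so on all of \<open>\<Lambda> i\<close>, and
  on \<open>\<Lambda> j\<close> for every \<open>j \<equiv> i\<close> modulo \<open>4\<close>. As \<open>n\<close> is odd, four consecutive applications of \<open>\<beta>\<close> start
  from levels in every class modulo \<open>4\<close>, so that \<open>\<pi>\<^sup>n \<beta>\<^sup>4\<close> would be strictly upper triangular modulo
  the maximal ideal.
\<close>

lemma fundamental_shifts:
  assumes \<beta>: "\<beta> \<in> a_filt \<Lambda> (- int n)" and fund: "fundamental v \<pi> \<Lambda> n \<beta>" and n: "coprime n 4"
  shows "shifts \<beta> (- int n)"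
proof (rule shiftsI[OF \<beta>], rule ccontr)
  fix i u
  assume u: "u \<in> \<Lambda> i" "\<beta> *v u \<in> \<Lambda> (i + - int n + 1)" "u \<notin> \<Lambda> (i + 1)"
  define bad where "bad j \<longleftrightarrow> (\<forall>w\<in>\<Lambda> j. \<beta> *v w \<in> \<Lambda> (j - int n + 1))" for j
  have "bad i"
    unfolding bad_def
  proof
    fix w
    assume "w \<in> \<Lambda> i"
    then obtain a where a: "a \<in> val_ideal v 0" "w - a *s u \<in> \<Lambda> (i + 1)"
      using chain_graded_line u by blast
    have "\<beta> *v (w - a *s u) \<in> \<Lambda> (i - int n + 1)"
      using a_filtD[OF \<beta> a(2)] by (simp add: algebra_simps)
    moreover have "a *s (\<beta> *v u) \<in> \<Lambda> (i - int n + 1)"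
      using chain_integral_scale[OF a(1)] u by simp
    ultimately have "\<beta> *v (w - a *s u) + a *s (\<beta> *v u) \<in> \<Lambda> (i - int n + 1)"
      by (rule chain_add)
    then show "\<beta> *v w \<in> \<Lambda> (i - int n + 1)"
      by (simp add: matrix_vector_mult_diff_distrib matrix_vector_mult_scale)
  qed
  have bad_mod: "bad (i + 4 * k)" for k
    unfolding bad_def
  proof
    fix w
    assume w: "w \<in> \<Lambda> (i + 4 * k)"
    define c where "c = \<pi> powi k"
    have c: "c \<noteq> 0" "v c = k"
      using uniformizer by (simp_all add: c_def val_powi)
    define w' where "w' = inverse c *s w"
    have ww': "w = c *s w'"
      using c by (simp add: w'_def)
    have "w' \<in> \<Lambda> i"
      using w chain_scale[of c w' i] c by (simp add: ww')
    then have "\<beta> *v w' \<in> \<Lambda> (i - int n + 1)"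
      using \<open>bad i\<close> by (simp add: bad_def)
    then have "c *s (\<beta> *v w') \<in> \<Lambda> (i - int n + 1 + 4 * v c)"
      using c(1) chain_scale[of c "\<beta> *v w'" "i - int n + 1"] by simp
    then show "\<beta> *v w \<in> \<Lambda> (i + 4 * k - int n + 1)"
      using c by (simp add: ww' matrix_vector_mult_scale algebra_simps)
  qed
  let ?y = "y_elt \<pi> \<Lambda> n \<beta>"
  have "gcd 4 n = 1"
    using n by (simp add: coprime_iff_gcd_eq_1 gcd.commute)
  then have y: "?y *v w = \<pi> ^ n *s (\<beta> *v (\<beta> *v (\<beta> *v (\<beta> *v w))))" for w
    by (simp add: y_elt_def Let_def period_chain matrix_power_def numeral_eq_Suc mat_mult_vector
        flip: matrix_vector_mul_assoc)
  have "?y \<in> a_filt \<Lambda> 1"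
  proof (rule a_filtI)
    fix j w
    assume w: "w \<in> \<Lambda> j"
    have good: "x \<in> \<Lambda> l \<Longrightarrow> \<beta> *v x \<in> \<Lambda> (l - int n)" for x l
      using a_filtD[OF \<beta>] by (metis diff_conv_add_uminus)
    have good1: "x \<in> \<Lambda> (l + 1) \<Longrightarrow> \<beta> *v x \<in> \<Lambda> (l - int n + 1)" for x l
      using good[of x "l + 1"] by (simp add: algebra_simps)
    have bad: "x \<in> \<Lambda> l \<Longrightarrow> \<beta> *v x \<in> \<Lambda> (l - int n + 1)" if "\<exists>k. l = i + 4 * k" for x l
      using bad_mod that unfolding bad_def by blast
    have "odd n"
      using n by (metis coprime_common_divisor even_numeral odd_one)
    then have "odd (int n)"
      by simp
    then have "4 dvd j - i \<or> 4 dvd j - int n - i \<or> 4 dvd j - int n - int n - i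
        \<or> 4 dvd j - int n - int n - int n - i"
      by (rule odd_step_residues)
    moreover have "\<exists>k. l = i + 4 * k" if "4 dvd l - i" for l
      using that by (auto elim!: dvdE simp: algebra_simps)
    ultimately have "(\<exists>k. j = i + 4 * k) \<or> (\<exists>k. j - int n = i + 4 * k) \<or> (\<exists>k. j - int n - int n = i + 4 * k)
        \<or> (\<exists>k. j - int n - int n - int n = i + 4 * k)"
      by metis
    then have "\<beta> *v (\<beta> *v (\<beta> *v (\<beta> *v w))) \<in> \<Lambda> (j - int n - int n - int n - int n + 1)"
    proof (elim disjE)
      assume "\<exists>k. j = i + 4 * k"
      from good1[OF good1[OF good1[OF bad[OF this w]]]] show ?thesis .
    next
      assume "\<exists>k. j - int n = i + 4 * k"
      from good1[OF good1[OF bad[OF this good[OF w]]]] show ?thesis .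
    next
      assume "\<exists>k. j - int n - int n = i + 4 * k"
      from good1[OF bad[OF this good[OF good[OF w]]]] show ?thesis .
    next
      assume "\<exists>k. j - int n - int n - int n = i + 4 * k"
      from bad[OF this good[OF good[OF good[OF w]]]] show ?thesis .
    qed
    moreover have "v (\<pi> ^ n) = int n" "\<pi> ^ n \<noteq> 0"
      using uniformizer by (simp_all add: val_power)
    ultimately have "?y *v w \<in> \<Lambda> (j - int n - int n - int n - int n + 1 + 4 * int n)"
      unfolding y using chain_scale[of "\<pi> ^ n"] by metis
    then show "?y *v w \<in> \<Lambda> (j + 1)"
      by (simp add: algebra_simps)
  qed
  then have "reduce_poly v (charpoly ?y) =
      up_ring.monom (UP (residue_field UNIV v)) \<one>\<^bsub>residue_field UNIV v\<^esub> 4"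
    by (intro reduce_poly_eq_monom charpoly_a_filt_1)
  then show False
    using fund by (simp add: fundamental_def)
qed

text \<open>
  A power of an element of odd shift, times a power of the uniformizer, shifts by exactly one: the
  exponents are \<open>3\<close> or \<open>1\<close> as \<open>n\<close> is \<open>1\<close> or \<open>3\<close> modulo \<open>4\<close>.
\<close>

lemma conjugate_shifts_normalizes:
  assumes X: "shifts X (- int n)" and X': "shifts X' (- int n)" and conj: "X ** g = g ** X'"
    and g: "invertible g" and n: "coprime n 4"
  shows "\<exists>c. shifts g c"
proof -
  have "odd n"
    using n by (metis coprime_common_divisor even_numeral odd_one)
  then have cases: "n mod 4 = 1 \<or> n mod 4 = 3"
    by presburger
  have nz: "\<pi> ^ b \<noteq> 0" and val: "v (\<pi> ^ b) = int b" for b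
    using uniformizer by (simp_all add: val_power)
  have comm: "mat (\<pi> ^ b) ** g = g ** mat (\<pi> ^ b)" for b
    by (rule mat_mult_commute)
  have conj': "Y ** X ** g = Y ** g ** X'" for Y :: "'f^4^4"
    using conj by (simp flip: matrix_mul_assoc)
  from cases show ?thesis
  proof
    assume n1: "n mod 4 = 1"
    \<comment> \<open>\<open>\<pi>\<^sup>b X\<^sup>3\<close> has shift \<open>4 b - 3 n = 1\<close>.\<close>
    define b where "b = (3 * n + 1) div 4"
    have "4 * b = 3 * n + 1"
      unfolding b_def using n1 by presburger
    then have b: "4 * int b + - int n + - int n + - int n = 1"
      by linarith
    have shift: "shifts (mat (\<pi> ^ b) ** Z ** Z ** Z) 1" if "shifts Z (- int n)" for Z
      using shifts_mult[OF shifts_mult[OF shifts_mult[OF shifts_scalar[OF nz[of b]] that] that] that]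
      unfolding val b .
    show ?thesis
      by (rule normalizes_of_common_shift[OF shift[OF X] shift[OF X'] _ g])
        (simp add: conj' comm matrix_mul_assoc)
  next
    assume n3: "n mod 4 = 3"
    \<comment> \<open>\<open>\<pi>\<^sup>b X\<close> has shift \<open>4 b - n = 1\<close>.\<close>
    define b where "b = (n + 1) div 4"
    have "4 * b = n + 1"
      unfolding b_def using n3 by presburger
    then have b: "4 * int b + - int n = 1"
      by linarith
    have shift: "shifts (mat (\<pi> ^ b) ** Z) 1" if "shifts Z (- int n)" for Z
      using shifts_mult[OF shifts_scalar[OF nz[of b]] that] unfolding val b .
    show ?thesis
      by (rule normalizes_of_common_shift[OF shift[OF X] shift[OF X'] _ g])
        (simp add: conj' comm matrix_mul_assoc)
  qed
qed

end


section \<open>Duality for lattices\<close>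

context discrete_valuation
begin

text \<open>
  Gaussian elimination over the valuation ring, coordinate \<open>j\<close> at a time: an element \<open>a\<close> of
  the module whose \<open>j\<close>-th coordinate has least valuation clears that coordinate of all others, and
  a functional found on the elements with vanishing \<open>j\<close>-th coordinate extends by requiring that it
  vanishes on \<open>a\<close>.
\<close>

lemma separating_functional:
  fixes S :: "('i \<Rightarrow> 'f) set" and b :: "'i \<Rightarrow> 'f"
  assumes "finite I"
    and "\<And>x y. x \<in> S \<Longrightarrow> y \<in> S \<Longrightarrow> (\<lambda>i. x i - y i) \<in> S"
    and "\<And>c x. c \<in> val_ideal v 0 \<Longrightarrow> x \<in> S \<Longrightarrow> (\<lambda>i. c * x i) \<in> S"
    and "(\<lambda>i. 0) \<in> S"
    and "\<And>x i. x \<in> S \<Longrightarrow> i \<notin> I \<Longrightarrow> x i = 0" and "\<And>i. i \<notin> I \<Longrightarrow> b i = 0"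
    and "\<And>x i. x \<in> S \<Longrightarrow> x i \<in> val_ideal v N"
    and "b \<notin> S"
  shows "\<exists>l. (\<forall>x\<in>S. (\<Sum>i\<in>I. l i * x i) \<in> val_ideal v 1) \<and> (\<Sum>i\<in>I. l i * b i) \<notin> val_ideal v 1"
  using assms
proof (induction I arbitrary: S b rule: finite_induct)
  case empty
  then have "b = (\<lambda>i. 0)" by auto
  then show ?case using empty by simp
next
  case (insert j I)
  have diff: "(\<lambda>i. x i - y i) \<in> S" if "x \<in> S" "y \<in> S" for x y
    using insert.prems(1) that by blast
  have scale: "(\<lambda>i. c * x i) \<in> S" if "c \<in> val_ideal v 0" "x \<in> S" for c x
    using insert.prems(2) that by blast
  have zero: "(\<lambda>i. 0) \<in> S" and supp: "\<And>x i. x \<in> S \<Longrightarrow> i \<notin> insert j I \<Longrightarrow> x i = 0"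
    and suppb: "\<And>i. i \<notin> insert j I \<Longrightarrow> b i = 0"
    and bounded: "\<And>x i. x \<in> S \<Longrightarrow> x i \<in> val_ideal v N" and bS: "b \<notin> S"
    using insert.prems(3-7) by blast+
  have one: "1 \<notin> val_ideal v 1"
    by (simp add: val_ideal_def val_one)
  have single: "(\<Sum>i\<in>insert j I. (if i = j then c else 0) * x i) = c * x j" for c and x :: "'i \<Rightarrow> 'f"
  proof -
    have "(\<Sum>i\<in>insert j I. (if i = j then c else 0) * x i) = (\<Sum>i\<in>insert j I. if i = j then c * x j else 0)"
      by (intro sum.cong) auto
    then show ?thesis using insert.hyps by simp
  qed
  show ?case
  proof (cases "\<forall>x\<in>S. x j = 0")
    case True
    show ?thesis
    proof (cases "b j = 0")
      case False
      show ?thesis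
        by (rule exI[of _ "\<lambda>i. if i = j then inverse (b j) else 0"]) (simp add: single True[rule_format] False one)
    next
      case bj: True
      have "\<exists>l. (\<forall>x\<in>S. (\<Sum>i\<in>I. l i * x i) \<in> val_ideal v 1) \<and> (\<Sum>i\<in>I. l i * b i) \<notin> val_ideal v 1"
      proof (rule insert.IH)
        show "x i = 0" if "x \<in> S" "i \<notin> I" for x i
          using that supp[of x i] True by (cases "i = j") auto
        show "b i = 0" if "i \<notin> I" for i
          using that suppb[of i] bj by (cases "i = j") auto
      qed (fact diff scale zero bounded bS)+
      then obtain l where l: "\<And>x. x \<in> S \<Longrightarrow> (\<Sum>i\<in>I. l i * x i) \<in> val_ideal v 1"
        "(\<Sum>i\<in>I. l i * b i) \<notin> val_ideal v 1"
        by blast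
      have "(\<Sum>i\<in>insert j I. l i * x i) = (\<Sum>i\<in>I. l i * x i)" if "x j = 0" for x
        using that insert.hyps by simp
      then show ?thesis
        using l True bj by (intro exI[of _ l]) simp
    qed
  next
    case False
    then obtain x0 where x0: "x0 \<in> S \<and> x0 j \<noteq> 0" by blast
    obtain a where a: "a \<in> S" "a j \<noteq> 0"
      and least: "\<And>x. x \<in> S \<Longrightarrow> x j \<noteq> 0 \<Longrightarrow> nat (v (a j) - N) \<le> nat (v (x j) - N)"
      using ex_has_least_nat[of "\<lambda>x. x \<in> S \<and> x j \<noteq> 0", OF x0, of "\<lambda>x. nat (v (x j) - N)"] by blast
    have ge: "N \<le> v (x j)" if "x \<in> S" "x j \<noteq> 0" for x
      using bounded[OF that(1), of j] that(2) by (simp add: val_ideal_def)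
    have le: "v (a j) \<le> v (x j)" if "x \<in> S" "x j \<noteq> 0" for x
      using least[OF that] ge[OF that] ge[OF a] by simp
    have quot: "x j / a j \<in> val_ideal v 0" if "x \<in> S" for x
      using le[OF that] a by (cases "x j = 0") (simp_all add: val_ideal_def val_divide)
    show ?thesis
    proof (cases "b j / a j \<in> val_ideal v 0")
      case False
      then have bj: "b j \<noteq> 0" "v (b j) < v (a j)"
        using a by (auto simp: val_ideal_def val_divide)
      have "inverse (b j) * x j \<in> val_ideal v 1" if "x \<in> S" for x
        using le[OF that] bj by (cases "x j = 0") (simp_all add: val_ideal_def val_mult val_inverse)
      then show ?thesis
        by (intro exI[of _ "\<lambda>i. if i = j then inverse (b j) else 0"]) (use bj one single in simp)
    next
      case True
      define clear where "clear x = (\<lambda>i. x i - x j / a j * a i)" for x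
      have clear_S: "clear x \<in> S" if "x \<in> S" for x
        unfolding clear_def by (rule diff[OF that scale[OF quot[OF that] a(1)]])
      have clear_j: "clear x j = 0" for x
        using a by (simp add: clear_def)
      have "clear b \<notin> S"
      proof
        assume cb: "clear b \<in> S"
        have "(\<lambda>i. clear b i - (- (b j / a j)) * a i) \<in> S"
          by (rule diff[OF cb scale]) (use True a in auto)
        then show False
          using bS by (simp add: clear_def)
      qed
      have "\<exists>l. (\<forall>x\<in>{x \<in> S. x j = 0}. (\<Sum>i\<in>I. l i * x i) \<in> val_ideal v 1)
          \<and> (\<Sum>i\<in>I. l i * clear b i) \<notin> val_ideal v 1"
      proof (rule insert.IH)
        show "clear b i = 0" if "i \<notin> I" for i
          using that clear_j[of b] suppb[of i] supp[OF a(1), of i] by (cases "i = j") (auto simp: clear_def)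
        show "clear b \<notin> {x \<in> S. x j = 0}"
          using \<open>clear b \<notin> S\<close> by blast
        show "x i = 0" if "x \<in> {x \<in> S. x j = 0}" "i \<notin> I" for x i
          using that supp[of x i] by (cases "i = j") auto
        show "(\<lambda>i. x i - y i) \<in> {x \<in> S. x j = 0}"
          if "x \<in> {x \<in> S. x j = 0}" "y \<in> {x \<in> S. x j = 0}" for x y
          using that diff[of x y] by simp
        show "(\<lambda>i. c * x i) \<in> {x \<in> S. x j = 0}" if "c \<in> val_ideal v 0" "x \<in> {x \<in> S. x j = 0}" for c x
          using that scale[of c x] by simp
        show "(\<lambda>i. 0) \<in> {x \<in> S. x j = 0}"
          using zero by simp
        show "x i \<in> val_ideal v N" if "x \<in> {x \<in> S. x j = 0}" for x i
          using that bounded[of x i] by simp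
      qed
      then obtain l where l: "\<And>x. x \<in> S \<Longrightarrow> x j = 0 \<Longrightarrow> (\<Sum>i\<in>I. l i * x i) \<in> val_ideal v 1"
        "(\<Sum>i\<in>I. l i * clear b i) \<notin> val_ideal v 1"
        by blast
      define l' where "l' = l(j := - (\<Sum>i\<in>I. l i * a i) / a j)"
      have sum: "(\<Sum>i\<in>insert j I. l' i * x i) = (\<Sum>i\<in>I. l i * clear x i)" for x
      proof -
        have "(\<Sum>i\<in>insert j I. l' i * x i) = l' j * x j + (\<Sum>i\<in>I. l' i * x i)"
          using insert.hyps by simp
        also have "(\<Sum>i\<in>I. l' i * x i) = (\<Sum>i\<in>I. l i * x i)"
          using insert.hyps by (intro sum.cong) (auto simp: l'_def)
        also have "l' j * x j = - (x j / a j) * (\<Sum>i\<in>I. l i * a i)"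
          by (simp add: l'_def)
        also have "\<dots> + (\<Sum>i\<in>I. l i * x i) = (\<Sum>i\<in>I. l i * clear x i)"
          by (simp add: clear_def right_diff_distrib sum_subtractf sum_distrib_left mult.left_commute
              mult.assoc sum_negf)
        finally show ?thesis .
      qed
      show ?thesis
        using l clear_S clear_j by (intro exI[of _ l']) (simp add: sum)
    qed
  qed
qed

end

context iwahori_chain
begin

text \<open>
  It suffices to pair \<open>X\<close> with matrices having a single nonzero entry, of least possible valuation.
\<close>

lemma trace_dual_a_filt:
  assumes "\<And>Y. Y \<in> a_filt \<Lambda> m \<Longrightarrow> trace (X ** Y) \<in> val_ideal v 1"
  shows "X \<in> a_filt \<Lambda> (1 - m)"
  unfolding a_filt_iff
proof (intro allI)
  fix k l
  define e where "e = (m + pos l - pos k + 3) div 4"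
  define c where "c = \<pi> powi e"
  have c: "c \<noteq> 0" "v c = e"
    using uniformizer by (simp_all add: c_def val_powi)
  define Y :: "'f^4^4" where "Y = (\<chi> i j. if i = l \<and> j = k then c else 0)"
  have "Y \<in> a_filt \<Lambda> m"
    unfolding a_filt_iff using c by (auto simp: Y_def val_ideal_def e_def)
  then have "trace (X ** Y) \<in> val_ideal v 1"
    by (rule assms)
  moreover have "trace (X ** Y) = c * X $ k $ l"
  proof -
    have "X $ i $ j * Y $ j $ i = (if j = l then if i = k then c * X $ k $ l else 0 else 0)" for i j
      by (simp add: Y_def)
    then show ?thesis
      by (simp add: trace_def matrix_matrix_mult_def)
  qed
  ultimately have "X $ k $ l \<in> val_ideal v (1 - e)"
    using c by (simp add: val_ideal_mult_left_iff)
  moreover have "(4 - t) div 4 \<le> 1 - (t + 3) div 4" for t :: int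
    by presburger
  from this[of "m + pos l - pos k"] have "(1 - m + pos k - pos l + 3) div 4 \<le> 1 - e"
    by (simp add: e_def algebra_simps)
  ultimately show "X $ k $ l \<in> val_ideal v ((1 - m + pos k - pos l + 3) div 4)"
    using val_ideal_mono by blast
qed

text \<open>
  An instance of the rule that the dual of an intersection of lattices is the sum of their
  duals, since \<open>a_filt \<Lambda> m\<close> and \<open>a_filt \<Lambda> (1 - m)\<close> are dual under the trace pairing. A functional
  separating \<open>D\<close> from the sum is \<open>X \<mapsto> trace (x X)\<close> for some \<open>x\<close>; being integral on both summands, \<open>x\<close>
  lies in the intersection, which contradicts the hypothesis on \<open>D\<close>.
\<close>

lemma sum_of_conjugate_filtrations:
  assumes g: "invertible g"
    and D: "\<And>x. x \<in> a_filt \<Lambda> (1 - m) \<Longrightarrow> matrix_inv g ** x ** g \<in> a_filt \<Lambda> (1 - m)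
      \<Longrightarrow> trace (x ** D) \<in> val_ideal v 1"
  obtains Y Z where "Y \<in> a_filt \<Lambda> m" "Z \<in> a_filt \<Lambda> m" "D = Y + g ** Z ** matrix_inv g"
proof -
  let ?S = "{Y + g ** Z ** matrix_inv g | Y Z. Y \<in> a_filt \<Lambda> m \<and> Z \<in> a_filt \<Lambda> m}"
  define fn :: "'f^4^4 \<Rightarrow> 4 \<times> 4 \<Rightarrow> 'f" where "fn X = (\<lambda>(k, l). X $ k $ l)" for X
  have fn_inj: "fn X = fn Y \<longleftrightarrow> X = Y" for X Y
    by (auto simp: fn_def fun_eq_iff vec_eq_iff)
  have pairing: "(\<Sum>i\<in>UNIV. l i * fn X i) = trace ((\<chi> i j. l (j, i)) ** X)" for l X
  proof -
    have "(\<Sum>i\<in>UNIV. l i * fn X i) = (\<Sum>i\<in>UNIV. \<Sum>j\<in>UNIV. l (i, j) * X $ i $ j)"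
      unfolding sum.cartesian_product UNIV_Times_UNIV by (simp add: fn_def case_prod_beta)
    also have "\<dots> = (\<Sum>j\<in>UNIV. \<Sum>i\<in>UNIV. l (i, j) * X $ i $ j)"
      by (rule sum.swap)
    finally show ?thesis
      by (simp add: trace_def matrix_matrix_mult_def)
  qed
  obtain M where M: "g \<in> a_filt \<Lambda> M"
    using a_filt_bounded by blast
  obtain M' where M': "matrix_inv g \<in> a_filt \<Lambda> M'"
    using a_filt_bounded by blast
  define q where "q = min m (M + m + M')"
  have S_bounded: "X $ k $ l \<in> val_ideal v (q div 4)" if X: "X \<in> ?S" for X k l
  proof -
    obtain Y Z where YZ: "Y \<in> a_filt \<Lambda> m" "Z \<in> a_filt \<Lambda> m" "X = Y + g ** Z ** matrix_inv g"
      using X by blast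
    have "g ** Z ** matrix_inv g \<in> a_filt \<Lambda> (M + m + M')"
      using M M' YZ by (intro a_filt_mult)
    note conj = this
    have "X \<in> a_filt \<Lambda> q"
      unfolding YZ(3) by (intro a_filt_add a_filt_anti[OF _ YZ(1)] a_filt_anti[OF _ conj]) (simp_all add: q_def)
    then have "X $ k $ l \<in> val_ideal v ((q + pos k - pos l + 3) div 4)"
      using a_filt_iff by blast
    then show ?thesis
      by (rule val_ideal_mono) (use pos_range[of k] pos_range[of l] in \<open>intro zdiv_mono1; simp\<close>)
  qed
  have S_diff: "X - Y \<in> ?S" if XY: "X \<in> ?S" "Y \<in> ?S" for X Y
  proof -
    obtain Y1 Z1 Y2 Z2 where *: "Y1 \<in> a_filt \<Lambda> m" "Z1 \<in> a_filt \<Lambda> m" "X = Y1 + g ** Z1 ** matrix_inv g"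
      "Y2 \<in> a_filt \<Lambda> m" "Z2 \<in> a_filt \<Lambda> m" "Y = Y2 + g ** Z2 ** matrix_inv g"
      using XY by blast
    have "X - Y = (Y1 - Y2) + g ** (Z1 - Z2) ** matrix_inv g"
      unfolding * by (simp add: matrix_ring_simps)
    then show ?thesis
      using * a_filt_diff by blast
  qed
  have S_scale: "mat c ** X \<in> ?S" if c: "c \<in> val_ideal v 0" and X: "X \<in> ?S" for c X
  proof -
    obtain Y Z where YZ: "Y \<in> a_filt \<Lambda> m" "Z \<in> a_filt \<Lambda> m" "X = Y + g ** Z ** matrix_inv g"
      using X by blast
    have "mat c ** (g ** Z ** matrix_inv g) = g ** (mat c ** Z) ** matrix_inv g"
      by (metis mat_mult_commute matrix_mul_assoc)
    then have "mat c ** X = mat c ** Y + g ** (mat c ** Z) ** matrix_inv g"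
      by (simp add: YZ matrix_add_ldistrib)
    then show ?thesis
      using YZ a_filt_integral_scale[OF c] by blast
  qed
  have "D \<in> ?S"
  proof (rule ccontr)
    assume "D \<notin> ?S"
    have "\<exists>l. (\<forall>x\<in>fn ` ?S. (\<Sum>i\<in>UNIV. l i * x i) \<in> val_ideal v 1) \<and> (\<Sum>i\<in>UNIV. l i * fn D i) \<notin> val_ideal v 1"
    proof (rule separating_functional[where N = "q div 4"])
      fix x y
      assume "x \<in> fn ` ?S" "y \<in> fn ` ?S"
      then obtain X Y where XY: "X \<in> ?S" "x = fn X" "Y \<in> ?S" "y = fn Y"
        by (elim imageE)
      have "(\<lambda>i. x i - y i) = fn (X - Y)"
        by (auto simp: XY fn_def)
      then show "(\<lambda>i. x i - y i) \<in> fn ` ?S"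
        using S_diff[OF XY(1,3)] by (simp only: imageI)
    next
      fix c x
      assume c: "c \<in> val_ideal v 0" and "x \<in> fn ` ?S"
      then obtain X where X: "X \<in> ?S" "x = fn X"
        by (elim imageE)
      have "(\<lambda>i. c * x i) = fn (mat c ** X)"
        by (auto simp: X fn_def mat_mult_left)
      then show "(\<lambda>i. c * x i) \<in> fn ` ?S"
        using S_scale[OF c X(1)] by (simp only: imageI)
    next
      have "0 = 0 + g ** 0 ** matrix_inv g"
        by simp
      then have "0 \<in> ?S"
        using a_filt_zero by blast
      moreover have "(\<lambda>i. 0) = fn 0"
        by (auto simp: fn_def)
      ultimately show "(\<lambda>i. 0) \<in> fn ` ?S"
        by (simp only: imageI)
    next
      fix x i
      assume "x \<in> fn ` ?S"
      then obtain X where X: "X \<in> ?S" "x = fn X"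
        by (elim imageE)
      show "x i \<in> val_ideal v (q div 4)"
        using S_bounded[OF X(1)] by (simp add: X(2) fn_def case_prod_beta)
    next
      show "fn D \<notin> fn ` ?S"
        using \<open>D \<notin> ?S\<close> fn_inj by (metis (no_types, lifting) imageE)
    qed simp_all
    then obtain l where l: "\<And>X. X \<in> ?S \<Longrightarrow> (\<Sum>i\<in>UNIV. l i * fn X i) \<in> val_ideal v 1"
      "(\<Sum>i\<in>UNIV. l i * fn D i) \<notin> val_ideal v 1"
      by blast
    define x where "x = (\<chi> i j. l (j, i))"
    have x: "trace (x ** X) \<in> val_ideal v 1" if "X \<in> ?S" for X
      using l(1)[OF that] by (simp add: pairing x_def)
    have "x \<in> a_filt \<Lambda> (1 - m)"
    proof (rule trace_dual_a_filt)
      fix Y assume Y: "Y \<in> a_filt \<Lambda> m"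
      have "Y = Y + g ** 0 ** matrix_inv g"
        by simp
      then have "Y \<in> ?S"
        using Y a_filt_zero by blast
      then show "trace (x ** Y) \<in> val_ideal v 1"
        by (rule x)
    qed
    moreover have "matrix_inv g ** x ** g \<in> a_filt \<Lambda> (1 - m)"
    proof (rule trace_dual_a_filt)
      fix Z assume Z: "Z \<in> a_filt \<Lambda> m"
      have "g ** Z ** matrix_inv g = 0 + g ** Z ** matrix_inv g"
        by simp
      then have "g ** Z ** matrix_inv g \<in> ?S"
        using Z a_filt_zero by blast
      then have "trace (x ** (g ** Z ** matrix_inv g)) \<in> val_ideal v 1"
        by (rule x)
      also have "trace (x ** (g ** Z ** matrix_inv g)) = trace (matrix_inv g ** x ** g ** Z)"
        using trace_mul_sym[of "x ** g ** Z" "matrix_inv g"] by (simp add: matrix_mul_assoc)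
      finally show "trace (matrix_inv g ** x ** g ** Z) \<in> val_ideal v 1" .
    qed
    ultimately have "trace (x ** D) \<in> val_ideal v 1"
      by (rule D)
    then show False
      using l(2) by (simp add: pairing x_def)
  qed
  then show thesis
    using that by blast
qed


section \<open>From characters of the group to the Lie algebra\<close>

lemma P_filt_iff: "0 < m \<Longrightarrow> p \<in> P_filt cj \<Lambda> m \<longleftrightarrow> p \<in> U22 cj \<and> p - mat 1 \<in> a_filt \<Lambda> (int m)"
  by (auto simp: P_filt_def image_iff intro!: bexI[of _ "p - mat 1"])

lemma P_filt_U22: "p \<in> P_filt cj \<Lambda> m \<Longrightarrow> p \<in> U22 cj"
  by (auto simp: P_filt_def split: if_splits)

lemma P_filt_a_filt_0: "0 < m \<Longrightarrow> p \<in> P_filt cj \<Lambda> m \<Longrightarrow> p \<in> a_filt \<Lambda> 0"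
proof -
  assume "0 < m" "p \<in> P_filt cj \<Lambda> m"
  then have "p - mat 1 \<in> a_filt \<Lambda> 0"
    using a_filt_anti[of 0 "int m"] by (simp add: P_filt_iff)
  from a_filt_add[OF this a_filt_one] show ?thesis by simp
qed

lemma P_filt_mult:
  assumes "0 < m" "p \<in> P_filt cj \<Lambda> m" "q \<in> P_filt cj \<Lambda> m"
  shows "p ** q \<in> P_filt cj \<Lambda> m"
proof -
  have eq: "p ** q - mat 1 = (p - mat 1) ** q + (q - mat 1)"
    by (simp add: matrix_ring_simps)
  have "(p - mat 1) ** q \<in> a_filt \<Lambda> (int m + 0)"
    using assms P_filt_a_filt_0 P_filt_iff by (blast intro: a_filt_mult)
  then have "p ** q - mat 1 \<in> a_filt \<Lambda> (int m)"
    unfolding eq using assms P_filt_iff by (intro a_filt_add) simp_all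
  then show ?thesis
    using assms by (simp add: P_filt_iff U22_mult)
qed

lemma P_filt_inv:
  assumes "0 < m" "p \<in> P_filt cj \<Lambda> m"
  shows "matrix_inv p \<in> P_filt cj \<Lambda> m"
proof -
  have "\<sigma> (p - mat 1) \<in> a_filt \<Lambda> (int m)"
    using assms by (simp add: P_filt_iff a_filt_sigma)
  then show ?thesis
    using assms by (simp add: P_filt_iff U22_inv_mem U22_inv sigma_diff sigma_one)
      (metis U22_inv U22_inv_mem)
qed

lemma P_filt_conj:
  assumes m: "0 < m" "p \<in> P_filt cj \<Lambda> m" and g: "g \<in> U22 cj" "g \<in> a_filt \<Lambda> 0" "matrix_inv g \<in> a_filt \<Lambda> 0"
  shows "matrix_inv g ** p ** g \<in> P_filt cj \<Lambda> m"
proof -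
  have "matrix_inv g ** p ** g - mat 1 = matrix_inv g ** (p - mat 1) ** g"
    using matrix_inv_mult[OF U22_invertible[OF g(1)]] by (simp add: matrix_ring_simps)
  moreover have "matrix_inv g ** (p - mat 1) ** g \<in> a_filt \<Lambda> (0 + int m + 0)"
    using m g by (intro a_filt_mult) (simp_all add: P_filt_iff)
  ultimately show ?thesis
    using m g by (simp add: P_filt_iff U22_mult U22_inv_mem)
qed

text \<open>
  As a perturbation of the identity, \<open>1 - y\<close> preserves the exact level of each vector. So it is
  injective, and its inverse preserves the levels too.
\<close>

lemma one_minus_inverse_exists:
  assumes y: "y \<in> a_filt \<Lambda> 1"
  shows "\<exists>z. (mat 1 - y) ** z = mat 1"
proof -
  have "shifts (mat 1) 0"
    by (simp add: shifts_def)
  then have s: "shifts (mat 1 - y) 0"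
    using shifts_perturb[of "mat 1" 0 "- y"] a_filt_minus[OF y] by simp
  have "u = w" if "(mat 1 - y) *v u = (mat 1 - y) *v w" for u w
  proof -
    have "(mat 1 - y) *v (u - w) = 0"
      using that by (simp add: matrix_vector_mult_diff_distrib)
    then have "u - w \<in> \<Lambda> i" for i
      using shiftsD[OF s, of "u - w" i] by simp
    then show ?thesis
      using chain_Inter_zero[of "u - w"] by simp
  qed
  then have "\<exists>z. z ** (mat 1 - y) = mat 1"
    by (auto simp: matrix_left_invertible_injective inj_on_def)
  then show ?thesis
    using matrix_left_right_inverse by blast
qed

lemma one_minus_inverse_integral:
  assumes y: "y \<in> a_filt \<Lambda> 1" and z: "(mat 1 - y) ** z = mat 1"
  shows "z \<in> a_filt \<Lambda> 0"
proof (rule a_filtI)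
  have "shifts (mat 1) 0"
    by (simp add: shifts_def)
  then have s: "shifts (mat 1 - y) 0"
    using shifts_perturb[of "mat 1" 0 "- y"] a_filt_minus[OF y] by simp
  fix i x
  assume "x \<in> \<Lambda> i"
  then have "(mat 1 - y) *v (z *v x) \<in> \<Lambda> (i + 0)"
    by (simp add: matrix_vector_mul_assoc z)
  then show "z *v x \<in> \<Lambda> (i + 0)"
    using shiftsD[OF s] by simp
qed

text \<open>
  The Cayley transform \<open>(1 + y)(1 - y)\<inverse> = 1 + 2y(1 - y)\<inverse>\<close>, which takes the Lie algebra to the group.
\<close>

lemma cayley_unitary:
  assumes skew: "\<sigma> y = - y" and z: "(mat 1 - y) ** z = mat 1" and x: "x = y + y"
  shows "mat 1 + x ** z \<in> U22 cj"
proof -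
  let ?h = "mat 1 + x ** z"
  have "?h = (mat 1 - y + x) ** z"
    by (simp add: z matrix_add_rdistrib)
  also have "mat 1 - y + x = mat 1 + y"
    by (simp add: x)
  finally have h: "?h = (mat 1 + y) ** z" .
  have z': "\<sigma> z ** (mat 1 + y) = mat 1"
    using arg_cong[OF z, of \<sigma>] by (simp add: sigma_mult sigma_diff sigma_one skew)
  have "\<sigma> ?h ** ?h = \<sigma> z ** (mat 1 - y) ** (mat 1 + y) ** z"
    unfolding h by (simp add: sigma_mult sigma_add sigma_one skew matrix_mul_assoc)
  also have "\<dots> = \<sigma> z ** ((mat 1 - y) ** (mat 1 + y)) ** z"
    by (simp only: matrix_mul_assoc)
  also have "(mat 1 - y) ** (mat 1 + y) = (mat 1 + y) ** (mat 1 - y)"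
    by (simp add: matrix_ring_simps)
  also have "\<sigma> z ** \<dots> ** z = \<sigma> z ** (mat 1 + y) ** ((mat 1 - y) ** z)"
    by (simp only: matrix_mul_assoc)
  also have "\<dots> = mat 1"
    by (simp add: z z')
  finally show ?thesis
    using U22_iff matrix_left_right_inverse by blast
qed

end

locale chain_character = iwahori_chain F0 v \<epsilon> s \<pi> cj \<Lambda>
  for F0 :: "'f::field set" and v :: "'f \<Rightarrow> int" and \<epsilon> s \<pi> :: 'f and cj :: "'f \<Rightarrow> 'f"
    and \<Lambda> :: "int \<Rightarrow> ('f^4) set" +
  fixes \<Omega> :: "'f \<Rightarrow> complex"
  assumes conductor: "char_of_conductor_p F0 v \<Omega>"
begin

lemma char_add: "x \<in> F0 \<Longrightarrow> y \<in> F0 \<Longrightarrow> \<Omega> (x + y) = \<Omega> x * \<Omega> y"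
  using conductor by (simp add: char_of_conductor_p_def)

lemma char_max: "x \<in> F0 \<Longrightarrow> x \<in> val_ideal v 1 \<Longrightarrow> \<Omega> x = 1"
  using conductor by (simp add: char_of_conductor_p_def)

lemma char_nonzero: "x \<in> F0 \<Longrightarrow> \<Omega> x \<noteq> 0"
  using char_add[of x "- x"] char_max[OF base_zero] base_minus by auto

abbreviation tr :: "'f \<Rightarrow> 'f" where "tr x \<equiv> x + cj x"

lemma tr_add: "tr (x + y) = tr x + tr y"
  by (simp add: cj_add)

lemma psi_eq: "psi \<Omega> cj \<beta> (mat 1 + X) = \<Omega> (tr (trace (\<beta> ** X)))"
  by (simp add: psi_def Let_def)

lemma char_tr_perturb:
  assumes "d \<in> val_ideal v 1"
  shows "\<Omega> (tr (a + d)) = \<Omega> (tr a)"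
proof -
  have "\<Omega> (tr a + tr d) = \<Omega> (tr a) * \<Omega> (tr d)"
    using trace_in_base by (rule char_add) (rule trace_in_base)
  moreover have "\<Omega> (tr d) = 1"
    using assms trace_in_base by (intro char_max) (auto intro: val_ideal_add)
  ultimately show ?thesis
    by (simp add: tr_add)
qed

text \<open>
  With \<open>z = (1 - y)\<inverse> = 1 + y z\<close>, the part of \<open>\<beta> x z\<close> beyond \<open>\<beta> x\<close> is \<open>\<beta> x y z\<close>, of degree at least
  \<open>2 (r + 1) - n > 0\<close>; so its trace is in the maximal ideal, where the character is trivial.
\<close>

lemma psi_cayley:
  assumes \<beta>: "\<beta> \<in> a_filt \<Lambda> (- int n)" and y: "y \<in> a_filt \<Lambda> (int r + 1)" and n: "n < 2 * (r + 1)"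
    and z: "(mat 1 - y) ** z = mat 1" and x: "x = y + y"
  shows "psi \<Omega> cj \<beta> (mat 1 + x ** z) = \<Omega> (tr (trace (\<beta> ** x)))"
proof -
  have xa: "x \<in> a_filt \<Lambda> (int r + 1)"
    unfolding x using y y by (rule a_filt_add)
  have y1: "y \<in> a_filt \<Lambda> 1"
    using y by (rule a_filt_anti[rotated]) simp
  have z0: "z \<in> a_filt \<Lambda> 0"
    using y1 z by (rule one_minus_inverse_integral)
  have "mat 1 + y ** z = z"
    using z by (simp add: matrix_diff_rdistrib algebra_simps)
  then have "\<beta> ** x ** z = \<beta> ** x ** (mat 1 + y ** z)"
    by simp
  also have "\<dots> = \<beta> ** x + \<beta> ** x ** y ** z"
    by (simp add: matrix_add_ldistrib matrix_mul_assoc)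
  finally have eq: "\<beta> ** (x ** z) = \<beta> ** x + \<beta> ** x ** y ** z"
    by (simp add: matrix_mul_assoc)
  have "\<beta> ** x ** y ** z \<in> a_filt \<Lambda> (- int n + (int r + 1) + (int r + 1) + 0)"
    using \<beta> y xa z0 by (intro a_filt_mult)
  then have "\<beta> ** x ** y ** z \<in> a_filt \<Lambda> 1"
    by (rule a_filt_anti[rotated]) (use n in simp)
  from trace_a_filt[OF this] show ?thesis
    by (simp add: psi_eq eq trace_add char_tr_perturb)
qed

text \<open>
  If \<open>\<psi>\<^sub>\<gamma>\<close> and the conjugate of \<open>\<psi>\<^sub>\<beta>\<close> by \<open>g\<close> agree where both are defined, then the cosets
  \<open>\<gamma> + a_filt \<Lambda> (- r)\<close> and \<open>g (\<beta> + a_filt \<Lambda> (- r)) g\<inverse>\<close> meet. On Cayley transforms the agreement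
  says that the trace pairing with \<open>D = \<gamma> - g \<beta> g\<inverse>\<close> is integral on the skew elements of
  \<open>L = a_filt \<Lambda> (r + 1) \<inter> g (a_filt \<Lambda> (r + 1)) g\<inverse>\<close>; since \<open>D\<close> is skew, this extends to all of \<open>L\<close>, and duality
  decomposes \<open>D\<close>.
\<close>

lemma intertwining_decomposition:
  assumes g: "g \<in> U22 cj" and n: "n < 2 * (r + 1)"
    and \<beta>: "\<beta> \<in> g_filt cj \<Lambda> (- int n)" and \<gamma>: "\<gamma> \<in> g_filt cj \<Lambda> (- int n)"
    and agree: "\<And>h. h \<in> P_filt cj \<Lambda> (r + 1) \<Longrightarrow> matrix_inv g ** h ** g \<in> P_filt cj \<Lambda> (r + 1)
      \<Longrightarrow> psi \<Omega> cj \<gamma> h = psi \<Omega> cj \<beta> (matrix_inv g ** h ** g)"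
  obtains Y Z where "Y \<in> a_filt \<Lambda> (- int r)" "Z \<in> a_filt \<Lambda> (- int r)"
    "\<gamma> - g ** \<beta> ** matrix_inv g = Y + g ** Z ** matrix_inv g"
proof -
  let ?i = "matrix_inv g" and ?D = "\<gamma> - g ** \<beta> ** matrix_inv g"
  let ?L = "{x. x \<in> a_filt \<Lambda> (int r + 1) \<and> matrix_inv g ** x ** g \<in> a_filt \<Lambda> (int r + 1)}"
  have inv: "invertible g"
    using g by (rule U22_invertible)
  have gi: "g ** ?i = mat 1" "?i ** g = mat 1"
    using matrix_inv_mult[OF inv] by auto
  have sg: "\<sigma> g = ?i" "\<sigma> ?i = g"
    using U22_inv[OF g] by (simp_all add: sigma_sigma)
  have skew_iff: "X \<in> u22_lie cj \<longleftrightarrow> \<sigma> X = - X" for X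
    by (auto simp: u22_lie_def eq_neg_iff_add_eq_0 add.commute)
  have \<beta>a: "\<beta> \<in> a_filt \<Lambda> (- int n)" and \<beta>s: "\<sigma> \<beta> = - \<beta>"
    and \<gamma>a: "\<gamma> \<in> a_filt \<Lambda> (- int n)" and \<gamma>s: "\<sigma> \<gamma> = - \<gamma>"
    using \<beta> \<gamma> skew_iff by (auto simp: g_filt_def)
  have Ds: "\<sigma> ?D = - ?D"
    by (simp add: sigma_diff sigma_mult sg \<beta>s \<gamma>s matrix_minus_left matrix_minus_right matrix_mul_assoc)
  have r1: "0 < r + 1" by simp
  have conj_conv: "trace (\<beta> ** (?i ** X ** g)) = trace (g ** \<beta> ** ?i ** X)" for X
    using trace_mul_sym[of "\<beta> ** ?i ** X" g] by (simp add: matrix_mul_assoc)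
  have char_one: "\<Omega> (tr (trace (?D ** (y + y)))) = 1" if y: "y \<in> ?L" "\<sigma> y = - y" for y
  proof -
    define x where "x = y + y"
    define y' where "y' = ?i ** y ** g"
    define x' where "x' = y' + y'"
    have x'_eq: "x' = ?i ** x ** g"
      unfolding x'_def x_def y'_def by (simp only: matrix_add_ldistrib matrix_add_rdistrib)
    have ya: "y \<in> a_filt \<Lambda> (int r + 1)" "y' \<in> a_filt \<Lambda> (int r + 1)"
      using y by (simp_all add: y'_def)
    have y1: "y \<in> a_filt \<Lambda> 1" "y' \<in> a_filt \<Lambda> 1"
      using ya by (auto elim: a_filt_anti[rotated])
    obtain z where z: "(mat 1 - y) ** z = mat 1"
      using one_minus_inverse_exists y1 by blast
    define z' where "z' = ?i ** z ** g"
    have cancel: "X ** g ** ?i = X" for X :: "'f^4^4"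
      by (rule matrix_mult_inv_cancel(1)[OF inv])
    have "(mat 1 - y') ** z' = ?i ** ((mat 1 - y) ** z) ** g"
      by (simp add: y'_def z'_def matrix_ring_simps cancel)
    then have z': "(mat 1 - y') ** z' = mat 1"
      by (simp add: z gi)
    have y's: "\<sigma> y' = - y'"
      by (simp add: y'_def sigma_mult sg y(2) matrix_minus_left matrix_minus_right matrix_mul_assoc)
    let ?h = "mat 1 + x ** z" and ?h' = "mat 1 + x' ** z'"
    have hh': "?i ** ?h ** g = ?h'"
      by (simp add: x'_eq z'_def matrix_ring_simps cancel gi)
    have in_P: "mat 1 + w2 ** u \<in> P_filt cj \<Lambda> (r + 1)"
      if w: "w \<in> a_filt \<Lambda> (int r + 1)" "w \<in> a_filt \<Lambda> 1" "\<sigma> w = - w" "(mat 1 - w) ** u = mat 1"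
        "w2 = w + w" for w w2 u
    proof -
      have "w2 ** u \<in> a_filt \<Lambda> (int r + 1 + 0)"
        unfolding w(5) using w(1) one_minus_inverse_integral[OF w(2,4)] by (intro a_filt_mult a_filt_add)
      then show ?thesis
        unfolding P_filt_iff[OF r1] using cayley_unitary[OF w(3-5)] by (simp add: add.commute)
    qed
    have h: "?h \<in> P_filt cj \<Lambda> (r + 1)" and h': "?h' \<in> P_filt cj \<Lambda> (r + 1)"
      using in_P[OF ya(1) y1(1) y(2) z x_def] in_P[OF ya(2) y1(2) y's z' x'_def] .
    have "psi \<Omega> cj \<gamma> ?h = psi \<Omega> cj \<beta> ?h'"
      using agree[OF h] h' unfolding hh' by blast
    then have "\<Omega> (tr (trace (\<gamma> ** x))) = \<Omega> (tr (trace (\<beta> ** x')))"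
      unfolding psi_cayley[OF \<gamma>a ya(1) n z x_def] psi_cayley[OF \<beta>a ya(2) n z' x'_def] .
    moreover have "trace (\<beta> ** x') = trace (g ** \<beta> ** ?i ** x)"
      unfolding conj_conv[symmetric] x'_eq ..
    moreover have "trace (\<gamma> ** x) = trace (?D ** x) + trace (g ** \<beta> ** ?i ** x)"
      by (simp add: matrix_diff_rdistrib trace_sub)
    ultimately have "\<Omega> (tr (trace (?D ** x)) + tr (trace (g ** \<beta> ** ?i ** x))) =
        \<Omega> (tr (trace (g ** \<beta> ** ?i ** x)))"
      by (simp only: tr_add)
    then have "\<Omega> (tr (trace (?D ** x))) = 1"
      using char_add[OF trace_in_base trace_in_base] char_nonzero[OF trace_in_base] by simp
    then show ?thesis
      unfolding x_def .
  qed
  have L_scale: "mat c ** x \<in> ?L" if c: "c \<in> val_ideal v 0" and x: "x \<in> ?L" for c x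
  proof -
    have "?i ** (mat c ** x) ** g = mat c ** (?i ** x ** g)"
      by (metis mat_mult_commute matrix_mul_assoc)
    then show ?thesis
      using x a_filt_integral_scale[OF c] by simp
  qed
  have scale_trace: "trace (X ** (mat c ** Y)) = c * trace (X ** Y)" for X Y :: "'f^4^4" and c
  proof -
    have "X ** (mat c ** Y) = mat c ** (X ** Y)"
      by (metis mat_mult_commute matrix_mul_assoc)
    then show ?thesis
      by (simp add: mat_mult_left trace_def sum_distrib_left)
  qed
  \<comment> \<open>Scaling by integers \<open>c\<close> of the base field stays in the lattice, so the character is trivial on the whole ideal generated by \<open>t\<close>; its conductor then forces \<open>t\<close> into the maximal ideal.\<close>
  have skew_integral: "tr (trace (?D ** y)) \<in> val_ideal v 1" if y: "y \<in> ?L" "\<sigma> y = - y" for y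
  proof -
    define t where "t = tr (trace (?D ** (y + y)))"
    have t: "t \<in> F0"
      unfolding t_def by (rule trace_in_base)
    have one: "\<Omega> (c * t) = 1" if c: "c \<in> F0" "c \<in> val_ideal v 0" for c
    proof -
      have cy: "mat c ** y + mat c ** y = mat c ** (y + y)"
        by (simp only: matrix_add_ldistrib)
      have "\<sigma> (mat c ** y) = - (mat c ** y)"
        using y(2) cj_base[OF c(1)] by (simp add: vec_eq_iff sigma_entry mat_mult_left cj_mult)
      from char_one[OF L_scale[OF c(2) y(1)] this] show ?thesis
        unfolding cy scale_trace by (simp add: t_def cj_mult cj_base[OF c(1)] distrib_left)
    qed
    have "t \<in> val_ideal v 1"
    proof (rule ccontr)
      assume nt: "t \<notin> val_ideal v 1"
      then have t0: "t \<noteq> 0" "v t \<le> 0"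
        by (auto simp: val_ideal_def)
      obtain u where u: "u \<in> F0" "u \<in> val_ideal v 0" "\<Omega> u \<noteq> 1"
        using conductor by (auto simp: char_of_conductor_p_def)
      have "u / t \<in> val_ideal v 0"
        using u t0 by (cases "u = 0") (auto simp: val_ideal_def val_divide)
      then have "\<Omega> (u / t * t) = 1"
        using u t base_divide by (intro one)
      then show False
        using u t0 by simp
    qed
    moreover have "t = 2 * tr (trace (?D ** y))"
      unfolding t_def matrix_add_ldistrib trace_add cj_add by simp
    ultimately show ?thesis
      by (simp only: two_mult_in_val_ideal_iff)
  qed
  have integral: "tr (trace (?D ** x)) \<in> val_ideal v 1" if x: "x \<in> ?L" for x
  proof -
    have "\<sigma> (?i ** x ** g) = ?i ** \<sigma> x ** g"
      by (simp add: sigma_mult sg matrix_mul_assoc)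
    then have "x - \<sigma> x \<in> ?L"
      using x a_filt_sigma[of x "int r + 1"] a_filt_sigma[of "?i ** x ** g" "int r + 1"]
      by (simp add: matrix_diff_ldistrib matrix_diff_rdistrib a_filt_diff)
    moreover have "\<sigma> (x - \<sigma> x) = - (x - \<sigma> x)"
      by (simp add: sigma_diff sigma_sigma)
    ultimately have int: "tr (trace (?D ** (x - \<sigma> x))) \<in> val_ideal v 1"
      by (rule skew_integral)
    \<comment> \<open>Since \<open>D\<close> is skew, replacing \<open>x\<close> by its skew part \<open>x - \<sigma> x\<close> merely doubles the pairing.\<close>
    have "\<sigma> (x ** ?D) = - (?D ** \<sigma> x)"
      unfolding sigma_mult Ds matrix_minus_left ..
    moreover have "trace (- X) = - trace X" for X :: "'f^4^4"
      by (simp add: trace_def sum_negf)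
    ultimately have "trace (?D ** \<sigma> x) = - trace (\<sigma> (x ** ?D))"
      by (simp only: minus_minus)
    also have "\<dots> = - cj (trace (?D ** x))"
      unfolding trace_sigma trace_mul_sym[of x] ..
    finally have "trace (?D ** (x - \<sigma> x)) = tr (trace (?D ** x))"
      by (simp add: matrix_diff_ldistrib trace_sub)
    then have "tr (trace (?D ** (x - \<sigma> x))) = 2 * tr (trace (?D ** x))"
      by (simp add: cj_add)
    with int show ?thesis
      by (simp only: two_mult_in_val_ideal_iff)
  qed
  have "trace (x ** ?D) \<in> val_ideal v 1" if x: "x \<in> ?L" for x
    unfolding trace_mul_sym[of x]
  proof (rule trace_form_perfect)
    fix c
    assume "c \<in> val_ideal v 0"
    from integral[OF L_scale[OF this x]] show "tr (c * trace (?D ** x)) \<in> val_ideal v 1"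
      by (simp add: scale_trace)
  qed
  then have "trace (x ** ?D) \<in> val_ideal v 1"
    if "x \<in> a_filt \<Lambda> (1 - - int r)" "?i ** x ** g \<in> a_filt \<Lambda> (1 - - int r)" for x
    using that by (simp add: add.commute)
  then show thesis
    by (rule sum_of_conjugate_filtrations[OF inv, where m = "- int r"]) (assumption | rule that)+
qed

end


section \<open>Finite quotients of congruence subgroups\<close>

context unramified_quadratic_extension
begin

text \<open>
  The residue field is represented by cosets; a finite set of representatives is easier to
  combine into representatives for \<open>F\<close> and for higher powers of the maximal ideal.
\<close>

lemma base_residues_finite:
  obtains R where "finite R" "\<And>x. x \<in> F0 \<Longrightarrow> x \<in> val_ideal v 0 \<Longrightarrow> \<exists>r\<in>R. x - r \<in> val_ideal v 1"
proof -
  define C where "C a = {i + a | i. i \<in> F0 \<inter> val_ideal v 1}" for a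
  have C: "C a = (\<Union>i\<in>F0 \<inter> val_ideal v 1. {i + a})" for a
    unfolding C_def by blast
  have "carrier (residue_field F0 v) = C ` (F0 \<inter> val_ideal v 0)"
    by (simp add: residue_field_def FactRing_def A_RCOSETS_defs RCOSETS_def
        val_ring_def a_r_coset_defs C UNION_singleton_eq_range)
  then have fin: "finite (C ` (F0 \<inter> val_ideal v 0))"
    using base.finite_residue_field by simp
  obtain R where R: "R \<subseteq> F0 \<inter> val_ideal v 0" "finite R" "C ` (F0 \<inter> val_ideal v 0) = C ` R"
    using finite_subset_image[OF fin subset_refl] by blast
  show thesis
  proof
    show "finite R" by fact
    fix x assume "x \<in> F0" "x \<in> val_ideal v 0"
    then have "C x \<in> C ` R"
      using R(3) by blast
    then obtain r where r: "r \<in> R" "C x = C r"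
      by blast
    have "x \<in> C x"
      unfolding C_def using base_zero by (intro CollectI exI[of _ 0]) simp
    then have "x \<in> C r"
      by (simp only: r(2))
    then obtain i where i: "x = i + r" "i \<in> val_ideal v 1"
      unfolding C_def by blast
    then have "x - r \<in> val_ideal v 1"
      by simp
    then show "\<exists>r\<in>R. x - r \<in> val_ideal v 1"
      using r(1) by blast
  qed
qed

text \<open>
  The basis \<open>1, s\<close> reduces the case \<open>N = 1\<close> to the base field, and \<open>\<pi>\<close>-adic digits give the powers
  of the maximal ideal.
\<close>

lemma residues_finite:
  obtains R where "finite R" "\<And>x. x \<in> val_ideal v 0 \<Longrightarrow> \<exists>r\<in>R. x - r \<in> val_ideal v (int N)"
proof -
  obtain R0 where R0: "finite R0" "\<And>x. x \<in> F0 \<Longrightarrow> x \<in> val_ideal v 0 \<Longrightarrow> \<exists>r\<in>R0. x - r \<in> val_ideal v 1"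
    using base_residues_finite by blast
  define R1 where "R1 = (\<lambda>(a, b). a + b * s) ` (R0 \<times> R0)"
  have R1: "\<exists>r\<in>R1. x - r \<in> val_ideal v 1" if x: "x \<in> val_ideal v 0" for x
  proof -
    obtain a b where ab: "a \<in> F0" "b \<in> F0" "x = a + b * s"
      using generates by metis
    then have "a \<in> val_ideal v 0" "b \<in> val_ideal v 0"
      using components_in_val_ideal x by blast+
    then obtain c d where cd: "c \<in> R0" "d \<in> R0" "a - c \<in> val_ideal v 1" "b - d \<in> val_ideal v 1"
      using R0(2)[OF ab(1)] R0(2)[OF ab(2)] by blast
    have "s * (b - d) \<in> val_ideal v 1"
      using cd(4) by (intro val_ideal_integral_mult) (simp_all add: val_ideal_def val_sqrt)
    then have "(a - c) + s * (b - d) \<in> val_ideal v 1"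
      using cd(3) by (simp add: val_ideal_add)
    also have "(a - c) + s * (b - d) = x - (c + d * s)"
      by (simp add: ab algebra_simps)
    finally have "x - (c + d * s) \<in> val_ideal v 1" .
    moreover have "c + d * s \<in> R1"
      unfolding R1_def using cd by (intro image_eqI[of _ _ "(c, d)"]) simp_all
    ultimately show ?thesis by blast
  qed
  have "\<exists>R. finite R \<and> (\<forall>x\<in>val_ideal v 0. \<exists>r\<in>R. x - r \<in> val_ideal v (int N))"
  proof (induction N)
    case 0
    show ?case
      by (rule exI[of _ "{0}"]) simp
  next
    case (Suc N)
    then obtain R where R: "finite R" "\<And>x. x \<in> val_ideal v 0 \<Longrightarrow> \<exists>r\<in>R. x - r \<in> val_ideal v (int N)"
      by blast
    have p: "\<pi> ^ N \<noteq> 0" "v (\<pi> ^ N) = int N"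
      using uniformizer by (simp_all add: val_power)
    let ?R = "(\<lambda>(r, t). r + \<pi> ^ N * t) ` (R \<times> R1)"
    have "\<exists>r\<in>?R. x - r \<in> val_ideal v (int (Suc N))" if x: "x \<in> val_ideal v 0" for x
    proof -
      obtain r where r: "r \<in> R" "x - r \<in> val_ideal v (int N)"
        using R x by blast
      define y where "y = (x - r) / \<pi> ^ N"
      have xr: "x - r = \<pi> ^ N * y"
        using p by (simp add: y_def)
      then have "y \<in> val_ideal v 0"
        using r p by (simp add: val_ideal_mult_left_iff)
      then obtain t where t: "t \<in> R1" "y - t \<in> val_ideal v 1"
        using R1 by blast
      then have "\<pi> ^ N * (y - t) \<in> val_ideal v (int (Suc N))"
        using p by (simp add: val_ideal_mult_left_iff)
      also have "\<pi> ^ N * (y - t) = x - (r + \<pi> ^ N * t)"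
        using xr by (simp add: algebra_simps)
      finally have "x - (r + \<pi> ^ N * t) \<in> val_ideal v (int (Suc N))" .
      moreover have "r + \<pi> ^ N * t \<in> ?R"
        using r t by (intro image_eqI[of _ _ "(r, t)"]) simp_all
      ultimately show ?thesis by blast
    qed
    moreover have "finite ?R"
      using R R0 by (simp add: R1_def)
    ultimately show ?case by blast
  qed
  then show thesis
    using that by blast
qed

end

context iwahori_chain
begin

lemma a_filt_of_entries:
  assumes "\<And>k l. X $ k $ l \<in> val_ideal v N"
  shows "X \<in> a_filt \<Lambda> (4 * N - 6)"
  unfolding a_filt_iff
proof (intro allI)
  fix k l
  have "(4 * N - 6 + pos k - pos l + 3) div 4 \<le> N"
    using pos_range[of k] pos_range[of l] by (simp add: div_4_le_iff)
  then show "X $ k $ l \<in> val_ideal v ((4 * N - 6 + pos k - pos l + 3) div 4)"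
    using assms val_ideal_mono by blast
qed

lemma a_filt_entries:
  assumes "X \<in> a_filt \<Lambda> (4 * N)"
  shows "X $ k $ l \<in> val_ideal v N"
proof -
  have "N = (4 * N) div 4" by simp
  also have "\<dots> \<le> (4 * N + pos k - pos l + 3) div 4"
    using pos_range[of k] pos_range[of l] by (intro zdiv_mono1) simp_all
  finally show ?thesis
    using assms a_filt_iff val_ideal_mono by blast
qed

text \<open>
  A function of integral matrices that depends only on the entries modulo a power of the maximal
  ideal has finitely many values. This replaces compactness of congruence subgroups.
\<close>

lemma finite_image_of_congruence_invariant:
  fixes f :: "'f^4^4 \<Rightarrow> 'b"
  assumes P: "P \<subseteq> a_filt \<Lambda> 0"
    and f: "\<And>p q. p \<in> P \<Longrightarrow> q \<in> P \<Longrightarrow> p - q \<in> a_filt \<Lambda> m \<Longrightarrow> f p = f q"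
  shows "finite (f ` P)"
proof -
  define N where "N = nat (max 0 m) + 2"
  have N: "m \<le> 4 * int N - 6"
    by (simp add: N_def)
  obtain R where R: "finite R" "\<And>x. x \<in> val_ideal v 0 \<Longrightarrow> \<exists>r\<in>R. x - r \<in> val_ideal v (int N)"
    using residues_finite by blast
  define red where "red x = (SOME r. r \<in> R \<and> x - r \<in> val_ideal v (int N))" for x
  have red: "red x \<in> R \<and> x - red x \<in> val_ideal v (int N)" if "x \<in> val_ideal v 0" for x
    unfolding red_def by (rule someI_ex) (use R(2)[OF that] in blast)
  define rd where "rd p = (\<lambda>(k, l). red (p $ k $ l))" for p :: "'f^4^4"
  have ent: "p $ k $ l \<in> val_ideal v 0" if "p \<in> P" for p k l
    using a_filt_entries[of p 0] P that by auto
  have "rd ` P \<subseteq> (\<Pi>\<^sub>E i\<in>UNIV. R)"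
    using red ent by (auto simp: rd_def)
  then have fin: "finite (rd ` P)"
    using R finite_PiE[of "UNIV :: (4 \<times> 4) set" "\<lambda>_. R"] finite_subset by auto
  have same: "f p = f q" if pq: "p \<in> P" "q \<in> P" "rd p = rd q" for p q
  proof -
    have "p - q \<in> a_filt \<Lambda> (4 * int N - 6)"
    proof (rule a_filt_of_entries)
      fix k l
      have "red (p $ k $ l) = red (q $ k $ l)"
        using fun_cong[OF pq(3), of "(k, l)"] by (simp add: rd_def)
      moreover have "p $ k $ l - red (p $ k $ l) - (q $ k $ l - red (q $ k $ l)) \<in> val_ideal v (int N)"
        using red[OF ent[OF pq(1)], of k l] red[OF ent[OF pq(2)], of k l] by (rule val_ideal_diff[OF conjunct2 conjunct2])
      ultimately show "(p - q) $ k $ l \<in> val_ideal v (int N)"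
        by simp
    qed
    from a_filt_anti[OF N this] show ?thesis
      by (rule f[OF pq(1,2)])
  qed
  have "f ` P \<subseteq> (\<lambda>x. f (SOME p. p \<in> P \<and> rd p = x)) ` rd ` P"
  proof
    fix y assume "y \<in> f ` P"
    then obtain p where p: "p \<in> P" "y = f p" by blast
    have q: "(SOME q. q \<in> P \<and> rd q = rd p) \<in> P \<and> rd (SOME q. q \<in> P \<and> rd q = rd p) = rd p"
      by (rule someI[of _ p]) (use p in simp)
    have "f (SOME q. q \<in> P \<and> rd q = rd p) = y"
      unfolding p(2) by (rule same) (use p q in blast)+
    then show "y \<in> (\<lambda>x. f (SOME p. p \<in> P \<and> rd p = x)) ` rd ` P"
      using p(1) by blast
  qed
  then show ?thesis
    by (rule finite_subset) (use fin in blast)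
qed

end


section \<open>Characters in an irreducible representation intertwine\<close>

context iwahori_chain
begin

text \<open>
  Translates of \<open>w1\<close> span the representation, so \<open>w2\<close> is a finite sum of vectors \<open>\<rho> g w1\<close>. Averaging
  \<open>\<chi>2 p\<inverse> \<rho> p\<close> over \<open>P\<close> does not kill \<open>w2\<close>, but it kills \<open>\<rho> g w1\<close> if \<open>\<chi>2\<close> and the conjugate
  of \<open>\<chi>1\<close> by \<open>g\<close> differ on the intersection of \<open>P\<close> and its conjugate. To make the average finite, all vectors
  involved are placed in the fixed space of a small normal subgroup \<open>K\<close> of \<open>P\<close>, where
  only finitely many operators \<open>\<chi>2 p\<inverse> \<rho> p\<close> occur; right translation permutes them.
\<close>

lemma intertwining_element_exists:
  fixes smul :: "complex \<Rightarrow> 'w::ab_group_add \<Rightarrow> 'w" and \<rho> :: "'f^4^4 \<Rightarrow> 'w \<Rightarrow> 'w"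
  assumes irr: "irreducible_smooth_rep smul (U22 cj) \<rho> v" and m: "0 < m"
    and w1: "w1 \<noteq> 0" "\<And>p. p \<in> P_filt cj \<Lambda> m \<Longrightarrow> \<rho> p w1 = smul (\<chi>1 p) w1"
    and w2: "w2 \<noteq> 0" "\<And>p. p \<in> P_filt cj \<Lambda> m \<Longrightarrow> \<rho> p w2 = smul (\<chi>2 p) w2"
  shows "\<exists>g\<in>U22 cj. \<forall>h\<in>P_filt cj \<Lambda> m. matrix_inv g ** h ** g \<in> P_filt cj \<Lambda> m
    \<longrightarrow> \<chi>2 h = \<chi>1 (matrix_inv g ** h ** g)"
proof (rule ccontr)
  assume none: "\<not> ?thesis"
  interpret irreducible_smooth_rep smul "U22 cj" \<rho> v
    by (rule irr)
  let ?P = "P_filt cj \<Lambda> m"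
  have PG: "p \<in> ?P \<Longrightarrow> p \<in> U22 cj" for p
    by (rule P_filt_U22)
  have rep_add: "\<rho> g (x + y) = \<rho> g x + \<rho> g y" and rep_scale: "\<rho> g (smul c x) = smul c (\<rho> g x)"
    if "g \<in> U22 cj" for g x y c
    using rep_linear[OF that] by (simp_all add: Vector_Spaces.linear_iff)
  have rep_comp: "\<rho> g (\<rho> h x) = \<rho> (g ** h) x" if "g \<in> U22 cj" "h \<in> U22 cj" for g h x
    using rep_mult[OF that] by simp
  have rep_zero: "\<rho> g 0 = 0" if "g \<in> U22 cj" for g
    using rep_scale[OF that, of 0 0] by simp
  have inv: "g ** matrix_inv g = mat 1" "matrix_inv g ** g = mat 1" if "g \<in> U22 cj" for g
    using matrix_inv_mult U22_invertible[OF that] by auto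
  have "span ((\<lambda>g. \<rho> g w1) ` U22 cj) = {0} \<or> span ((\<lambda>g. \<rho> g w1) ` U22 cj) = UNIV"
  proof (rule irreducible)
    show "subspace (span ((\<lambda>g. \<rho> g w1) ` U22 cj))"
      by (rule subspace_span)
    fix g assume g: "g \<in> U22 cj"
    show "\<rho> g ` span ((\<lambda>g. \<rho> g w1) ` U22 cj) \<subseteq> span ((\<lambda>g. \<rho> g w1) ` U22 cj)"
    proof
      fix y assume "y \<in> \<rho> g ` span ((\<lambda>g. \<rho> g w1) ` U22 cj)"
      then obtain x where x: "x \<in> span ((\<lambda>g. \<rho> g w1) ` U22 cj)" "y = \<rho> g x"
        by blast
      have "\<rho> g x \<in> span ((\<lambda>g. \<rho> g w1) ` U22 cj)"
        using x(1)
      proof (induction rule: span_induct_alt)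
        case base
        show ?case using rep_zero[OF g] span_zero by simp
      next
        case (step c x y)
        then obtain h where h: "h \<in> U22 cj" "x = \<rho> h w1" by blast
        have "\<rho> g x \<in> span ((\<lambda>g. \<rho> g w1) ` U22 cj)"
          using h g U22_mult[OF g h(1)] by (auto simp: rep_comp intro!: span_base)
        then show ?case
          using step by (simp add: rep_add[OF g] rep_scale[OF g] span_add span_scale)
      qed
      then show "y \<in> span ((\<lambda>g. \<rho> g w1) ` U22 cj)"
        using x by simp
    qed
  qed
  moreover have "w1 \<in> span ((\<lambda>g. \<rho> g w1) ` U22 cj)"
    using U22_one rep_one by (intro span_base image_eqI[of _ _ "mat 1"]) simp_all
  ultimately have "w2 \<in> span ((\<lambda>g. \<rho> g w1) ` U22 cj)"
    using w1 by auto
  then obtain t a where t: "finite t" "t \<subseteq> (\<lambda>g. \<rho> g w1) ` U22 cj" "w2 = (\<Sum>x\<in>t. smul (a x) x)"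
    unfolding span_explicit by blast
  have "\<exists>N. \<forall>k\<in>U22 cj. (\<forall>i j. (k - mat 1) $ i $ j \<in> val_ideal v N) \<longrightarrow> \<rho> k x = x" for x
    using smooth[of x] U22_one rep_one unfolding open_in_group_def by fastforce
  then obtain N where N: "\<And>x k. k \<in> U22 cj \<Longrightarrow> (\<forall>i j. (k - mat 1) $ i $ j \<in> val_ideal v (N x)) \<Longrightarrow> \<rho> k x = x"
    by metis
  \<comment> \<open>One congruence condition that fixes all the vectors occurring in the expansion of \<open>w2\<close>.\<close>
  define N0 where "N0 = Max (insert 0 (N ` insert w2 t))"
  have N0: "N x \<le> N0" if "x \<in> insert w2 t" for x
    unfolding N0_def using t that by (intro Max_ge) auto
  define K where "K = {k \<in> U22 cj. k - mat 1 \<in> a_filt \<Lambda> (4 * N0)}"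
  have K_fix: "\<rho> k x = x" if "k \<in> K" "x \<in> insert w2 t" for k x
  proof (rule N)
    show "k \<in> U22 cj"
      using that by (simp add: K_def)
    show "\<forall>i j. (k - mat 1) $ i $ j \<in> val_ideal v (N x)"
      using that a_filt_entries val_ideal_mono[OF _ N0] unfolding K_def by blast
  qed
  have K_conj: "matrix_inv p ** k ** p \<in> K" if k: "k \<in> K" and p: "p \<in> ?P" for k p
  proof -
    have pG: "p \<in> U22 cj" by (rule PG[OF p])
    have "matrix_inv p ** k ** p - mat 1 = matrix_inv p ** (k - mat 1) ** p"
      using inv[OF pG] by (simp add: matrix_ring_simps)
    moreover have "matrix_inv p ** (k - mat 1) ** p \<in> a_filt \<Lambda> (0 + 4 * N0 + 0)"
      using k P_filt_a_filt_0[OF m p] P_filt_a_filt_0[OF m P_filt_inv[OF m p]]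
      by (intro a_filt_mult) (simp_all add: K_def)
    ultimately show ?thesis
      using k pG by (simp add: K_def U22_mult U22_inv_mem)
  qed
  define W where "W = {x. \<forall>k\<in>K. \<rho> k x = x}"
  have KG: "k \<in> U22 cj" if "k \<in> K" for k
    using that by (simp add: K_def)
  have W_add: "x + y \<in> W" if "x \<in> W" "y \<in> W" for x y
    using that rep_add KG by (simp add: W_def)
  have W_scale: "smul c x \<in> W" if "x \<in> W" for x c
    using that rep_scale KG by (simp add: W_def)
  have W_zero: "0 \<in> W"
    using rep_zero KG by (simp add: W_def)
  have tW: "t \<subseteq> W" and w2W: "w2 \<in> W"
    using K_fix by (auto simp: W_def)
  have W_rep: "\<rho> p x \<in> W" if p: "p \<in> ?P" and x: "x \<in> W" for p x
    unfolding W_def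
  proof (intro CollectI ballI)
    fix k assume k: "k \<in> K"
    have pG: "p \<in> U22 cj" by (rule PG[OF p])
    have kG: "k \<in> U22 cj" by (rule KG[OF k])
    have "k ** p = p ** (matrix_inv p ** k ** p)"
      using inv[OF pG] by (simp add: matrix_mul_assoc)
    then have "\<rho> k (\<rho> p x) = \<rho> p (\<rho> (matrix_inv p ** k ** p) x)"
      using pG kG by (simp add: rep_comp U22_mult U22_inv_mem)
    then show "\<rho> k (\<rho> p x) = \<rho> p x"
      using x K_conj[OF k p] by (simp add: W_def)
  qed
  have \<chi>_nz: "\<chi>2 p \<noteq> 0" if p: "p \<in> ?P" for p
  proof
    assume "\<chi>2 p = 0"
    then have "\<rho> p w2 = 0"
      using w2(2)[OF p] by simp
    then have "\<rho> (matrix_inv p) (\<rho> p w2) = 0"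
      using rep_zero U22_inv_mem[OF PG[OF p]] by simp
    then show False
      using w2(1) PG[OF p] by (simp add: rep_comp U22_inv_mem inv rep_one)
  qed
  have \<chi>_mult: "\<chi>2 (p ** q) = \<chi>2 p * \<chi>2 q" if p: "p \<in> ?P" and q: "q \<in> ?P" for p q
  proof -
    have "smul (\<chi>2 (p ** q)) w2 = \<rho> p (\<rho> q w2)"
      using w2(2)[OF P_filt_mult[OF m p q]] PG[OF p] PG[OF q] by (simp add: rep_comp)
    also have "\<dots> = smul (\<chi>2 p * \<chi>2 q) w2"
      using w2(2)[OF p] w2(2)[OF q] PG[OF p] by (simp add: rep_scale mult.commute)
    finally show ?thesis
      using w2(1) by (simp add: scale_right_imp_eq)
  qed
  \<comment> \<open>Restricting to \<open>W\<close>, by the value \<open>0\<close> elsewhere, makes equality of operators depend on \<open>p\<close> modulo \<open>K\<close> only.\<close>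
  define \<phi> where "\<phi> p = (\<lambda>x. if x \<in> W then smul (inverse (\<chi>2 p)) (\<rho> p x) else 0)" for p
  define E where "E = \<phi> ` ?P"
  have E_finite: "finite E"
    unfolding E_def
  proof (rule finite_image_of_congruence_invariant)
    show "?P \<subseteq> a_filt \<Lambda> 0"
      using P_filt_a_filt_0[OF m] by blast
    fix p q assume p: "p \<in> ?P" and q: "q \<in> ?P" and pq: "p - q \<in> a_filt \<Lambda> (4 * N0)"
    define k where "k = matrix_inv q ** p"
    have qk: "q ** k = p"
      using inv[OF PG[OF q]] by (simp add: k_def matrix_mul_assoc)
    have "k - mat 1 = matrix_inv q ** (p - q)"
      using inv[OF PG[OF q]] by (simp add: k_def matrix_ring_simps)
    moreover have "matrix_inv q ** (p - q) \<in> a_filt \<Lambda> (0 + 4 * N0)"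
      using P_filt_a_filt_0[OF m P_filt_inv[OF m q]] pq by (rule a_filt_mult)
    ultimately have k: "k \<in> K"
      using U22_mult[OF U22_inv_mem[OF PG[OF q]] PG[OF p]] by (simp add: K_def k_def)
    have same: "\<rho> p x = \<rho> q x" if "x \<in> W" for x
      using rep_comp[OF PG[OF q] KG[OF k], of x] that k by (simp add: qk W_def)
    have "smul (\<chi>2 p) w2 = smul (\<chi>2 q) w2"
      using same[OF w2W] w2(2) p q by simp
    then have "\<chi>2 p = \<chi>2 q"
      using w2(1) by (simp add: scale_right_imp_eq)
    then show "\<phi> p = \<phi> q"
      using same by (auto simp: \<phi>_def)
  qed
  have E_ne: "E \<noteq> {}"
  proof -
    have "mat 1 \<in> ?P"
      using m by (simp add: P_filt_iff U22_one a_filt_zero)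
    then show ?thesis by (auto simp: E_def)
  qed
  define e where "e x = (\<Sum>f\<in>E. f x)" for x
  have \<phi>_W: "\<phi> p x \<in> W" if "p \<in> ?P" "x \<in> W" for p x
    using that W_rep W_scale by (simp add: \<phi>_def)
  have \<phi>_comp: "\<phi> p (\<phi> h x) = \<phi> (p ** h) x" if p: "p \<in> ?P" and h: "h \<in> ?P" and x: "x \<in> W" for p h x
    using \<phi>_W[OF h x] x PG[OF p] PG[OF h]
    by (simp add: \<phi>_def rep_scale rep_comp \<chi>_mult[OF p h] mult.commute)
  have e_translate: "e (\<phi> h x) = e x" if h: "h \<in> ?P" and x: "x \<in> W" for h x
  proof -
    define T where "T h f = (\<lambda>x. if x \<in> W then f (\<phi> h x) else 0)" for h and f :: "'w \<Rightarrow> 'w"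
    have T: "T h (\<phi> p) = \<phi> (p ** h)" if "p \<in> ?P" "h \<in> ?P" for p h
    proof
      fix x
      show "T h (\<phi> p) x = \<phi> (p ** h) x"
      proof (cases "x \<in> W")
        case True
        then show ?thesis by (simp add: T_def \<phi>_comp that)
      next
        case False
        then show ?thesis by (simp add: T_def \<phi>_def)
      qed
    qed
    have h': "matrix_inv h \<in> ?P"
      by (rule P_filt_inv[OF m h])
    have "bij_betw (T h) E E"
    proof (rule bij_betw_byWitness[where f' = "T (matrix_inv h)"])
      show "\<forall>f\<in>E. T (matrix_inv h) (T h f) = f" "\<forall>f\<in>E. T h (T (matrix_inv h) f) = f"
        using inv[OF PG[OF h]] h h' by (auto simp: E_def T P_filt_mult[OF m] simp flip: matrix_mul_assoc)
      show "T h ` E \<subseteq> E" "T (matrix_inv h) ` E \<subseteq> E"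
        using h h' by (auto simp: E_def T P_filt_mult[OF m])
    qed
    then have "(\<Sum>f\<in>E. (T h f) x) = (\<Sum>f\<in>E. f x)"
      by (rule sum.reindex_bij_betw)
    then show ?thesis
      using x by (simp add: e_def T_def)
  qed
  have e_add: "e (x + y) = e x + e y" if "x \<in> W" "y \<in> W" for x y
  proof -
    have "f (x + y) = f x + f y" if "f \<in> E" for f
      using that \<open>x \<in> W\<close> \<open>y \<in> W\<close> W_add PG rep_add by (auto simp: E_def \<phi>_def scale_right_distrib)
    then have "e (x + y) = (\<Sum>f\<in>E. f x + f y)"
      unfolding e_def by (intro sum.cong refl)
    then show ?thesis
      by (simp add: e_def sum.distrib)
  qed
  have e_scale: "e (smul c x) = smul c (e x)" if "x \<in> W" for x c
  proof -
    have "f (smul c x) = smul c (f x)" if "f \<in> E" for f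
      using that \<open>x \<in> W\<close> W_scale PG rep_scale by (auto simp: E_def \<phi>_def mult.commute)
    then have "e (smul c x) = (\<Sum>f\<in>E. smul c (f x))"
      unfolding e_def by (intro sum.cong refl)
    then show ?thesis
      by (simp add: e_def scale_sum_right)
  qed
  \<comment> \<open>On \<open>x = \<rho> g w1\<close> the operator of some \<open>h\<close> is a scalar \<open>c \<noteq> 1\<close>, whereas \<open>e\<close> is unchanged by it.\<close>
  have e_zero: "e x = 0" if x: "x \<in> t" for x
  proof -
    obtain g where g: "g \<in> U22 cj" "x = \<rho> g w1"
      using t x by blast
    obtain h where h: "h \<in> ?P" "matrix_inv g ** h ** g \<in> ?P" "\<chi>2 h \<noteq> \<chi>1 (matrix_inv g ** h ** g)"
      using none g by blast
    have xW: "x \<in> W"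
      using x tW by blast
    define c where "c = inverse (\<chi>2 h) * \<chi>1 (matrix_inv g ** h ** g)"
    have "h ** g = g ** (matrix_inv g ** h ** g)"
      using inv[OF g(1)] by (simp add: matrix_mul_assoc)
    then have "\<rho> h x = \<rho> g (\<rho> (matrix_inv g ** h ** g) w1)"
      using g PG[OF h(1)] PG[OF h(2)] by (simp add: rep_comp)
    also have "\<dots> = smul (\<chi>1 (matrix_inv g ** h ** g)) x"
      using w1(2)[OF h(2)] g by (simp add: rep_scale)
    finally have "\<phi> h x = smul c x"
      using xW by (simp add: \<phi>_def c_def)
    then have "e x = smul c (e x)"
      using e_translate[OF h(1) xW] e_scale[OF xW] by simp
    moreover have "c \<noteq> 1"
      using h \<chi>_nz[OF h(1)] by (auto simp: c_def field_simps)
    ultimately have "smul (1 - c) (e x) = 0" "1 - c \<noteq> 0"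
      by (simp_all add: scale_left_diff_distrib)
    then show ?thesis by simp
  qed
  have e_0: "e 0 = 0"
    using e_scale[OF W_zero, of 0] by simp
  have "(\<Sum>x\<in>t'. smul (a x) x) \<in> W \<and> e (\<Sum>x\<in>t'. smul (a x) x) = 0" if "t' \<subseteq> t" for t'
    using finite_subset[OF that t(1)] that
  proof (induction t' rule: finite_induct)
    case empty
    then show ?case by (simp add: W_zero e_0)
  next
    case (insert x F)
    then have "x \<in> W" "x \<in> t"
      using tW by auto
    then show ?case
      using insert by (simp add: W_add W_scale e_add e_scale e_zero)
  qed
  then have "e w2 = 0"
    using t(3) by blast
  moreover have "e w2 = smul (of_nat (card E)) w2"
  proof -
    have "f w2 = w2" if "f \<in> E" for f
      using that w2W w2(2) \<chi>_nz by (auto simp: E_def \<phi>_def)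
    then have "e w2 = (\<Sum>f\<in>E. w2)"
      unfolding e_def by (intro sum.cong refl)
    also have "\<dots> = smul (of_nat (card E)) w2"
      using E_finite by (induction E rule: finite_induct) (simp_all add: scale_left_distrib)
    finally show ?thesis .
  qed
  ultimately show False
    using w2(1) E_finite E_ne by simp
qed

end


section \<open>Conjugacy of the characters\<close>

theorem theorem3p3:
  fixes F0 :: "'f::field set" and v :: "'f \<Rightarrow> int" and \<epsilon> s \<pi> :: 'f and cj :: "'f \<Rightarrow> 'f"
    and \<Omega> :: "'f \<Rightarrow> complex"
    and \<Lambda> :: "int \<Rightarrow> ('f^4) set" and n :: nat and \<beta> \<gamma> :: "'f^4^4"
    and smul :: "complex \<Rightarrow> 'w::ab_group_add \<Rightarrow> 'w" and \<rho> :: "'f^4^4 \<Rightarrow> 'w \<Rightarrow> 'w"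
  assumes "unramified_quadratic_extension F0 v \<epsilon> s \<pi> cj"
    and "char_of_conductor_p F0 v \<Omega>"
    and "\<And>i. \<Lambda> (4 * i) = lattice_scale (\<pi> powi i) (N0 v)"
    and "\<And>i. \<Lambda> (4 * i + 1) = lattice_scale (\<pi> powi i) (N1 v)"
    and "\<And>i. \<Lambda> (4 * i + 2) = lattice_scale (\<pi> powi i) (N2 v)"
    and "\<And>i. \<Lambda> (4 * i + 3) = lattice_scale (\<pi> powi (i + 1)) (dual_lattice v cj (N1 v))"
    and "0 < n" and "coprime n 4"
    and "skew_stratum v cj \<pi> \<Lambda> n (n div 2) \<beta>" and "fundamental v \<pi> \<Lambda> n \<beta>"
    and "skew_stratum v cj \<pi> \<Lambda> n (n div 2) \<gamma>" and "fundamental v \<pi> \<Lambda> n \<gamma>"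
    and "irreducible_smooth_rep smul (U22 cj) \<rho> v"
    and "rep_contains smul \<rho> \<Omega> cj \<Lambda> (n div 2) \<beta>"
    and "rep_contains smul \<rho> \<Omega> cj \<Lambda> (n div 2) \<gamma>"
  shows "\<exists>g \<in> P_filt cj \<Lambda> 0. \<forall>x \<in> P_filt cj \<Lambda> (n div 2 + 1).
           psi \<Omega> cj \<gamma> x = psi \<Omega> cj \<beta> (g ** x ** matrix_inv g)"
proof -
  interpret unramified_quadratic_extension F0 v \<epsilon> s \<pi> cj
    by (rule assms(1))
  interpret chain_character F0 v \<epsilon> s \<pi> cj \<Lambda> \<Omega>
    by unfold_locales (fact assms(2-6))+
  define r where "r = n div 2"
  have n2: "n < 2 * (r + 1)" and rn: "r < n"
    using assms(7) by (auto simp: r_def)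
  have dual: "self_dual v cj \<Lambda>"
    and \<beta>: "\<beta> \<in> a_filt \<Lambda> (- int n)" "\<beta> \<in> g_filt cj \<Lambda> (- int n)"
    and \<gamma>: "\<gamma> \<in> a_filt \<Lambda> (- int n)" "\<gamma> \<in> g_filt cj \<Lambda> (- int n)"
    using assms(9,11) by (simp_all add: skew_stratum_def stratum_def)
  obtain w1 where w1: "w1 \<noteq> 0" "\<And>p. p \<in> P_filt cj \<Lambda> (r + 1) \<Longrightarrow> \<rho> p w1 = smul (psi \<Omega> cj \<beta> p) w1"
    using assms(14) unfolding rep_contains_def r_def by blast
  obtain w2 where w2: "w2 \<noteq> 0" "\<And>p. p \<in> P_filt cj \<Lambda> (r + 1) \<Longrightarrow> \<rho> p w2 = smul (psi \<Omega> cj \<gamma> p) w2"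
    using assms(15) unfolding rep_contains_def r_def by blast
  have "0 < r + 1" by simp
  from intertwining_element_exists[OF assms(13) this w1 w2]
  obtain g where g: "g \<in> U22 cj"
    and agree: "\<And>h. h \<in> P_filt cj \<Lambda> (r + 1) \<Longrightarrow> matrix_inv g ** h ** g \<in> P_filt cj \<Lambda> (r + 1)
      \<Longrightarrow> psi \<Omega> cj \<gamma> h = psi \<Omega> cj \<beta> (matrix_inv g ** h ** g)"
    by blast
  have inv: "g ** matrix_inv g = mat 1" "matrix_inv g ** g = mat 1"
    using matrix_inv_mult[OF U22_invertible[OF g]] by auto
  obtain Y Z where Y: "Y \<in> a_filt \<Lambda> (- int r)" and Z: "Z \<in> a_filt \<Lambda> (- int r)"
    and D: "\<gamma> - g ** \<beta> ** matrix_inv g = Y + g ** Z ** matrix_inv g"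
    using intertwining_decomposition[OF g n2 \<beta>(2) \<gamma>(2) agree] by blast
  have small: "X \<in> a_filt \<Lambda> (- int n + 1)" if "X \<in> a_filt \<Lambda> (- int r)" for X
    by (rule a_filt_anti[OF _ that]) (use rn in simp)
  \<comment> \<open>The common element of the two cosets is \<open>\<gamma> - Y = g (\<beta> + Z) g\<inverse>\<close>.\<close>
  have "shifts (\<gamma> + - Y) (- int n)"
    by (intro shifts_perturb fundamental_shifts \<gamma> assms small a_filt_minus Y)
  moreover have "shifts (\<beta> + Z) (- int n)"
    by (intro shifts_perturb fundamental_shifts \<beta> assms small Z)
  moreover have "(\<gamma> + - Y) ** g = g ** (\<beta> + Z)"
  proof -
    have "\<gamma> + - Y = g ** (\<beta> + Z) ** matrix_inv g"
      using D by (simp add: matrix_add_ldistrib matrix_add_rdistrib algebra_simps)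
    then show ?thesis
      using inv by (simp flip: matrix_mul_assoc)
  qed
  ultimately obtain c where c: "shifts g c"
    using conjugate_shifts_normalizes[OF _ _ _ U22_invertible[OF g] assms(8)] by blast
  then have g0: "shifts g 0"
    using unitary_shift_zero[OF g c dual] by simp
  then have ga: "g \<in> a_filt \<Lambda> 0"
    by (rule shifts_a_filt)
  have gi: "matrix_inv g \<in> a_filt \<Lambda> 0"
  proof (rule a_filtI)
    fix i x assume "x \<in> \<Lambda> i"
    then show "matrix_inv g *v x \<in> \<Lambda> (i + 0)"
      using shiftsD[OF g0, of "matrix_inv g *v x" i] inv by (simp add: matrix_vector_mul_assoc)
  qed
  have "matrix_inv g \<in> P_filt cj \<Lambda> 0"
    using gi U22_inv_mem[OF g] by (simp add: P_filt_def)
  moreover have "matrix_inv (matrix_inv g) = g"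
    using inv by (intro matrix_inv_eqI)
  moreover have "psi \<Omega> cj \<gamma> x = psi \<Omega> cj \<beta> (matrix_inv g ** x ** g)" if "x \<in> P_filt cj \<Lambda> (r + 1)" for x
    using agree[OF that] P_filt_conj[OF _ that g ga gi] by simp
  ultimately show ?thesis
    unfolding r_def by (intro bexI[of _ "matrix_inv g"]) simp_all
qed

end
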